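(* Let $A$ be an abelian group, $k$ a commutative ring, $G$ a finite group and $(K,\kappa)\in\mathcal{M}_G^G$. Let $\mathcal{R}_G$ be the set of reduced pairs, i.e. of those pairs in $\mathcal{M}_G^G$ whose associated element $e_{(K,\kappa)}$ does not lie in $I_G$. (a) If $(K,\kappa)\in\mathcal{R}_G$ then $\kappa$ is faithful (injective) and $K\le Z(G)$. (b) If $\kappa$ is faithful and $K\le G'$ (the commutator subgroup of $G$) then $(K,\kappa)\in\mathcal{R}_G$.
   Context: $A$ is written multiplicatively; $Z(G)$ is the center of $G$. For a finite group $K$, $K^*=\mathrm{Hom}(K,A)$. $\mathcal{M}_G$ is the set of pairs $(K,\kappa)$ with $K\le G$, $\kappa\in K^*$; $\mathcal{M}_G^G$ is the subset of pairs with $K\trianglelefteq G$ and $\kappa(gxg^{-1})=\kappa(x)$ for all $g\in G,x\in K$. An $A$-fibered $(G,H)$-biset is a left $A\times G\times H$-set, free as an $A$-set with finitely many $A$-orbits. For $(U,\phi)\in\mathcal{M}_{G\times H}$, $\left(\frac{G\times H}{U,\phi}\right)=(A\times G\times H)/U_\phi$ with $U_\phi=\{(\phi(u)^{-1},u):u\in U\}$; these are up to isomorphism the transitive ones, two being isomorphic iff the pairs are $G\times H$-conjugate. For an $A$-fibered $(G,H)$-biset $X$ and an $A$-fibered $(H,I)$-biset $Y$, let $A\times H$ act on $X\times Y$ by $(a,h)\cdot(x,y)=((a^{-1},1,h)x,(a,h,1)y)$; the orbit set is an $A\times G\times I$-set via $(a,g,i)[x,y]=[(a,g,1)x,(1,1,i)y]$,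 and $X\otimes_{AH}Y$ is its subset of elements with trivial stabilizer in $A$. $B_k^A(G,H)=k\otimes B^A(G,H)$, where $B^A(G,H)$ is the Grothendieck group of isomorphism classes of $A$-fibered $(G,H)$-bisets under disjoint union (with basis the classes $\left[\frac{G\times H}{U,\phi}\right]$); the tensor product induces bilinear compositions $B_k^A(G,H)\times B_k^A(H,I)\to B_k^A(G,I)$. $I_G=\sum_{|H|<|G|}B_k^A(G,H)\cdot B_k^A(H,G)\subseteq B_k^A(G,G)$, the sum over finite groups $H$ with $|H|<|G|$. For $(K,\kappa)\in\mathcal{M}_G^G$, $e_{(K,\kappa)}=\left[\frac{G\times G}{\Delta_K(G),\phi_\kappa}\right]$ with $\Delta_K(G)=\{(g_1,g_2)\in G\times G:g_1K=g_2K\}$ and $\phi_\kappa(g_1,g_2)=\kappa(g_1g_2^{-1})$. Thus $\mathcal{R}_G=\{(K,\kappa)\in\mathcal{M}_G^G: e_{(K,\kappa)}\notin I_G\}$.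
   Formalization: In (b) the ring k is assumed nonzero: over the zero ring every e_(K,κ) is 0 and lies in I_G, so (b) fails. The groups H in I_G are taken with natural numbers as elements, which covers all finite groups up to isomorphism. *)

theory Defs
  imports "HOL-Algebra.Ring" "HOL-Algebra.Generated_Groups" "HOL-Algebra.Group_Action"
    "HOL-Algebra.Left_Coset" "HOL-Algebra.Free_Abelian_Groups"
begin

section \<open>Abelian groups by generators and relations\<close>

definition presented_group :: "'x set \<Rightarrow> ('x \<Rightarrow>\<^sub>0 int) set \<Rightarrow> ('x \<Rightarrow>\<^sub>0 int) set monoid" where
  "presented_group S R = free_Abelian_group S Mod generate (free_Abelian_group S) R"

definition presented_class :: "'x set \<Rightarrow> ('x \<Rightarrow>\<^sub>0 int) set \<Rightarrow> ('x \<Rightarrow>\<^sub>0 int) \<Rightarrow> ('x \<Rightarrow>\<^sub>0 int) set" where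
  "presented_class S R u =
     generate (free_Abelian_group S) R #>\<^bsub>free_Abelian_group S\<^esub> u"

definition frag_bilinear ::
  "('x \<Rightarrow> 'y \<Rightarrow> 'z) \<Rightarrow> ('x \<Rightarrow>\<^sub>0 int) \<Rightarrow> ('y \<Rightarrow>\<^sub>0 int) \<Rightarrow> ('z \<Rightarrow>\<^sub>0 int)" where
  "frag_bilinear f u v = frag_extend (\<lambda>x. frag_extend (\<lambda>y. frag_of (f x y)) v) u"

text \<open>The map on cosets \<open>P\<close>, \<open>Q\<close> induced by the biadditive extension of \<open>f\<close>. The
  union ranges over all representatives and consists of one
  coset whenever the result does not depend on them.\<close>

definition induced_bilinear ::
  "'z set \<Rightarrow> ('z \<Rightarrow>\<^sub>0 int) set \<Rightarrow> ('x \<Rightarrow> 'y \<Rightarrow> 'z)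
    \<Rightarrow> ('x \<Rightarrow>\<^sub>0 int) set \<Rightarrow> ('y \<Rightarrow>\<^sub>0 int) set \<Rightarrow> ('z \<Rightarrow>\<^sub>0 int) set" where
  "induced_bilinear S R f P Q = (\<Union>u\<in>P. \<Union>v\<in>Q. presented_class S R (frag_bilinear f u v))"


section \<open>Fibered bisets\<close>

text \<open>A set together with an action of \<open>A \<times> G \<times> H\<close>.\<close>

type_synonym ('a, 'g, 'h, 'x) fbiset = "'x set \<times> ('a \<times> 'g \<times> 'h \<Rightarrow> 'x \<Rightarrow> 'x)"

definition fibered_biset ::
  "('a, 'm) monoid_scheme \<Rightarrow> ('g, 'p) monoid_scheme \<Rightarrow> ('h, 'q) monoid_scheme
    \<Rightarrow> ('a, 'g, 'h, 'x) fbiset \<Rightarrow> bool" where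
  "fibered_biset A G H X \<longleftrightarrow>
     group_action (A \<times>\<times> G \<times>\<times> H) (fst X) (snd X) \<and>
     (\<forall>x\<in>fst X. stabilizer A (\<lambda>a. snd X (a, \<one>\<^bsub>G\<^esub>, \<one>\<^bsub>H\<^esub>)) x = {\<one>\<^bsub>A\<^esub>}) \<and>
     finite (orbits A (fst X) (\<lambda>a. snd X (a, \<one>\<^bsub>G\<^esub>, \<one>\<^bsub>H\<^esub>)))"

definition fbiset_iso ::
  "('a, 'm) monoid_scheme \<Rightarrow> ('g, 'p) monoid_scheme \<Rightarrow> ('h, 'q) monoid_scheme
    \<Rightarrow> ('a, 'g, 'h, 'x) fbiset \<Rightarrow> ('a, 'g, 'h, 'y) fbiset \<Rightarrow> bool" where
  "fbiset_iso A G H X Y \<longleftrightarrow>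
     (\<exists>f. bij_betw f (fst X) (fst Y) \<and>
        (\<forall>w\<in>carrier (A \<times>\<times> G \<times>\<times> H). \<forall>x\<in>fst X. f (snd X w x) = snd Y w (f x)))"

definition fbiset_union ::
  "('a, 'g, 'h, 'x) fbiset \<Rightarrow> ('a, 'g, 'h, 'y) fbiset \<Rightarrow> ('a, 'g, 'h, 'x + 'y) fbiset" where
  "fbiset_union X Y =
     (fst X <+> fst Y, \<lambda>w. restrict (map_sum (snd X w) (snd Y w)) (fst X <+> fst Y))"

definition twisted_subgroup :: "('a, 'm) monoid_scheme \<Rightarrow> 'u set \<Rightarrow> ('u \<Rightarrow> 'a) \<Rightarrow> ('a \<times> 'u) set" where
  "twisted_subgroup A U \<phi> = {(inv\<^bsub>A\<^esub> (\<phi> u), u) | u. u \<in> U}"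

definition transitive_fbiset ::
  "('a, 'm) monoid_scheme \<Rightarrow> ('g, 'p) monoid_scheme \<Rightarrow> ('h, 'q) monoid_scheme
    \<Rightarrow> ('g \<times> 'h) set \<Rightarrow> ('g \<times> 'h \<Rightarrow> 'a) \<Rightarrow> ('a, 'g, 'h, ('a \<times> 'g \<times> 'h) set) fbiset" where
  "transitive_fbiset A G H U \<phi> =
     (let W = A \<times>\<times> G \<times>\<times> H; C = lcosets\<^bsub>W\<^esub> (twisted_subgroup A U \<phi>)
      in (C, \<lambda>w. restrict (\<lambda>c. w <#\<^bsub>W\<^esub> c) C))"

definition pair_action ::
  "('a, 'm) monoid_scheme \<Rightarrow> ('g, 'p) monoid_scheme \<Rightarrow> ('i, 'r) monoid_scheme
    \<Rightarrow> ('a, 'g, 'h, 'x) fbiset \<Rightarrow> ('a, 'h, 'i, 'y) fbiset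
    \<Rightarrow> 'a \<times> 'h \<Rightarrow> 'x \<times> 'y \<Rightarrow> 'x \<times> 'y" where
  "pair_action A G I X Y =
     (\<lambda>(a, h) (x, y). (snd X (inv\<^bsub>A\<^esub> a, \<one>\<^bsub>G\<^esub>, h) x, snd Y (a, h, \<one>\<^bsub>I\<^esub>) y))"

definition fbiset_tensor ::
  "('a, 'm) monoid_scheme \<Rightarrow> ('g, 'p) monoid_scheme \<Rightarrow> ('h, 'q) monoid_scheme
    \<Rightarrow> ('i, 'r) monoid_scheme \<Rightarrow> ('a, 'g, 'h, 'x) fbiset \<Rightarrow> ('a, 'h, 'i, 'y) fbiset
    \<Rightarrow> ('a, 'g, 'i, ('x \<times> 'y) set) fbiset" where
  "fbiset_tensor A G H I X Y =
     (let \<theta> = pair_action A G I X Y;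
          act = (\<lambda>(a, g, i) \<omega>. \<Union>(x, y)\<in>\<omega>.
                   orbit (A \<times>\<times> H) \<theta> (snd X (a, g, \<one>\<^bsub>H\<^esub>) x, snd Y (\<one>\<^bsub>A\<^esub>, \<one>\<^bsub>H\<^esub>, i) y));
          T = {\<omega> \<in> orbits (A \<times>\<times> H) (fst X \<times> fst Y) \<theta>.
                 stabilizer A (\<lambda>a. act (a, \<one>\<^bsub>G\<^esub>, \<one>\<^bsub>I\<^esub>)) \<omega> = {\<one>\<^bsub>A\<^esub>}}
      in (T, \<lambda>w. restrict (act w) T))"


section \<open>The Grothendieck group and its extension of scalars\<close>

text \<open>A free \<open>A\<close>-set with finitely many orbits embeds into \<open>A \<times> \<nat>\<close>, so every fibered biset,
  on whatever type, has isomorphic copies with points in \<open>'a \<times> nat\<close>. Its isomorphism class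
  is represented by the set of these copies.\<close>

type_synonym ('a, 'g, 'h) fbiset_class = "('a, 'g, 'h, 'a \<times> nat) fbiset set"

definition iso_class ::
  "('a, 'm) monoid_scheme \<Rightarrow> ('g, 'p) monoid_scheme \<Rightarrow> ('h, 'q) monoid_scheme
    \<Rightarrow> ('a, 'g, 'h, 'x) fbiset \<Rightarrow> ('a, 'g, 'h) fbiset_class" where
  "iso_class A G H X = {Y. fibered_biset A G H Y \<and> fbiset_iso A G H X Y}"

definition iso_classes ::
  "('a, 'm) monoid_scheme \<Rightarrow> ('g, 'p) monoid_scheme \<Rightarrow> ('h, 'q) monoid_scheme
    \<Rightarrow> ('a, 'g, 'h) fbiset_class set" where
  "iso_classes A G H =
     {iso_class A G H X | X :: ('a, 'g, 'h, 'a \<times> nat) fbiset. fibered_biset A G H X}"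

definition union_relations ::
  "('a, 'm) monoid_scheme \<Rightarrow> ('g, 'p) monoid_scheme \<Rightarrow> ('h, 'q) monoid_scheme
    \<Rightarrow> (('a, 'g, 'h) fbiset_class \<Rightarrow>\<^sub>0 int) set" where
  "union_relations A G H =
     {frag_of (iso_class A G H (fbiset_union X Y))
        - frag_of (iso_class A G H X) - frag_of (iso_class A G H Y)
      | (X :: ('a, 'g, 'h, 'a \<times> nat) fbiset) (Y :: ('a, 'g, 'h, 'a \<times> nat) fbiset).
          fibered_biset A G H X \<and> fibered_biset A G H Y}"

type_synonym ('a, 'g, 'h) burnside = "(('a, 'g, 'h) fbiset_class \<Rightarrow>\<^sub>0 int) set"

definition burnside_group ::
  "('a, 'm) monoid_scheme \<Rightarrow> ('g, 'p) monoid_scheme \<Rightarrow> ('h, 'q) monoid_scheme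
    \<Rightarrow> ('a, 'g, 'h) burnside monoid" where
  "burnside_group A G H = presented_group (iso_classes A G H) (union_relations A G H)"

definition burnside_class ::
  "('a, 'm) monoid_scheme \<Rightarrow> ('g, 'p) monoid_scheme \<Rightarrow> ('h, 'q) monoid_scheme
    \<Rightarrow> ('a, 'g, 'h, 'x) fbiset \<Rightarrow> ('a, 'g, 'h) burnside" where
  "burnside_class A G H X =
     presented_class (iso_classes A G H) (union_relations A G H) (frag_of (iso_class A G H X))"

definition class_tensor ::
  "('a, 'm) monoid_scheme \<Rightarrow> ('g, 'p) monoid_scheme \<Rightarrow> ('h, 'q) monoid_scheme
    \<Rightarrow> ('i, 'r) monoid_scheme
    \<Rightarrow> ('a, 'g, 'h) fbiset_class \<Rightarrow> ('a, 'h, 'i) fbiset_class \<Rightarrow> ('a, 'g, 'i) fbiset_class" where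
  "class_tensor A G H I c d = (\<Union>X\<in>c. \<Union>Y\<in>d. iso_class A G I (fbiset_tensor A G H I X Y))"

definition burnside_comp ::
  "('a, 'm) monoid_scheme \<Rightarrow> ('g, 'p) monoid_scheme \<Rightarrow> ('h, 'q) monoid_scheme
    \<Rightarrow> ('i, 'r) monoid_scheme
    \<Rightarrow> ('a, 'g, 'h) burnside \<Rightarrow> ('a, 'h, 'i) burnside \<Rightarrow> ('a, 'g, 'i) burnside" where
  "burnside_comp A G H I =
     induced_bilinear (iso_classes A G I) (union_relations A G I) (class_tensor A G H I)"

text \<open>The tensor product of \<open>k\<close> and \<open>B\<close> over the integers, for \<open>B\<close> an abelian group written
  multiplicatively, as generated by the symbols \<open>(r, b)\<close>.\<close>

definition tensor_generators :: "('k, 'n) ring_scheme \<Rightarrow> ('b, 'm) monoid_scheme \<Rightarrow> ('k \<times> 'b) set" where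
  "tensor_generators k B = carrier k \<times> carrier B"

definition tensor_relations ::
  "('k, 'n) ring_scheme \<Rightarrow> ('b, 'm) monoid_scheme \<Rightarrow> ('k \<times> 'b \<Rightarrow>\<^sub>0 int) set" where
  "tensor_relations k B =
     {frag_of (r \<oplus>\<^bsub>k\<^esub> s, b) - frag_of (r, b) - frag_of (s, b)
      | r s b. r \<in> carrier k \<and> s \<in> carrier k \<and> b \<in> carrier B} \<union>
     {frag_of (r, b \<otimes>\<^bsub>B\<^esub> c) - frag_of (r, b) - frag_of (r, c)
      | r b c. r \<in> carrier k \<and> b \<in> carrier B \<and> c \<in> carrier B}"

type_synonym ('k, 'a, 'g, 'h) kburnside = "('k \<times> ('a, 'g, 'h) burnside \<Rightarrow>\<^sub>0 int) set"

definition kburnside_group ::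
  "('k, 'n) ring_scheme \<Rightarrow> ('a, 'm) monoid_scheme \<Rightarrow> ('g, 'p) monoid_scheme
    \<Rightarrow> ('h, 'q) monoid_scheme \<Rightarrow> ('k, 'a, 'g, 'h) kburnside monoid" where
  "kburnside_group k A G H =
     presented_group (tensor_generators k (burnside_group A G H))
       (tensor_relations k (burnside_group A G H))"

definition kburnside_class ::
  "('k, 'n) ring_scheme \<Rightarrow> ('a, 'm) monoid_scheme \<Rightarrow> ('g, 'p) monoid_scheme
    \<Rightarrow> ('h, 'q) monoid_scheme \<Rightarrow> ('a, 'g, 'h, 'x) fbiset \<Rightarrow> ('k, 'a, 'g, 'h) kburnside" where
  "kburnside_class k A G H X =
     presented_class (tensor_generators k (burnside_group A G H))
       (tensor_relations k (burnside_group A G H))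
       (frag_of (\<one>\<^bsub>k\<^esub>, burnside_class A G H X))"

definition kburnside_comp ::
  "('k, 'n) ring_scheme \<Rightarrow> ('a, 'm) monoid_scheme \<Rightarrow> ('g, 'p) monoid_scheme
    \<Rightarrow> ('h, 'q) monoid_scheme \<Rightarrow> ('i, 'r) monoid_scheme
    \<Rightarrow> ('k, 'a, 'g, 'h) kburnside \<Rightarrow> ('k, 'a, 'h, 'i) kburnside \<Rightarrow> ('k, 'a, 'g, 'i) kburnside" where
  "kburnside_comp k A G H I =
     induced_bilinear (tensor_generators k (burnside_group A G I))
       (tensor_relations k (burnside_group A G I))
       (\<lambda>(r, b) (s, c). (r \<otimes>\<^bsub>k\<^esub> s, burnside_comp A G H I b c))"

text \<open>Every finite group is isomorphic to one with elements in \<^typ>\<open>nat\<close>, so the groups \<open>H\<close>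
  are taken there. The additive subgroup generated by the products is the sum of the
  \<open>k\<close>-submodules, because each set of products is closed under scalars.\<close>

definition I_ideal ::
  "('k, 'n) ring_scheme \<Rightarrow> ('a, 'm) monoid_scheme \<Rightarrow> ('g, 'p) monoid_scheme
    \<Rightarrow> ('k, 'a, 'g, 'g) kburnside set" where
  "I_ideal k A G =
     generate (kburnside_group k A G G)
       {kburnside_comp k A G H G P Q | (H :: nat monoid) P Q.
          group H \<and> finite (carrier H) \<and> order H < order G \<and>
          P \<in> carrier (kburnside_group k A G H) \<and> Q \<in> carrier (kburnside_group k A H G)}"


section \<open>Reduced pairs\<close>

definition M_pairs ::
  "('a, 'm) monoid_scheme \<Rightarrow> ('g, 'p) monoid_scheme \<Rightarrow> ('g set \<times> ('g \<Rightarrow> 'a)) set" where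
  "M_pairs A G = {(K, \<kappa>). subgroup K G \<and> \<kappa> \<in> hom (G\<lparr>carrier := K\<rparr>) A}"

definition M_pairs_fixed ::
  "('a, 'm) monoid_scheme \<Rightarrow> ('g, 'p) monoid_scheme \<Rightarrow> ('g set \<times> ('g \<Rightarrow> 'a)) set" where
  "M_pairs_fixed A G =
     {(K, \<kappa>) \<in> M_pairs A G. K \<lhd> G \<and>
        (\<forall>g\<in>carrier G. \<forall>x\<in>K. \<kappa> (g \<otimes>\<^bsub>G\<^esub> x \<otimes>\<^bsub>G\<^esub> inv\<^bsub>G\<^esub> g) = \<kappa> x)}"

definition Delta :: "('g, 'p) monoid_scheme \<Rightarrow> 'g set \<Rightarrow> ('g \<times> 'g) set" where
  "Delta G K = {(g1, g2) \<in> carrier G \<times> carrier G. g1 <#\<^bsub>G\<^esub> K = g2 <#\<^bsub>G\<^esub> K}"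

definition e_element ::
  "('k, 'n) ring_scheme \<Rightarrow> ('a, 'm) monoid_scheme \<Rightarrow> ('g, 'p) monoid_scheme
    \<Rightarrow> 'g set \<Rightarrow> ('g \<Rightarrow> 'a) \<Rightarrow> ('k, 'a, 'g, 'g) kburnside" where
  "e_element k A G K \<kappa> =
     kburnside_class k A G G
       (transitive_fbiset A G G (Delta G K) (\<lambda>(g1, g2). \<kappa> (g1 \<otimes>\<^bsub>G\<^esub> inv\<^bsub>G\<^esub> g2)))"

definition reduced_pairs ::
  "('k, 'n) ring_scheme \<Rightarrow> ('a, 'm) monoid_scheme \<Rightarrow> ('g, 'p) monoid_scheme
    \<Rightarrow> ('g set \<times> ('g \<Rightarrow> 'a)) set" where
  "reduced_pairs k A G = {(K, \<kappa>) \<in> M_pairs_fixed A G. e_element k A G K \<kappa> \<notin> I_ideal k A G}"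

definition center :: "('g, 'p) monoid_scheme \<Rightarrow> 'g set" where
  "center G = {z \<in> carrier G. \<forall>g\<in>carrier G. z \<otimes>\<^bsub>G\<^esub> g = g \<otimes>\<^bsub>G\<^esub> z}"

end

theory Submission
  imports Defs "HOL-Algebra.Elementary_Groups" "HOL-Algebra.Weak_Morphisms"
begin

text \<open>
  Let \<open>e\<close> be the class attached to \<open>(K, \<kappa>)\<close>. The ideal \<open>I\<^sub>G\<close> is spanned by products that pass
  through groups of smaller order; the two halves of the proposition say when \<open>e\<close> can, and when it
  cannot, be written with such products.

  Suppose that \<open>\<kappa>\<close> is not injective. Its kernel \<open>L\<close> is a nontrivial normal subgroup of \<open>G\<close>, and
  \<open>1 \<times> 1 \<times> L\<close> fixes every point of the biset of \<open>e\<close>. This biset is therefore the tensor product of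
  itself, read as a \<open>(G, G/L)\<close>-biset, with the \<open>(G/L, G)\<close>-biset \<open>A \<times> G/L\<close>
  (\<open>inflation_in_I_ideal\<close>), and \<open>e\<close> lies in \<open>I\<^sub>G\<close>. So a reduced pair has an injective \<open>\<kappa>\<close>, and
  then the invariance of \<open>\<kappa>\<close> under conjugation makes \<open>K\<close> central (\<open>inj_imp_central\<close>).

  Suppose now that \<open>\<kappa>\<close> is injective and \<open>K \<le> G'\<close>, and let \<open>S\<close> be the stabilizer of the base point
  in the biset of \<open>e\<close>. The number of \<open>A \<times> G \<times> G\<close>-orbits that contain a point with stabilizer \<open>S\<close>
  is additive on disjoint unions, so it defines a linear form on \<open>k \<otimes> B(G, G)\<close>. Its value at \<open>e\<close>
  is 1, which is nonzero in \<open>k\<close>. It vanishes on \<open>I\<^sub>G\<close>, because no point \<open>x \<otimes> y\<close> of a tensor product over a group \<open>H\<close> of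
  smaller order has stabilizer \<open>S\<close> (\<open>stabilizer_tensor_point_neq\<close>). Indeed, assume that one has,
  and let \<open>D \<le> A \<times> G \<times> H\<close> be the stabilizer of \<open>x\<close>. The diagonal of \<open>G \<times> G\<close> fixes \<open>x \<otimes> y\<close>, so
  \<open>D\<close> projects onto \<open>G\<close>. If \<open>(a, l, 1) \<in> D\<close>, then \<open>(a, l, 1)\<close> fixes \<open>x \<otimes> y\<close>, so \<open>l \<in> K\<close> and
  \<open>a = \<kappa>(l)\<^sup>-\<^sup>1\<close>; let \<open>L \<le> K\<close> be the group of these \<open>l\<close>. As \<open>A\<close> is abelian, commutators in \<open>D\<close>
  have trivial component in \<open>A\<close>, so for each \<open>l \<in> G'\<close> there is some \<open>(1, l, h) \<in> D\<close>. If \<open>l \<in> L\<close>,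
  dividing it by \<open>(\<kappa>(l)\<^sup>-\<^sup>1, l, 1)\<close> gives \<open>(\<kappa>(l), 1, h) \<in> D\<close>. As \<open>\<kappa>\<close> is injective, \<open>D\<close> thus has at
  least \<open>|L|\<close> elements over each element of \<open>G\<close>; it has at most \<open>|L|\<close> over each element of \<open>H\<close>.
  Hence \<open>|G| |L| \<le> |D| \<le> |H| |L|\<close>, a contradiction.

  Both halves compute with the composition of cosets, which requires that the composition is well
  defined. For the tensor product of bisets this comes down to one fact, \<open>tensor_emb\<close>: injective
  equivariant maps of the factors induce an injective equivariant map of the tensor products, with
  the expected image. It contains the invariance under isomorphism and the distributivity over
  disjoint unions; \<open>presented_bilinear\<close> does the rest.
\<close>

section \<open>Bilinear maps between presented abelian groups\<close>

abbreviation relators :: "'x set \<Rightarrow> ('x \<Rightarrow>\<^sub>0 int) set \<Rightarrow> ('x \<Rightarrow>\<^sub>0 int) set" where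
  "relators S R \<equiv> generate (free_Abelian_group S) R"

lemma relators_subgroup:
  assumes "R \<subseteq> carrier (free_Abelian_group S)"
  shows "subgroup (relators S R) (free_Abelian_group S)"
  using group.generate_is_subgroup[OF group_free_Abelian_group assms] .

lemma relators_keys:
  assumes "R \<subseteq> carrier (free_Abelian_group S)" "u \<in> relators S R"
  shows "Poly_Mapping.keys u \<subseteq> S"
  using subgroup.mem_carrier[OF relators_subgroup[OF assms(1)] assms(2)] by simp

lemma relators_zero: "0 \<in> relators S R"
  using generate.one[of "free_Abelian_group S" R] by simp

lemma relators_add: "u \<in> relators S R \<Longrightarrow> v \<in> relators S R \<Longrightarrow> u + v \<in> relators S R"
  using generate.eng[of u "free_Abelian_group S" R v] by simp

lemma relators_minus:
  assumes "R \<subseteq> carrier (free_Abelian_group S)" "u \<in> relators S R"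
  shows "- u \<in> relators S R"
  using subgroup.m_inv_closed[OF relators_subgroup[OF assms(1)] assms(2)]
    relators_keys[OF assms] by simp

lemma relators_diff:
  assumes "R \<subseteq> carrier (free_Abelian_group S)" "u \<in> relators S R" "v \<in> relators S R"
  shows "u - v \<in> relators S R"
  using relators_add[OF assms(2) relators_minus[OF assms(1,3)]] by simp

lemma mem_presented_class:
  "w \<in> presented_class S R u \<longleftrightarrow> w - u \<in> relators S R"
  unfolding presented_class_def r_coset_def
  by (auto simp: algebra_simps intro: bexI[of _ "w - u"])

lemma presented_class_eq_iff:
  assumes "R \<subseteq> carrier (free_Abelian_group S)"
  shows "presented_class S R u = presented_class S R v \<longleftrightarrow> u - v \<in> relators S R"
proof
  assume "presented_class S R u = presented_class S R v"
  moreover have "u \<in> presented_class S R u"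
    by (simp add: mem_presented_class relators_zero)
  ultimately show "u - v \<in> relators S R" by (simp add: mem_presented_class)
next
  assume uv: "u - v \<in> relators S R"
  have "w - u \<in> relators S R \<longleftrightarrow> w - v \<in> relators S R" for w
    using relators_add[OF _ uv, of "w - u"] relators_diff[OF assms _ uv, of "w - v"]
    by (auto simp: algebra_simps)
  then show "presented_class S R u = presented_class S R v"
    by (auto simp: mem_presented_class)
qed

lemma relators_normal:
  assumes "R \<subseteq> carrier (free_Abelian_group S)"
  shows "relators S R \<lhd> free_Abelian_group S"
  using comm_group.subgroup_imp_normal[OF abelian_free_Abelian_group relators_subgroup[OF assms]] .

lemma comm_group_presented_group:
  assumes "R \<subseteq> carrier (free_Abelian_group S)"
  shows "comm_group (presented_group S R)"
  unfolding presented_group_def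
  using comm_group.abelian_FactGroup[OF abelian_free_Abelian_group relators_subgroup[OF assms]] .

lemma carrier_presented_group:
  "carrier (presented_group S R) = presented_class S R ` {u. Poly_Mapping.keys u \<subseteq> S}"
  by (auto simp: presented_group_def FactGroup_def RCOSETS_def presented_class_def)

lemma mult_presented_group:
  assumes "R \<subseteq> carrier (free_Abelian_group S)" "Poly_Mapping.keys u \<subseteq> S" "Poly_Mapping.keys v \<subseteq> S"
  shows "presented_class S R u \<otimes>\<^bsub>presented_group S R\<^esub> presented_class S R v = presented_class S R (u + v)"
  using normal.rcos_sum[OF relators_normal[OF assms(1)], of u v] assms
  by (simp add: presented_group_def FactGroup_def presented_class_def)

lemma presented_class_hom:
  assumes "R \<subseteq> carrier (free_Abelian_group S)"
  shows "group_hom (free_Abelian_group S) (presented_group S R) (presented_class S R)"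
  using comm_group_presented_group[OF assms]
  by (auto simp: group_hom_def group_hom_axioms_def comm_group_def hom_def
      carrier_presented_group mult_presented_group[OF assms])

lemma frag_extend_in_relators:
  assumes "R1 \<subseteq> carrier (free_Abelian_group S1)" "R \<subseteq> carrier (free_Abelian_group S)"
    and "\<And>r. r \<in> R1 \<Longrightarrow> frag_extend f r \<in> relators S R"
    and "u \<in> relators S1 R1"
  shows "frag_extend f u \<in> relators S R"
  using assms(4)
proof induction
  case one
  then show ?case by (simp add: relators_zero)
next
  case (incl h)
  then show ?case by (rule assms(3))
next
  case (inv h)
  then have "Poly_Mapping.keys h \<subseteq> S1" using subsetD[OF assms(1)] by simp
  then show ?case
    using relators_minus[OF assms(2) assms(3)[OF inv]] by (simp add: frag_extend_minus)
next
  case (eng h1 h2)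
  then show ?case by (simp add: frag_extend_add relators_add)
qed

text \<open>The condition on the relations refers to an arbitrary extension \<open>h\<close> of \<open>f\<close> to the free group:
  the value of such an \<open>h\<close> at a relation follows from its values on the generators, without any
  formula for \<open>h\<close>.\<close>

lemma presented_group_universal:
  assumes R: "R \<subseteq> carrier (free_Abelian_group S)" and M: "comm_group M"
    and f: "f ` S \<subseteq> carrier M"
    and rel: "\<And>h r. \<lbrakk>h \<in> hom (free_Abelian_group S) M; \<forall>x\<in>S. h (frag_of x) = f x; r \<in> R\<rbrakk>
        \<Longrightarrow> h r = \<one>\<^bsub>M\<^esub>"
  obtains F where "F \<in> hom (presented_group S R) M"
    "\<And>x. x \<in> S \<Longrightarrow> F (presented_class S R (frag_of x)) = f x"
proof -
  interpret M: comm_group M by (rule M)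
  obtain h where h: "h \<in> hom (free_Abelian_group S) M" "\<forall>x\<in>S. h (frag_of x) = f x"
    by (rule M.free_Abelian_group_universal[OF f]) blast
  interpret h: group_hom "free_Abelian_group S" M h
    using h by (simp add: group_hom_def group_hom_axioms_def M.group_axioms)
  have kernel: "h u = \<one>\<^bsub>M\<^esub>" if "u \<in> relators S R" for u
    using that
  proof induction
    case one
    then show ?case using h.hom_one by simp
  next
    case (incl r)
    then show ?case by (rule rel[OF h])
  next
    case (inv r)
    then have "r \<in> carrier (free_Abelian_group S)" using subsetD[OF R] by blast
    then show ?case using rel[OF h inv] h.hom_inv by simp
  next
    case (eng u v)
    then show ?case using h.hom_mult[of u v] relators_keys[OF R] by simp
  qed
  \<comment> \<open>a coset is sent to the common value of \<open>h\<close> on its elements\<close>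
  have "\<exists>a. \<forall>u\<in>c. h u = a" if "c \<in> carrier (presented_group S R)" for c
  proof -
    obtain u where u: "c = presented_class S R u" "Poly_Mapping.keys u \<subseteq> S"
      using \<open>c \<in> _\<close> by (auto simp: carrier_presented_group)
    have "h w = h u" if "w \<in> c" for w
    proof -
      have w: "w - u \<in> relators S R" using that u by (simp add: mem_presented_class)
      then have "h ((w - u) + u) = h u"
        using h.hom_mult[of "w - u" u] relators_keys[OF R w] u(2) kernel[OF w] h.hom_closed[of u] by simp
      then show ?thesis by simp
    qed
    then show ?thesis by blast
  qed
  then obtain F where F: "\<And>c u. c \<in> carrier (presented_group S R) \<Longrightarrow> u \<in> c \<Longrightarrow> h u = F c"
    by metis
  have Fc: "F (presented_class S R u) = h u" if "Poly_Mapping.keys u \<subseteq> S" for u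
    using F[of "presented_class S R u" u] that
    by (simp add: carrier_presented_group mem_presented_class relators_zero)
  show thesis
  proof
    show "F \<in> hom (presented_group S R) M"
    proof (rule homI)
      fix c assume "c \<in> carrier (presented_group S R)"
      then show "F c \<in> carrier M" using Fc h.hom_closed by (auto simp: carrier_presented_group)
    next
      fix c d assume "c \<in> carrier (presented_group S R)" "d \<in> carrier (presented_group S R)"
      then obtain u v where "c = presented_class S R u" "Poly_Mapping.keys u \<subseteq> S"
        "d = presented_class S R v" "Poly_Mapping.keys v \<subseteq> S" by (auto simp: carrier_presented_group)
      moreover from this have "Poly_Mapping.keys (u + v) \<subseteq> S" using keys_add[of u v] by blast
      ultimately show "F (c \<otimes>\<^bsub>presented_group S R\<^esub> d) = F c \<otimes>\<^bsub>M\<^esub> F d"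
        using h.hom_mult[of u v] by (simp add: mult_presented_group[OF R] Fc)
    qed
    show "F (presented_class S R (frag_of x)) = f x" if "x \<in> S" for x
      using Fc[of "frag_of x"] h(2) that by simp
  qed
qed

lemma frag_bilinear_of [simp]: "frag_bilinear f (frag_of x) (frag_of y) = frag_of (f x y)"
  by (simp add: frag_bilinear_def)

lemma frag_bilinear_zero_left [simp]: "frag_bilinear f 0 v = 0"
  by (simp add: frag_bilinear_def)

lemma frag_bilinear_add_left:
  "frag_bilinear f (u + u') v = frag_bilinear f u v + frag_bilinear f u' v"
  by (simp add: frag_bilinear_def frag_extend_add)

lemma frag_bilinear_diff_left:
  "frag_bilinear f (u - u') v = frag_bilinear f u v - frag_bilinear f u' v"
  by (simp add: frag_bilinear_def frag_extend_diff)

lemma frag_extend_distrib_diff: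
  "frag_extend (\<lambda>x. b x - c x) u = frag_extend b u - frag_extend c u"
proof -
  have "frag_cmul n (v - w) = frag_cmul n v - frag_cmul n w" for n and v w :: "'a \<Rightarrow>\<^sub>0 int"
    by (simp add: right_diff_distrib lookup_minus poly_mapping_eqI)
  then show ?thesis by (simp add: frag_extend_def sum_subtractf)
qed

text \<open>Exchanging the two summations turns facts about the first argument into facts about the second
  one.\<close>

lemma frag_bilinear_swap: "frag_bilinear f u v = frag_bilinear (\<lambda>y x. f x y) v u"
proof -
  have "Poly_Mapping.keys u \<subseteq> UNIV" by simp
  then show ?thesis
  proof (induction u rule: frag_induction)
    case (one x)
    then show ?case by (simp add: frag_bilinear_def)
  next
    case (diff a b)
    then show ?case by (simp add: frag_bilinear_def frag_extend_diff frag_extend_distrib_diff)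
  qed (simp add: frag_bilinear_def frag_extend_eq_0)
qed

lemma frag_bilinear_zero_right [simp]: "frag_bilinear f u 0 = 0"
  by (subst frag_bilinear_swap) simp

lemma frag_bilinear_add_right:
  "frag_bilinear f u (v + v') = frag_bilinear f u v + frag_bilinear f u v'"
  by (subst (1 2 3) frag_bilinear_swap) (rule frag_bilinear_add_left)

lemma frag_bilinear_diff_right:
  "frag_bilinear f u (v - v') = frag_bilinear f u v - frag_bilinear f u v'"
  by (subst (1 2 3) frag_bilinear_swap) (rule frag_bilinear_diff_left)

lemma frag_bilinear_induct:
  assumes u: "Poly_Mapping.keys u \<subseteq> S1" and v: "Poly_Mapping.keys v \<subseteq> S2"
    and zero: "P 0" and diff: "\<And>w w'. P w \<Longrightarrow> P w' \<Longrightarrow> P (w - w')"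
    and gen: "\<And>x y. x \<in> S1 \<Longrightarrow> y \<in> S2 \<Longrightarrow> P (frag_of (f x y))"
  shows "P (frag_bilinear f u v)"
  using u
proof (induction u rule: frag_induction)
  case (one x)
  show ?case using v
    by (induction v rule: frag_induction)
      (use one in \<open>auto simp: zero diff gen frag_bilinear_diff_right\<close>)
qed (auto simp: zero diff frag_bilinear_diff_left)

text \<open>A bilinear map descends to the presented groups as soon as it sends a single relation, paired
  with a single generator, into the subgroup of relations of the target. The locale is used twice:
  for the tensor product of bisets, and again for its extension of scalars to \<open>k\<close>.\<close>

locale presented_bilinear =
  fixes S1 :: "'x set" and R1 and S2 :: "'y set" and R2 and S :: "'z set" and R and f
  assumes R1: "R1 \<subseteq> carrier (free_Abelian_group S1)"
    and R2: "R2 \<subseteq> carrier (free_Abelian_group S2)"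
    and R: "R \<subseteq> carrier (free_Abelian_group S)"
    and closed: "x \<in> S1 \<Longrightarrow> y \<in> S2 \<Longrightarrow> f x y \<in> S"
    and left: "r \<in> R1 \<Longrightarrow> y \<in> S2 \<Longrightarrow> frag_bilinear f r (frag_of y) \<in> relators S R"
    and right: "x \<in> S1 \<Longrightarrow> r' \<in> R2 \<Longrightarrow> frag_bilinear f (frag_of x) r' \<in> relators S R"
begin

lemma keys_frag_bilinear:
  assumes "Poly_Mapping.keys u \<subseteq> S1" "Poly_Mapping.keys v \<subseteq> S2"
  shows "Poly_Mapping.keys (frag_bilinear f u v) \<subseteq> S"
  using assms
proof (rule frag_bilinear_induct)
  show "Poly_Mapping.keys (w - w') \<subseteq> S" if "Poly_Mapping.keys w \<subseteq> S" "Poly_Mapping.keys w' \<subseteq> S" for w w'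
    using keys_diff[of w w'] that by blast
qed (use closed in auto)

lemma frag_bilinear_relators_left:
  assumes u: "u \<in> relators S1 R1" and v: "Poly_Mapping.keys v \<subseteq> S2"
  shows "frag_bilinear f u v \<in> relators S R"
  using v
proof (induction v rule: frag_induction)
  case (one y)
  show ?case
    using frag_extend_in_relators[OF R1 R _ u, of "\<lambda>x. frag_of (f x y)"] left[of _ y] one
    by (simp add: frag_bilinear_def)
qed (auto simp: relators_zero frag_bilinear_diff_right relators_diff[OF R])

lemma frag_bilinear_relators_right:
  assumes u: "Poly_Mapping.keys u \<subseteq> S1" and v: "v \<in> relators S2 R2"
  shows "frag_bilinear f u v \<in> relators S R"
  using u
proof (induction u rule: frag_induction)
  case (one x)
  show ?case
    using frag_extend_in_relators[OF R2 R _ v, of "\<lambda>y. frag_of (f x y)"] right[of x] one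
    by (simp add: frag_bilinear_def)
qed (auto simp: relators_zero frag_bilinear_diff_left relators_diff[OF R])

lemma induced_bilinear_class:
  assumes u: "Poly_Mapping.keys u \<subseteq> S1" and v: "Poly_Mapping.keys v \<subseteq> S2"
  shows "induced_bilinear S R f (presented_class S1 R1 u) (presented_class S2 R2 v)
    = presented_class S R (frag_bilinear f u v)"
proof -
  have "presented_class S R (frag_bilinear f u' v') = presented_class S R (frag_bilinear f u v)"
    if u': "u' \<in> presented_class S1 R1 u" and v': "v' \<in> presented_class S2 R2 v" for u' v'
  proof -
    have du: "u' - u \<in> relators S1 R1" and dv: "v' - v \<in> relators S2 R2"
      using u' v' by (simp_all add: mem_presented_class)
    have "Poly_Mapping.keys v' \<subseteq> S2"
      using keys_add[of "v' - v" v] relators_keys[OF R2 dv] v by auto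
    then have "frag_bilinear f (u' - u) v' + frag_bilinear f u (v' - v) \<in> relators S R"
      by (intro relators_add frag_bilinear_relators_left frag_bilinear_relators_right du dv u)
    then show ?thesis
      by (simp add: presented_class_eq_iff[OF R] frag_bilinear_diff_left frag_bilinear_diff_right)
  qed
  moreover have "u \<in> presented_class S1 R1 u" "v \<in> presented_class S2 R2 v"
    by (simp_all add: mem_presented_class relators_zero)
  ultimately show ?thesis unfolding induced_bilinear_def by blast
qed

lemma induced_bilinear_closed:
  assumes "P \<in> carrier (presented_group S1 R1)" "Q \<in> carrier (presented_group S2 R2)"
  shows "induced_bilinear S R f P Q \<in> carrier (presented_group S R)"
  using assms by (auto simp: carrier_presented_group induced_bilinear_class keys_frag_bilinear)

lemma induced_bilinear_mult_left:
  assumes "P \<in> carrier (presented_group S1 R1)" "P' \<in> carrier (presented_group S1 R1)"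
    and "Q \<in> carrier (presented_group S2 R2)"
  shows "induced_bilinear S R f (P \<otimes>\<^bsub>presented_group S1 R1\<^esub> P') Q
    = induced_bilinear S R f P Q \<otimes>\<^bsub>presented_group S R\<^esub> induced_bilinear S R f P' Q"
proof -
  obtain u u' v where "P = presented_class S1 R1 u" "Poly_Mapping.keys u \<subseteq> S1"
    "P' = presented_class S1 R1 u'" "Poly_Mapping.keys u' \<subseteq> S1"
    "Q = presented_class S2 R2 v" "Poly_Mapping.keys v \<subseteq> S2"
    using assms by (auto simp: carrier_presented_group)
  moreover from this have "Poly_Mapping.keys (u + u') \<subseteq> S1" using keys_add[of u u'] by blast
  ultimately show ?thesis
    by (simp add: mult_presented_group R R1 induced_bilinear_class keys_frag_bilinear
        frag_bilinear_add_left)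
qed

lemma induced_bilinear_mult_right:
  assumes "P \<in> carrier (presented_group S1 R1)"
    and "Q \<in> carrier (presented_group S2 R2)" "Q' \<in> carrier (presented_group S2 R2)"
  shows "induced_bilinear S R f P (Q \<otimes>\<^bsub>presented_group S2 R2\<^esub> Q')
    = induced_bilinear S R f P Q \<otimes>\<^bsub>presented_group S R\<^esub> induced_bilinear S R f P Q'"
proof -
  obtain u v v' where "P = presented_class S1 R1 u" "Poly_Mapping.keys u \<subseteq> S1"
    "Q = presented_class S2 R2 v" "Poly_Mapping.keys v \<subseteq> S2"
    "Q' = presented_class S2 R2 v'" "Poly_Mapping.keys v' \<subseteq> S2"
    using assms by (auto simp: carrier_presented_group)
  moreover from this have "Poly_Mapping.keys (v + v') \<subseteq> S2" using keys_add[of v v'] by blast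
  ultimately show ?thesis
    by (simp add: mult_presented_group R R2 induced_bilinear_class keys_frag_bilinear
        frag_bilinear_add_right)
qed

text \<open>A homomorphism kills all products if it kills the products of generators. This is how the linear
  form that separates \<open>e\<close> from \<open>I\<^sub>G\<close> is evaluated on \<open>I\<^sub>G\<close>.\<close>

lemma induced_bilinear_vanishes:
  assumes F: "F \<in> hom (presented_group S R) M" and M: "group M"
    and gen: "\<And>x y. x \<in> S1 \<Longrightarrow> y \<in> S2 \<Longrightarrow> F (presented_class S R (frag_of (f x y))) = \<one>\<^bsub>M\<^esub>"
    and P: "P \<in> carrier (presented_group S1 R1)" and Q: "Q \<in> carrier (presented_group S2 R2)"
  shows "F (induced_bilinear S R f P Q) = \<one>\<^bsub>M\<^esub>"
proof -
  obtain u v where u: "P = presented_class S1 R1 u" "Poly_Mapping.keys u \<subseteq> S1"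
    and v: "Q = presented_class S2 R2 v" "Poly_Mapping.keys v \<subseteq> S2"
    using P Q by (auto simp: carrier_presented_group)
  interpret c: group_hom "free_Abelian_group S" "presented_group S R" "presented_class S R"
    by (rule presented_class_hom[OF R])
  interpret F: group_hom "presented_group S R" M F
    using F M c.H.group_axioms by (simp add: group_hom_def group_hom_axioms_def)
  interpret h: group_hom "free_Abelian_group S" M "F \<circ> presented_class S R"
    using hom_compose[OF c.homh F] M by (simp add: group_hom_def group_hom_axioms_def)
  have hd: "F (presented_class S R (w - w')) = F (presented_class S R w) \<otimes>\<^bsub>M\<^esub> inv\<^bsub>M\<^esub> F (presented_class S R w')"
    if "Poly_Mapping.keys w \<subseteq> S" "Poly_Mapping.keys w' \<subseteq> S" for w w'
    using h.hom_mult[of w "- w'"] h.hom_inv[of w'] that by simp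
  have "Poly_Mapping.keys (frag_bilinear f u v) \<subseteq> S \<and> F (presented_class S R (frag_bilinear f u v)) = \<one>\<^bsub>M\<^esub>"
    using u(2) v(2)
  proof (rule frag_bilinear_induct)
    show "Poly_Mapping.keys 0 \<subseteq> S \<and> F (presented_class S R 0) = \<one>\<^bsub>M\<^esub>" using h.hom_one by simp
  next
    fix w w' assume "Poly_Mapping.keys w \<subseteq> S \<and> F (presented_class S R w) = \<one>\<^bsub>M\<^esub>"
      "Poly_Mapping.keys w' \<subseteq> S \<and> F (presented_class S R w') = \<one>\<^bsub>M\<^esub>"
    then show "Poly_Mapping.keys (w - w') \<subseteq> S \<and> F (presented_class S R (w - w')) = \<one>\<^bsub>M\<^esub>"
      using keys_diff[of w w'] F.H.group_axioms by (auto simp: hd)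
  qed (use gen closed in auto)
  then show ?thesis by (simp add: u v induced_bilinear_class)
qed

end

section \<open>Fibered bisets and their embeddings\<close>

text \<open>A homomorphism into the group of bijections amounts to the usual equations, since the inverse of
  \<open>w\<close> acts as an inverse of the map by which \<open>w\<close> acts.\<close>

lemma group_action_iff:
  assumes "group W"
  shows "group_action W E s \<longleftrightarrow>
    (\<forall>w\<in>carrier W. s w \<in> extensional E) \<and> (\<forall>w\<in>carrier W. \<forall>x\<in>E. s w x \<in> E) \<and>
    (\<forall>x\<in>E. s \<one>\<^bsub>W\<^esub> x = x) \<and>
    (\<forall>v\<in>carrier W. \<forall>w\<in>carrier W. \<forall>x\<in>E. s (v \<otimes>\<^bsub>W\<^esub> w) x = s v (s w x))"
    (is "_ \<longleftrightarrow> ?E")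
proof
  assume "group_action W E s"
  then interpret group_action W E s .
  show ?E
  proof (intro conjI ballI)
    show "s w \<in> extensional E" if "w \<in> carrier W" for w
      using bij_prop0[OF that] by (simp add: Bij_def)
    show "s w x \<in> E" if "w \<in> carrier W" "x \<in> E" for w x
      using element_image[OF that] by simp
    show "s \<one>\<^bsub>W\<^esub> x = x" if "x \<in> E" for x
      using fun_cong[OF id_eq_one, of x] that by simp
  qed (rule composition_rule)
next
  assume E: ?E
  interpret W: group W by fact
  have bij: "s w \<in> Bij E" if w: "w \<in> carrier W" for w
  proof -
    have "bij_betw (s w) E E"
    proof (rule bij_betw_byWitness[where f' = "s (inv\<^bsub>W\<^esub> w)"])
      show "\<forall>x\<in>E. s (inv\<^bsub>W\<^esub> w) (s w x) = x" "\<forall>x\<in>E. s w (s (inv\<^bsub>W\<^esub> w) x) = x"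
        using E w by (metis W.inv_closed W.l_inv, metis W.inv_closed W.r_inv)
    qed (use E w in auto)
    then show ?thesis using E w by (simp add: Bij_def)
  qed
  show "group_action W E s"
  proof (unfold group_action_def group_hom_def group_hom_axioms_def, intro conjI homI)
    show "group W" "group (BijGroup E)" by (rule assms, rule group_BijGroup)
    show "s w \<in> carrier (BijGroup E)" if "w \<in> carrier W" for w
      using bij[OF that] by (simp add: BijGroup_def)
    fix v w assume vw: "v \<in> carrier W" "w \<in> carrier W"
    then have "s (v \<otimes>\<^bsub>W\<^esub> w) = compose E (s v) (s w)"
      using E by (intro extensionalityI[of _ E]) (auto simp: compose_def)
    then show "s (v \<otimes>\<^bsub>W\<^esub> w) = s v \<otimes>\<^bsub>BijGroup E\<^esub> s w"
      using bij vw by (simp add: BijGroup_def)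
  qed
qed

locale three_groups = A: comm_group A + G: group G + H: group H
  for A :: "('a, 'm) monoid_scheme" and G :: "('g, 'p) monoid_scheme"
    and H :: "('h, 'q) monoid_scheme"
begin

lemma group_W: "group (A \<times>\<times> G \<times>\<times> H)"
  by (simp add: DirProd_group A.group_axioms G.group_axioms H.group_axioms)

text \<open>The finiteness condition is given by a finite set of points that meets every \<open>A\<close>-orbit, which is
  easier to exhibit than the set of orbits.\<close>

lemma fibered_bisetI:
  assumes ext: "\<And>a g h. \<lbrakk>a \<in> carrier A; g \<in> carrier G; h \<in> carrier H\<rbrakk> \<Longrightarrow> snd X (a, g, h) \<in> extensional (fst X)"
    and closed: "\<And>a g h x. \<lbrakk>a \<in> carrier A; g \<in> carrier G; h \<in> carrier H; x \<in> fst X\<rbrakk> \<Longrightarrow> snd X (a, g, h) x \<in> fst X"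
    and one: "\<And>x. x \<in> fst X \<Longrightarrow> snd X (\<one>\<^bsub>A\<^esub>, \<one>\<^bsub>G\<^esub>, \<one>\<^bsub>H\<^esub>) x = x"
    and act: "\<And>a g h a' g' h' x. \<lbrakk>a \<in> carrier A; g \<in> carrier G; h \<in> carrier H;
        a' \<in> carrier A; g' \<in> carrier G; h' \<in> carrier H; x \<in> fst X\<rbrakk> \<Longrightarrow>
        snd X (a \<otimes>\<^bsub>A\<^esub> a', g \<otimes>\<^bsub>G\<^esub> g', h \<otimes>\<^bsub>H\<^esub> h') x = snd X (a, g, h) (snd X (a', g', h') x)"
    and free: "\<And>a x. \<lbrakk>a \<in> carrier A; x \<in> fst X; snd X (a, \<one>\<^bsub>G\<^esub>, \<one>\<^bsub>H\<^esub>) x = x\<rbrakk> \<Longrightarrow> a = \<one>\<^bsub>A\<^esub>"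
    and fin: "finite F" "\<And>x. x \<in> fst X \<Longrightarrow> \<exists>y\<in>F \<inter> fst X. \<exists>a\<in>carrier A. x = snd X (a, \<one>\<^bsub>G\<^esub>, \<one>\<^bsub>H\<^esub>) y"
  shows "fibered_biset A G H X"
proof -
  have orb: "orbit A (\<lambda>a. snd X (a, \<one>\<^bsub>G\<^esub>, \<one>\<^bsub>H\<^esub>)) (snd X (b, \<one>\<^bsub>G\<^esub>, \<one>\<^bsub>H\<^esub>) y)
      = orbit A (\<lambda>a. snd X (a, \<one>\<^bsub>G\<^esub>, \<one>\<^bsub>H\<^esub>)) y" if b: "b \<in> carrier A" and y: "y \<in> fst X" for b y
  proof -
    have "\<exists>c\<in>carrier A. snd X (a, \<one>\<^bsub>G\<^esub>, \<one>\<^bsub>H\<^esub>) y = snd X (c, \<one>\<^bsub>G\<^esub>, \<one>\<^bsub>H\<^esub>) (snd X (b, \<one>\<^bsub>G\<^esub>, \<one>\<^bsub>H\<^esub>) y)"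
      if "a \<in> carrier A" for a
      using act[of "a \<otimes>\<^bsub>A\<^esub> inv\<^bsub>A\<^esub> b" "\<one>\<^bsub>G\<^esub>" "\<one>\<^bsub>H\<^esub>" b "\<one>\<^bsub>G\<^esub>" "\<one>\<^bsub>H\<^esub>" y] that b y
      by (intro bexI[of _ "a \<otimes>\<^bsub>A\<^esub> inv\<^bsub>A\<^esub> b"]) (auto simp: A.m_assoc)
    moreover have "\<exists>c\<in>carrier A. snd X (a, \<one>\<^bsub>G\<^esub>, \<one>\<^bsub>H\<^esub>) (snd X (b, \<one>\<^bsub>G\<^esub>, \<one>\<^bsub>H\<^esub>) y) = snd X (c, \<one>\<^bsub>G\<^esub>, \<one>\<^bsub>H\<^esub>) y"
      if "a \<in> carrier A" for a
      using act[of a "\<one>\<^bsub>G\<^esub>" "\<one>\<^bsub>H\<^esub>" b "\<one>\<^bsub>G\<^esub>" "\<one>\<^bsub>H\<^esub>" y] that b y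
      by (intro bexI[of _ "a \<otimes>\<^bsub>A\<^esub> b"]) auto
    ultimately show ?thesis unfolding orbit_def by blast
  qed
  have "orbits A (fst X) (\<lambda>a. snd X (a, \<one>\<^bsub>G\<^esub>, \<one>\<^bsub>H\<^esub>)) \<subseteq>
      (\<lambda>y. orbit A (\<lambda>a. snd X (a, \<one>\<^bsub>G\<^esub>, \<one>\<^bsub>H\<^esub>)) y) ` F"
  proof
    fix Q assume "Q \<in> orbits A (fst X) (\<lambda>a. snd X (a, \<one>\<^bsub>G\<^esub>, \<one>\<^bsub>H\<^esub>))"
    then obtain x where x: "x \<in> fst X" "Q = orbit A (\<lambda>a. snd X (a, \<one>\<^bsub>G\<^esub>, \<one>\<^bsub>H\<^esub>)) x"
      unfolding orbits_def by blast
    obtain y b where "y \<in> F" "y \<in> fst X" "b \<in> carrier A" "x = snd X (b, \<one>\<^bsub>G\<^esub>, \<one>\<^bsub>H\<^esub>) y"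
      using fin(2)[OF x(1)] by blast
    with orb x(2) show "Q \<in> (\<lambda>y. orbit A (\<lambda>a. snd X (a, \<one>\<^bsub>G\<^esub>, \<one>\<^bsub>H\<^esub>)) y) ` F"
      by (intro image_eqI[of _ _ y]) simp_all
  qed
  then have "finite (orbits A (fst X) (\<lambda>a. snd X (a, \<one>\<^bsub>G\<^esub>, \<one>\<^bsub>H\<^esub>)))"
    using fin(1) finite_surj by blast
  then show ?thesis
    unfolding fibered_biset_def group_action_iff[OF group_W]
    using ext closed one act free by (auto simp: DirProd_def stabilizer_def)
qed

end

locale fibered = three_groups A G H
  for A :: "('a, 'm) monoid_scheme" and G :: "('g, 'p) monoid_scheme"
    and H :: "('h, 'q) monoid_scheme" +
  fixes X :: "('a, 'g, 'h, 'x) fbiset"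
  assumes fibered: "fibered_biset A G H X"
begin

lemma group_action: "group_action (A \<times>\<times> G \<times>\<times> H) (fst X) (snd X)"
  using fibered by (simp add: fibered_biset_def)

lemma act_extensional:
  "\<lbrakk>a \<in> carrier A; g \<in> carrier G; h \<in> carrier H\<rbrakk> \<Longrightarrow> snd X (a, g, h) \<in> extensional (fst X)"
  using group_action unfolding group_action_iff[OF group_W] by (simp add: DirProd_def)

lemma act_closed [simp]:
  "\<lbrakk>a \<in> carrier A; g \<in> carrier G; h \<in> carrier H; x \<in> fst X\<rbrakk> \<Longrightarrow> snd X (a, g, h) x \<in> fst X"
  using group_action unfolding group_action_iff[OF group_W] by (simp add: DirProd_def)

lemma act_one [simp]: "x \<in> fst X \<Longrightarrow> snd X (\<one>\<^bsub>A\<^esub>, \<one>\<^bsub>G\<^esub>, \<one>\<^bsub>H\<^esub>) x = x"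
  using group_action unfolding group_action_iff[OF group_W] by (simp add: DirProd_def)

lemma act_act:
  "\<lbrakk>a \<in> carrier A; g \<in> carrier G; h \<in> carrier H; a' \<in> carrier A; g' \<in> carrier G; h' \<in> carrier H; x \<in> fst X\<rbrakk>
    \<Longrightarrow> snd X (a, g, h) (snd X (a', g', h') x) = snd X (a \<otimes>\<^bsub>A\<^esub> a', g \<otimes>\<^bsub>G\<^esub> g', h \<otimes>\<^bsub>H\<^esub> h') x"
  using group_action unfolding group_action_iff[OF group_W] by (simp add: DirProd_def)

lemma free: "\<lbrakk>a \<in> carrier A; x \<in> fst X; snd X (a, \<one>\<^bsub>G\<^esub>, \<one>\<^bsub>H\<^esub>) x = x\<rbrakk> \<Longrightarrow> a = \<one>\<^bsub>A\<^esub>"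
  using fibered by (auto simp: fibered_biset_def stabilizer_def)

abbreviation "A_orbit \<equiv> orbit A (\<lambda>a. snd X (a, \<one>\<^bsub>G\<^esub>, \<one>\<^bsub>H\<^esub>))"

lemma A_orbit_self: "x \<in> fst X \<Longrightarrow> x \<in> A_orbit x"
  unfolding orbit_def using act_one[of x] by (auto intro: exI[of _ "\<one>\<^bsub>A\<^esub>"])

lemma finite_A_orbits: "finite (A_orbit ` fst X)"
proof -
  have "A_orbit ` fst X = orbits A (fst X) (\<lambda>a. snd X (a, \<one>\<^bsub>G\<^esub>, \<one>\<^bsub>H\<^esub>))"
    by (auto simp: orbits_def)
  then show ?thesis using fibered by (simp add: fibered_biset_def)
qed

definition A_rep :: "'x \<Rightarrow> 'x" where
  "A_rep x = (SOME y. y \<in> fst X \<and> A_orbit y = A_orbit x)"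

lemma A_rep:
  assumes "x \<in> fst X"
  shows "A_rep x \<in> fst X" "\<exists>a\<in>carrier A. x = snd X (a, \<one>\<^bsub>G\<^esub>, \<one>\<^bsub>H\<^esub>) (A_rep x)"
proof -
  have "A_rep x \<in> fst X \<and> A_orbit (A_rep x) = A_orbit x"
    unfolding A_rep_def by (rule someI[of _ x]) (simp add: assms)
  moreover from this have "x \<in> A_orbit (A_rep x)" using A_orbit_self[OF assms] by simp
  ultimately show "A_rep x \<in> fst X" "\<exists>a\<in>carrier A. x = snd X (a, \<one>\<^bsub>G\<^esub>, \<one>\<^bsub>H\<^esub>) (A_rep x)"
    by (auto simp: orbit_def)
qed

lemma finite_A_reps: "finite (A_rep ` fst X)"
proof -
  have "A_rep ` fst X = (\<lambda>Q. SOME y. y \<in> fst X \<and> A_orbit y = Q) ` (A_orbit ` fst X)"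
    unfolding A_rep_def by auto
  then show ?thesis using finite_A_orbits by simp
qed

end

text \<open>Injective equivariant maps serve for isomorphisms (when they are onto) and for the inclusions of
  the parts of a disjoint union.\<close>

definition fbiset_emb ::
  "('a, 'm) monoid_scheme \<Rightarrow> ('g, 'p) monoid_scheme \<Rightarrow> ('h, 'q) monoid_scheme
    \<Rightarrow> ('a, 'g, 'h, 'x) fbiset \<Rightarrow> ('a, 'g, 'h, 'y) fbiset \<Rightarrow> ('x \<Rightarrow> 'y) \<Rightarrow> bool" where
  "fbiset_emb A G H X Y f \<longleftrightarrow>
     inj_on f (fst X) \<and> f ` fst X \<subseteq> fst Y \<and>
     (\<forall>a\<in>carrier A. \<forall>g\<in>carrier G. \<forall>h\<in>carrier H. \<forall>x\<in>fst X.
        f (snd X (a, g, h) x) = snd Y (a, g, h) (f x))"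

lemma fbiset_iso_iff_emb:
  "fbiset_iso A G H X Y \<longleftrightarrow> (\<exists>f. fbiset_emb A G H X Y f \<and> f ` fst X = fst Y)"
  unfolding fbiset_iso_def fbiset_emb_def bij_betw_def by (auto simp: DirProd_def)

lemma fbiset_embD:
  assumes "fbiset_emb A G H X Y f"
  shows "inj_on f (fst X)" "x \<in> fst X \<Longrightarrow> f x \<in> fst Y"
    "\<lbrakk>a \<in> carrier A; g \<in> carrier G; h \<in> carrier H; x \<in> fst X\<rbrakk>
      \<Longrightarrow> snd Y (a, g, h) (f x) = f (snd X (a, g, h) x)"
  using assms by (auto simp: fbiset_emb_def)

lemma fbiset_emb_comp:
  assumes "fbiset_emb A G H X Y f" "fbiset_emb A G H Y Z g"
  shows "fbiset_emb A G H X Z (g \<circ> f)"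
  using assms unfolding fbiset_emb_def
  by (auto simp: image_subset_iff intro: comp_inj_on inj_on_subset)

lemma fbiset_iso_trans:
  assumes "fbiset_iso A G H X Y" "fbiset_iso A G H Y Z"
  shows "fbiset_iso A G H X Z"
proof -
  obtain f g where "fbiset_emb A G H X Y f" "f ` fst X = fst Y"
    "fbiset_emb A G H Y Z g" "g ` fst Y = fst Z"
    using assms unfolding fbiset_iso_iff_emb by blast
  then show ?thesis
    unfolding fbiset_iso_iff_emb
    by (intro exI[of _ "g \<circ> f"] conjI fbiset_emb_comp[of _ _ _ _ Y]) (simp_all only: image_comp[symmetric])
qed

lemma (in fibered) fbiset_emb_inv:
  assumes f: "fbiset_emb A G H X Y f" and im: "f ` fst X = fst Y"
  shows "fbiset_emb A G H Y X (inv_into (fst X) f)" "inv_into (fst X) f ` fst Y = fst X"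
proof -
  note f = fbiset_embD[OF f]
  have inv: "inv_into (fst X) f (f x) = x" if "x \<in> fst X" for x
    using f(1) that by simp
  show "inv_into (fst X) f ` fst Y = fst X"
    using inv im by force
  show "fbiset_emb A G H Y X (inv_into (fst X) f)"
    unfolding fbiset_emb_def im[symmetric] using inv f by (auto simp: inj_on_def)
qed

lemma (in fibered) fbiset_iso_sym: "fbiset_iso A G H X Y \<Longrightarrow> fbiset_iso A G H Y X"
  using fbiset_emb_inv unfolding fbiset_iso_iff_emb by metis

lemma (in fibered) fibered_biset_transport:
  assumes f: "inj_on f (fst X)"
  obtains Y where "fibered_biset A G H Y" "fbiset_emb A G H X Y f" "f ` fst X = fst Y"
proof
  define Y where "Y = (f ` fst X, \<lambda>w. restrict (\<lambda>y. f (snd X w (inv_into (fst X) f y))) (f ` fst X))"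
  have inv: "inv_into (fst X) f (f x) = x" if "x \<in> fst X" for x
    using f that by simp
  show "fbiset_emb A G H X Y f" "f ` fst X = fst Y"
    using f by (auto simp: fbiset_emb_def Y_def inv)
  show "fibered_biset A G H Y"
  proof (rule fibered_bisetI)
    show "finite (f ` A_rep ` fst X)" using finite_A_reps by simp
    fix y assume "y \<in> fst Y"
    then obtain x where x: "x \<in> fst X" "y = f x" by (auto simp: Y_def)
    obtain a where a: "a \<in> carrier A" "x = snd X (a, \<one>\<^bsub>G\<^esub>, \<one>\<^bsub>H\<^esub>) (A_rep x)"
      using A_rep(2)[OF x(1)] by blast
    have "y = snd Y (a, \<one>\<^bsub>G\<^esub>, \<one>\<^bsub>H\<^esub>) (f (A_rep x))"
      using A_rep(1)[OF x(1)] a(2)[symmetric] x(2) by (simp add: Y_def inv)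
    moreover have "f (A_rep x) \<in> f ` A_rep ` fst X \<inter> fst Y"
      using A_rep(1)[OF x(1)] x(1) by (simp add: Y_def)
    ultimately show "\<exists>z\<in>f ` A_rep ` fst X \<inter> fst Y. \<exists>a\<in>carrier A. y = snd Y (a, \<one>\<^bsub>G\<^esub>, \<one>\<^bsub>H\<^esub>) z"
      using a(1) by blast
  next
    fix a x assume "a \<in> carrier A" "x \<in> fst Y" "snd Y (a, \<one>\<^bsub>G\<^esub>, \<one>\<^bsub>H\<^esub>) x = x"
    then show "a = \<one>\<^bsub>A\<^esub>"
      using free[of a] inj_onD[OF f] by (auto simp: Y_def inv)
  next
    fix a g h a' g' h' y
    assume w: "a \<in> carrier A" "g \<in> carrier G" "h \<in> carrier H"
      "a' \<in> carrier A" "g' \<in> carrier G" "h' \<in> carrier H" and "y \<in> fst Y"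
    then obtain x where "x \<in> fst X" "y = f x" by (auto simp: Y_def)
    then show "snd Y (a \<otimes>\<^bsub>A\<^esub> a', g \<otimes>\<^bsub>G\<^esub> g', h \<otimes>\<^bsub>H\<^esub> h') y = snd Y (a, g, h) (snd Y (a', g', h') y)"
      using w by (simp add: Y_def inv act_act)
  qed (auto simp: Y_def inv)
qed

text \<open>A point is determined by its \<open>A\<close>-orbit together with a scalar that carries the representative of
  this orbit to it, and there are finitely many orbits to be numbered.\<close>

lemma (in fibered) fibered_biset_copy:
  obtains Y :: "('a, 'g, 'h, 'a \<times> nat) fbiset"
  where "fibered_biset A G H Y" "fbiset_iso A G H X Y"
proof -
  obtain n :: "'x \<Rightarrow> nat" where n: "inj_on n (A_rep ` fst X)"
    using finite_imp_inj_to_nat_seg[OF finite_A_reps] by blast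
  have "\<forall>x\<in>fst X. \<exists>a. a \<in> carrier A \<and> x = snd X (a, \<one>\<^bsub>G\<^esub>, \<one>\<^bsub>H\<^esub>) (A_rep x)"
    using A_rep(2) by blast
  then obtain c where c0: "\<forall>x\<in>fst X. c x \<in> carrier A \<and> x = snd X (c x, \<one>\<^bsub>G\<^esub>, \<one>\<^bsub>H\<^esub>) (A_rep x)"
    unfolding bchoice_iff by (elim exE)
  have c: "x = snd X (c x, \<one>\<^bsub>G\<^esub>, \<one>\<^bsub>H\<^esub>) (A_rep x)" if "x \<in> fst X" for x
    using bspec[OF c0 that] by (rule conjunct2)
  have "inj_on (\<lambda>x. (c x, n (A_rep x))) (fst X)"
  proof (rule inj_onI)
    fix x y assume xy: "x \<in> fst X" "y \<in> fst X" "(c x, n (A_rep x)) = (c y, n (A_rep y))"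
    then have rep: "A_rep x = A_rep y" by (intro inj_onD[OF n]) simp_all
    have "x = snd X (c x, \<one>\<^bsub>G\<^esub>, \<one>\<^bsub>H\<^esub>) (A_rep x)" by (rule c) (rule xy)
    also have "\<dots> = snd X (c y, \<one>\<^bsub>G\<^esub>, \<one>\<^bsub>H\<^esub>) (A_rep y)" using xy(3) rep by simp
    also have "\<dots> = y" by (rule c[symmetric]) (rule xy)
    finally show "x = y" .
  qed
  then obtain Y where Y: "fibered_biset A G H Y" "fbiset_emb A G H X Y (\<lambda>x. (c x, n (A_rep x)))"
    "(\<lambda>x. (c x, n (A_rep x))) ` fst X = fst Y" by (rule fibered_biset_transport)
  show thesis by (rule that[OF Y(1)]) (use Y(2,3) in \<open>unfold fbiset_iso_iff_emb, blast\<close>)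
qed

section \<open>Isomorphism classes\<close>

lemma (in fibered) iso_class_eqI:
  assumes "fbiset_iso A G H X Y"
  shows "iso_class A G H X = iso_class A G H Y"
  unfolding iso_class_def
  using fbiset_iso_trans[OF assms] fbiset_iso_trans[OF fbiset_iso_sym[OF assms]] by blast

lemma (in fibered) iso_class_in_iso_classes: "iso_class A G H X \<in> iso_classes A G H"
proof -
  obtain Y :: "('a, 'g, 'h, 'a \<times> nat) fbiset"
    where "fibered_biset A G H Y" "fbiset_iso A G H X Y" using fibered_biset_copy .
  then show ?thesis using iso_class_eqI[of Y] unfolding iso_classes_def by blast
qed

lemma (in three_groups) fibered_biset_union:
  assumes "fibered_biset A G H X" "fibered_biset A G H Y"
  shows "fibered_biset A G H (fbiset_union X Y)"
proof -
  interpret X: fibered A G H X by unfold_locales fact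
  interpret Y: fibered A G H Y by unfold_locales fact
  show ?thesis
  proof (rule fibered_bisetI)
    show "finite (Inl ` X.A_rep ` fst X \<union> Inr ` Y.A_rep ` fst Y)"
      using X.finite_A_reps Y.finite_A_reps by simp
    fix z assume "z \<in> fst (fbiset_union X Y)"
    then consider x where "x \<in> fst X" "z = Inl x" | y where "y \<in> fst Y" "z = Inr y"
      by (auto simp: fbiset_union_def)
    then show "\<exists>y\<in>(Inl ` X.A_rep ` fst X \<union> Inr ` Y.A_rep ` fst Y) \<inter> fst (fbiset_union X Y).
        \<exists>a\<in>carrier A. z = snd (fbiset_union X Y) (a, \<one>\<^bsub>G\<^esub>, \<one>\<^bsub>H\<^esub>) y"
    proof cases
      case 1
      then show ?thesis using X.A_rep[of x]
        by (intro bexI[of _ "Inl (X.A_rep x)"]) (auto simp: fbiset_union_def)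
    next
      case 2
      then show ?thesis using Y.A_rep[of y]
        by (intro bexI[of _ "Inr (Y.A_rep y)"]) (auto simp: fbiset_union_def)
    qed
  next
    fix a z assume "a \<in> carrier A" "z \<in> fst (fbiset_union X Y)"
      "snd (fbiset_union X Y) (a, \<one>\<^bsub>G\<^esub>, \<one>\<^bsub>H\<^esub>) z = z"
    then show "a = \<one>\<^bsub>A\<^esub>" using X.free Y.free by (auto simp: fbiset_union_def)
  qed (auto simp: fbiset_union_def X.act_act Y.act_act)
qed

lemma fbiset_union_emb:
  "fbiset_emb A G H X (fbiset_union X Y) Inl" "fbiset_emb A G H Y (fbiset_union X Y) Inr"
  by (auto simp: fbiset_emb_def fbiset_union_def)

lemma inj_on_case_sum:
  assumes "inj_on p A" "inj_on q B" "p ` A \<inter> q ` B = {}"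
  shows "inj_on (case_sum p q) (A <+> B)"
  using assms unfolding inj_on_def disjoint_iff by (auto split: sum.splits)

text \<open>The relation \<open>[Z] = [X] + [Y]\<close> holds whenever \<open>X\<close> and \<open>Y\<close> embed onto complementary parts of \<open>Z\<close>,
  on whatever types their points live: the defining relations concern copies with points in
  \<open>'a \<times> nat\<close>, and copies of \<open>X\<close> and \<open>Y\<close> reassemble to a biset isomorphic to \<open>Z\<close>.\<close>

lemma (in three_groups) split_relation:
  assumes X: "fibered_biset A G H X" and Y: "fibered_biset A G H Y" and Z: "fibered_biset A G H Z"
    and i: "fbiset_emb A G H X Z i" and j: "fbiset_emb A G H Y Z j"
    and cover: "i ` fst X \<union> j ` fst Y = fst Z" and disjoint: "i ` fst X \<inter> j ` fst Y = {}"
  shows "frag_of (iso_class A G H Z) - frag_of (iso_class A G H X) - frag_of (iso_class A G H Y)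
    \<in> union_relations A G H"
proof -
  interpret X: fibered A G H X by unfold_locales fact
  interpret Y: fibered A G H Y by unfold_locales fact
  interpret Z: fibered A G H Z by unfold_locales fact
  obtain X' :: "('a, 'g, 'h, 'a \<times> nat) fbiset" where X': "fibered_biset A G H X'" "fbiset_iso A G H X X'"
    using X.fibered_biset_copy .
  obtain Y' :: "('a, 'g, 'h, 'a \<times> nat) fbiset" where Y': "fibered_biset A G H Y'" "fbiset_iso A G H Y Y'"
    using Y.fibered_biset_copy .
  interpret X': fibered A G H X' by unfold_locales fact
  interpret Y': fibered A G H Y' by unfold_locales fact
  let ?U = "fbiset_union X' Y'"
  interpret U: fibered A G H ?U by unfold_locales (rule fibered_biset_union[OF X'(1) Y'(1)])
  obtain f where f: "fbiset_emb A G H X' X f" "f ` fst X' = fst X"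
    using X.fbiset_iso_sym[OF X'(2)] unfolding fbiset_iso_iff_emb by blast
  obtain g where g: "fbiset_emb A G H Y' Y g" "g ` fst Y' = fst Y"
    using Y.fbiset_iso_sym[OF Y'(2)] unfolding fbiset_iso_iff_emb by blast
  have if': "fbiset_emb A G H X' Z (i \<circ> f)" "(i \<circ> f) ` fst X' = i ` fst X"
    and jg: "fbiset_emb A G H Y' Z (j \<circ> g)" "(j \<circ> g) ` fst Y' = j ` fst Y"
    using fbiset_emb_comp[OF f(1) i] fbiset_emb_comp[OF g(1) j] by (auto simp flip: f(2) g(2))
  note D = fbiset_embD[OF if'(1)] fbiset_embD[OF jg(1)]
  have "fbiset_emb A G H ?U Z (case_sum (i \<circ> f) (j \<circ> g))"
    unfolding fbiset_emb_def
  proof (intro conjI)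
    show "inj_on (case_sum (i \<circ> f) (j \<circ> g)) (fst ?U)"
      using inj_on_case_sum[OF D(1,4)] disjoint unfolding if'(2)[symmetric] jg(2)[symmetric]
      by (simp add: fbiset_union_def)
  qed (use D in \<open>auto simp: fbiset_union_def\<close>)
  moreover have "case_sum (i \<circ> f) (j \<circ> g) ` fst ?U = fst Z"
    unfolding cover[symmetric] if'(2)[symmetric] jg(2)[symmetric]
    by (force simp: fbiset_union_def)
  ultimately have "fbiset_iso A G H ?U Z" unfolding fbiset_iso_iff_emb by blast
  then have "iso_class A G H ?U = iso_class A G H Z" by (rule U.iso_class_eqI)
  moreover have "iso_class A G H X = iso_class A G H X'" "iso_class A G H Y = iso_class A G H Y'"
    using X.iso_class_eqI[OF X'(2)] Y.iso_class_eqI[OF Y'(2)] by simp_all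
  ultimately show ?thesis
    unfolding union_relations_def using X'(1) Y'(1)
    by (intro CollectI exI[of _ X'] exI[of _ Y'] conjI) simp_all
qed

section \<open>Tensor products of fibered bisets\<close>

text \<open>The point \<open>pt x y\<close> stands for \<open>x \<otimes> y\<close>, the orbit of \<open>(x, y)\<close>. It is an element of the tensor product
  \<open>T\<close> only if \<open>A\<close> acts freely on it.\<close>

locale fibered_pair = X: fibered A G H X + Y: fibered A H I Y
  for A :: "('a, 'm) monoid_scheme" and G :: "('g, 'p) monoid_scheme"
    and H :: "('h, 'q) monoid_scheme" and I :: "('i, 'r) monoid_scheme"
    and X :: "('a, 'g, 'h, 'x) fbiset" and Y :: "('a, 'h, 'i, 'y) fbiset"
begin

abbreviation pt :: "'x \<Rightarrow> 'y \<Rightarrow> ('x \<times> 'y) set" where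
  "pt x y \<equiv> orbit (A \<times>\<times> H) (pair_action A G I X Y) (x, y)"

abbreviation T :: "('a, 'g, 'i, ('x \<times> 'y) set) fbiset" where
  "T \<equiv> fbiset_tensor A G H I X Y"

sublocale T: three_groups A G I ..

lemma mem_pt:
  "p \<in> pt x y \<longleftrightarrow> (\<exists>a\<in>carrier A. \<exists>h\<in>carrier H.
     p = (snd X (inv\<^bsub>A\<^esub> a, \<one>\<^bsub>G\<^esub>, h) x, snd Y (a, h, \<one>\<^bsub>I\<^esub>) y))"
  by (auto simp: orbit_def pair_action_def DirProd_def)

lemma pt_subset: "x \<in> fst X \<Longrightarrow> y \<in> fst Y \<Longrightarrow> pt x y \<subseteq> fst X \<times> fst Y"
  by (auto simp: mem_pt)

lemma pt_self: "x \<in> fst X \<Longrightarrow> y \<in> fst Y \<Longrightarrow> (x, y) \<in> pt x y"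
  unfolding mem_pt by (intro bexI[of _ "\<one>\<^bsub>A\<^esub>"] bexI[of _ "\<one>\<^bsub>H\<^esub>"]) auto

text \<open>Scalars and elements of \<open>H\<close> can be moved across the tensor sign.\<close>

lemma pt_move:
  assumes a: "a \<in> carrier A" and h: "h \<in> carrier H" and x: "x \<in> fst X" and y: "y \<in> fst Y"
  shows "pt (snd X (inv\<^bsub>A\<^esub> a, \<one>\<^bsub>G\<^esub>, h) x) (snd Y (a, h, \<one>\<^bsub>I\<^esub>) y) = pt x y"
proof -
  have sub: "pt (snd X (inv\<^bsub>A\<^esub> a, \<one>\<^bsub>G\<^esub>, h) x) (snd Y (a, h, \<one>\<^bsub>I\<^esub>) y) \<subseteq> pt x y"
    if a: "a \<in> carrier A" and h: "h \<in> carrier H" and x: "x \<in> fst X" and y: "y \<in> fst Y" for a h x y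
  proof
    fix p assume "p \<in> pt (snd X (inv\<^bsub>A\<^esub> a, \<one>\<^bsub>G\<^esub>, h) x) (snd Y (a, h, \<one>\<^bsub>I\<^esub>) y)"
    then obtain b k where b: "b \<in> carrier A" and k: "k \<in> carrier H"
      and p: "p = (snd X (inv\<^bsub>A\<^esub> b, \<one>\<^bsub>G\<^esub>, k) (snd X (inv\<^bsub>A\<^esub> a, \<one>\<^bsub>G\<^esub>, h) x),
          snd Y (b, k, \<one>\<^bsub>I\<^esub>) (snd Y (a, h, \<one>\<^bsub>I\<^esub>) y))"
      unfolding mem_pt by blast
    show "p \<in> pt x y"
      unfolding mem_pt
      by (intro bexI[of _ "b \<otimes>\<^bsub>A\<^esub> a"] bexI[of _ "k \<otimes>\<^bsub>H\<^esub> h"])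
        (use a h x y b k in \<open>simp_all add: p X.act_act Y.act_act X.A.inv_mult\<close>)
  qed
  let ?x = "snd X (inv\<^bsub>A\<^esub> a, \<one>\<^bsub>G\<^esub>, h) x" and ?y = "snd Y (a, h, \<one>\<^bsub>I\<^esub>) y"
  have "snd X (inv\<^bsub>A\<^esub> (inv\<^bsub>A\<^esub> a), \<one>\<^bsub>G\<^esub>, inv\<^bsub>H\<^esub> h) ?x = x" "snd Y (inv\<^bsub>A\<^esub> a, inv\<^bsub>H\<^esub> h, \<one>\<^bsub>I\<^esub>) ?y = y"
    using a h x y by (simp_all add: X.act_act Y.act_act)
  then show ?thesis
    using sub[OF a h x y] sub[of "inv\<^bsub>A\<^esub> a" "inv\<^bsub>H\<^esub> h" ?x ?y] a h x y by simp
qed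

lemma pt_eq_iff:
  assumes "x \<in> fst X" "y \<in> fst Y" "x' \<in> fst X" "y' \<in> fst Y"
  shows "pt x' y' = pt x y \<longleftrightarrow> (\<exists>a\<in>carrier A. \<exists>h\<in>carrier H.
    x' = snd X (inv\<^bsub>A\<^esub> a, \<one>\<^bsub>G\<^esub>, h) x \<and> y' = snd Y (a, h, \<one>\<^bsub>I\<^esub>) y)"
proof
  assume "pt x' y' = pt x y"
  then have "(x', y') \<in> pt x y" using pt_self[OF assms(3,4)] by simp
  then show "\<exists>a\<in>carrier A. \<exists>h\<in>carrier H.
      x' = snd X (inv\<^bsub>A\<^esub> a, \<one>\<^bsub>G\<^esub>, h) x \<and> y' = snd Y (a, h, \<one>\<^bsub>I\<^esub>) y"
    unfolding mem_pt by simp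
qed (use pt_move[OF _ _ assms(1,2)] in \<open>elim bexE conjE, simp\<close>)

lemma pt_scalar:
  assumes "a \<in> carrier A" "x \<in> fst X" "y \<in> fst Y"
  shows "pt x (snd Y (a, \<one>\<^bsub>H\<^esub>, \<one>\<^bsub>I\<^esub>) y) = pt (snd X (a, \<one>\<^bsub>G\<^esub>, \<one>\<^bsub>H\<^esub>) x) y"
  using pt_move[of a "\<one>\<^bsub>H\<^esub>" "snd X (a, \<one>\<^bsub>G\<^esub>, \<one>\<^bsub>H\<^esub>) x" y] assms by (simp add: X.act_act)

text \<open>The union that defines the action on orbits has equal terms, because the actions of \<open>G\<close> and \<open>I\<close>
  commute with the one of \<open>A \<times> H\<close> on pairs.\<close>

lemma act_pt:
  assumes "a \<in> carrier A" "g \<in> carrier G" "i \<in> carrier I" "x \<in> fst X" "y \<in> fst Y"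
  shows "(\<Union>(x, y)\<in>pt x y. pt (snd X (a, g, \<one>\<^bsub>H\<^esub>) x) (snd Y (\<one>\<^bsub>A\<^esub>, \<one>\<^bsub>H\<^esub>, i) y))
    = pt (snd X (a, g, \<one>\<^bsub>H\<^esub>) x) (snd Y (\<one>\<^bsub>A\<^esub>, \<one>\<^bsub>H\<^esub>, i) y)" (is "_ = ?r")
proof -
  have "pt (snd X (a, g, \<one>\<^bsub>H\<^esub>) x') (snd Y (\<one>\<^bsub>A\<^esub>, \<one>\<^bsub>H\<^esub>, i) y') = ?r" if p: "(x', y') \<in> pt x y" for x' y'
  proof -
    obtain b h where b: "b \<in> carrier A" "h \<in> carrier H"
      "x' = snd X (inv\<^bsub>A\<^esub> b, \<one>\<^bsub>G\<^esub>, h) x" "y' = snd Y (b, h, \<one>\<^bsub>I\<^esub>) y"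
      using p unfolding mem_pt by blast
    then show ?thesis
      using pt_move[of b h "snd X (a, g, \<one>\<^bsub>H\<^esub>) x" "snd Y (\<one>\<^bsub>A\<^esub>, \<one>\<^bsub>H\<^esub>, i) y"] assms
      by (simp add: X.act_act Y.act_act X.A.m_comm)
  qed
  then have "(\<Union>(x, y)\<in>pt x y. pt (snd X (a, g, \<one>\<^bsub>H\<^esub>) x) (snd Y (\<one>\<^bsub>A\<^esub>, \<one>\<^bsub>H\<^esub>, i) y)) = (\<Union>p\<in>pt x y. ?r)"
    by (intro SUP_cong refl) (auto split: prod.split)
  then show ?thesis using pt_self[OF assms(4,5)] by (metis UN_constant empty_iff)
qed

lemma pt_act_cong:
  assumes "a \<in> carrier A" "g \<in> carrier G" "i \<in> carrier I"
    "x \<in> fst X" "y \<in> fst Y" "x' \<in> fst X" "y' \<in> fst Y" "pt x y = pt x' y'"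
  shows "pt (snd X (a, g, \<one>\<^bsub>H\<^esub>) x) (snd Y (\<one>\<^bsub>A\<^esub>, \<one>\<^bsub>H\<^esub>, i) y)
    = pt (snd X (a, g, \<one>\<^bsub>H\<^esub>) x') (snd Y (\<one>\<^bsub>A\<^esub>, \<one>\<^bsub>H\<^esub>, i) y')"
  using act_pt[OF assms(1-5)] act_pt[OF assms(1-3,6,7)] assms(8) by simp

lemma fst_tensor:
  "fst T = {pt x y | x y. x \<in> fst X \<and> y \<in> fst Y \<and>
     (\<forall>a\<in>carrier A. pt (snd X (a, \<one>\<^bsub>G\<^esub>, \<one>\<^bsub>H\<^esub>) x) y = pt x y \<longrightarrow> a = \<one>\<^bsub>A\<^esub>)}"
proof -
  let ?act = "\<lambda>a. \<lambda>\<omega>. \<Union>(x, y)\<in>\<omega>. pt (snd X (a, \<one>\<^bsub>G\<^esub>, \<one>\<^bsub>H\<^esub>) x) (snd Y (\<one>\<^bsub>A\<^esub>, \<one>\<^bsub>H\<^esub>, \<one>\<^bsub>I\<^esub>) y)"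
  have 1: "fst T = {\<omega> \<in> orbits (A \<times>\<times> H) (fst X \<times> fst Y) (pair_action A G I X Y). stabilizer A ?act \<omega> = {\<one>\<^bsub>A\<^esub>}}"
    by (simp add: fbiset_tensor_def Let_def)
  have 2: "stabilizer A ?act (pt x y) = {\<one>\<^bsub>A\<^esub>} \<longleftrightarrow>
      (\<forall>a\<in>carrier A. pt (snd X (a, \<one>\<^bsub>G\<^esub>, \<one>\<^bsub>H\<^esub>) x) y = pt x y \<longrightarrow> a = \<one>\<^bsub>A\<^esub>)"
    if "x \<in> fst X" "y \<in> fst Y" for x y
  proof -
    have "stabilizer A ?act (pt x y) = {a \<in> carrier A. pt (snd X (a, \<one>\<^bsub>G\<^esub>, \<one>\<^bsub>H\<^esub>) x) y = pt x y}"
      using act_pt[of _ "\<one>\<^bsub>G\<^esub>" "\<one>\<^bsub>I\<^esub>" x y] that by (auto simp: stabilizer_def)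
    moreover have "pt (snd X (\<one>\<^bsub>A\<^esub>, \<one>\<^bsub>G\<^esub>, \<one>\<^bsub>H\<^esub>) x) y = pt x y" using that by simp
    ultimately show ?thesis by auto
  qed
  have 3: "orbits (A \<times>\<times> H) (fst X \<times> fst Y) (pair_action A G I X Y) = {pt x y | x y. x \<in> fst X \<and> y \<in> fst Y}"
    by (auto simp: orbits_def)
  show ?thesis
  proof (intro equalityI subsetI)
    fix \<omega> assume \<omega>: "\<omega> \<in> fst T"
    then obtain x y where xy: "\<omega> = pt x y" "x \<in> fst X" "y \<in> fst Y" unfolding 1 3 by blast
    then show "\<omega> \<in> {pt x y | x y. x \<in> fst X \<and> y \<in> fst Y \<and>
        (\<forall>a\<in>carrier A. pt (snd X (a, \<one>\<^bsub>G\<^esub>, \<one>\<^bsub>H\<^esub>) x) y = pt x y \<longrightarrow> a = \<one>\<^bsub>A\<^esub>)}"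
      using \<omega> 2[OF xy(2,3)] unfolding 1 by blast
  next
    fix \<omega> assume "\<omega> \<in> {pt x y | x y. x \<in> fst X \<and> y \<in> fst Y \<and>
        (\<forall>a\<in>carrier A. pt (snd X (a, \<one>\<^bsub>G\<^esub>, \<one>\<^bsub>H\<^esub>) x) y = pt x y \<longrightarrow> a = \<one>\<^bsub>A\<^esub>)}"
    then show "\<omega> \<in> fst T" unfolding 1 3 using 2 by blast
  qed
qed

lemma pt_in_tensor:
  assumes "x \<in> fst X" "y \<in> fst Y"
  shows "pt x y \<in> fst T \<longleftrightarrow>
    (\<forall>a\<in>carrier A. pt (snd X (a, \<one>\<^bsub>G\<^esub>, \<one>\<^bsub>H\<^esub>) x) y = pt x y \<longrightarrow> a = \<one>\<^bsub>A\<^esub>)"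
proof -
  have "pt (snd X (a, \<one>\<^bsub>G\<^esub>, \<one>\<^bsub>H\<^esub>) x) y = pt (snd X (a, \<one>\<^bsub>G\<^esub>, \<one>\<^bsub>H\<^esub>) x') y'"
    if "a \<in> carrier A" "x' \<in> fst X" "y' \<in> fst Y" "pt x y = pt x' y'" for a x' y'
    using pt_act_cong[of a "\<one>\<^bsub>G\<^esub>" "\<one>\<^bsub>I\<^esub>" x y x' y'] that assms by simp
  then show ?thesis using assms unfolding fst_tensor by blast
qed

lemma snd_tensor:
  assumes "a \<in> carrier A" "g \<in> carrier G" "i \<in> carrier I" "x \<in> fst X" "y \<in> fst Y" "pt x y \<in> fst T"
  shows "snd T (a, g, i) (pt x y) = pt (snd X (a, g, \<one>\<^bsub>H\<^esub>) x) (snd Y (\<one>\<^bsub>A\<^esub>, \<one>\<^bsub>H\<^esub>, i) y)"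
proof -
  have "snd T (a, g, i) = restrict (\<lambda>\<omega>. \<Union>(x, y)\<in>\<omega>. pt (snd X (a, g, \<one>\<^bsub>H\<^esub>) x) (snd Y (\<one>\<^bsub>A\<^esub>, \<one>\<^bsub>H\<^esub>, i) y)) (fst T)"
    by (simp add: fbiset_tensor_def Let_def)
  then show ?thesis using act_pt[OF assms(1-5)] assms(6) by simp
qed

lemma tensor_cases:
  assumes "\<omega> \<in> fst T"
  obtains x y where "\<omega> = pt x y" "x \<in> fst X" "y \<in> fst Y"
  using assms unfolding fst_tensor by blast

lemma pt_act_in_tensor:
  assumes w: "a \<in> carrier A" "g \<in> carrier G" "i \<in> carrier I" and x: "x \<in> fst X" and y: "y \<in> fst Y"
    and "pt x y \<in> fst T"
  shows "pt (snd X (a, g, \<one>\<^bsub>H\<^esub>) x) (snd Y (\<one>\<^bsub>A\<^esub>, \<one>\<^bsub>H\<^esub>, i) y) \<in> fst T"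
proof -
  let ?x = "snd X (a, g, \<one>\<^bsub>H\<^esub>) x" and ?y = "snd Y (\<one>\<^bsub>A\<^esub>, \<one>\<^bsub>H\<^esub>, i) y"
  have "b = \<one>\<^bsub>A\<^esub>" if b: "b \<in> carrier A" "pt (snd X (b, \<one>\<^bsub>G\<^esub>, \<one>\<^bsub>H\<^esub>) ?x) ?y = pt ?x ?y" for b
  proof -
    have "pt (snd X (b, \<one>\<^bsub>G\<^esub>, \<one>\<^bsub>H\<^esub>) x) y = pt x y"
      using pt_act_cong[of "inv\<^bsub>A\<^esub> a" "inv\<^bsub>G\<^esub> g" "inv\<^bsub>I\<^esub> i" "snd X (b, \<one>\<^bsub>G\<^esub>, \<one>\<^bsub>H\<^esub>) ?x" ?y ?x ?y] b w x y
      by (simp add: X.act_act Y.act_act X.A.m_lcomm[of "inv\<^bsub>A\<^esub> a" b a])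
    then show ?thesis using assms(6) b(1) x y by (simp add: pt_in_tensor)
  qed
  then show ?thesis using w x y by (simp add: pt_in_tensor)
qed

text \<open>By \<open>pt_scalar\<close>, the \<open>A\<close>-orbit of \<open>x \<otimes> y\<close> depends only on the \<open>A\<close>-orbits of \<open>x\<close> and \<open>y\<close>; this leaves
  finitely many.\<close>

lemma fibered_tensor: "fibered_biset A G I T"
proof (rule T.fibered_bisetI)
  show "snd T (a, g, i) \<in> extensional (fst T)" for a g i
    by (simp add: fbiset_tensor_def Let_def)
next
  fix a g i \<omega>
  assume w: "a \<in> carrier A" "g \<in> carrier G" "i \<in> carrier I" and "\<omega> \<in> fst T"
  moreover from this(4) obtain x y where "\<omega> = pt x y" "x \<in> fst X" "y \<in> fst Y" by (rule tensor_cases)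
  ultimately show "snd T (a, g, i) \<omega> \<in> fst T"
    using pt_act_in_tensor[of a g i x y] by (simp add: snd_tensor)
next
  fix \<omega> assume \<omega>: "\<omega> \<in> fst T"
  then obtain x y where "\<omega> = pt x y" "x \<in> fst X" "y \<in> fst Y" by (rule tensor_cases)
  then show "snd T (\<one>\<^bsub>A\<^esub>, \<one>\<^bsub>G\<^esub>, \<one>\<^bsub>I\<^esub>) \<omega> = \<omega>" using \<omega> by (simp add: snd_tensor)
next
  fix a g i a' g' i' \<omega>
  assume w: "a \<in> carrier A" "g \<in> carrier G" "i \<in> carrier I" "a' \<in> carrier A" "g' \<in> carrier G" "i' \<in> carrier I"
    and \<omega>: "\<omega> \<in> fst T"
  obtain x y where xy: "\<omega> = pt x y" "x \<in> fst X" "y \<in> fst Y" using \<omega> by (rule tensor_cases)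
  show "snd T (a \<otimes>\<^bsub>A\<^esub> a', g \<otimes>\<^bsub>G\<^esub> g', i \<otimes>\<^bsub>I\<^esub> i') \<omega> = snd T (a, g, i) (snd T (a', g', i') \<omega>)"
    using pt_act_in_tensor[of a' g' i' x y] w \<omega> xy by (simp add: snd_tensor X.act_act Y.act_act)
next
  fix a \<omega> assume a: "a \<in> carrier A" "\<omega> \<in> fst T" "snd T (a, \<one>\<^bsub>G\<^esub>, \<one>\<^bsub>I\<^esub>) \<omega> = \<omega>"
  obtain x y where xy: "\<omega> = pt x y" "x \<in> fst X" "y \<in> fst Y" using a(2) by (rule tensor_cases)
  then show "a = \<one>\<^bsub>A\<^esub>" using a by (simp add: snd_tensor) (simp add: pt_in_tensor)
next
  show "finite ((\<lambda>(x, y). pt x y) ` (X.A_rep ` fst X \<times> Y.A_rep ` fst Y))"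
    using X.finite_A_reps Y.finite_A_reps by simp
  fix \<omega> assume \<omega>: "\<omega> \<in> fst T"
  obtain x y where xy: "\<omega> = pt x y" "x \<in> fst X" "y \<in> fst Y" using \<omega> by (rule tensor_cases)
  define x0 y0 where "x0 = X.A_rep x" and "y0 = Y.A_rep y"
  have x0: "x0 \<in> fst X" and y0: "y0 \<in> fst Y"
    using X.A_rep(1) Y.A_rep(1) xy by (auto simp: x0_def y0_def)
  obtain a where a: "a \<in> carrier A" "x = snd X (a, \<one>\<^bsub>G\<^esub>, \<one>\<^bsub>H\<^esub>) x0"
    using X.A_rep(2)[OF xy(2)] unfolding x0_def by blast
  obtain b where b: "b \<in> carrier A" "y = snd Y (b, \<one>\<^bsub>H\<^esub>, \<one>\<^bsub>I\<^esub>) y0"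
    using Y.A_rep(2)[OF xy(3)] unfolding y0_def by blast
  have 1: "\<omega> = pt (snd X (b \<otimes>\<^bsub>A\<^esub> a, \<one>\<^bsub>G\<^esub>, \<one>\<^bsub>H\<^esub>) x0) y0"
    using xy(1) pt_scalar[of b x y0] a b x0 y0 by (simp add: X.act_act)
  have 2: "pt x0 y0 \<in> fst T"
    using pt_act_in_tensor[of "inv\<^bsub>A\<^esub> (b \<otimes>\<^bsub>A\<^esub> a)" "\<one>\<^bsub>G\<^esub>" "\<one>\<^bsub>I\<^esub>" "snd X (b \<otimes>\<^bsub>A\<^esub> a, \<one>\<^bsub>G\<^esub>, \<one>\<^bsub>H\<^esub>) x0" y0]
      \<omega>[unfolded 1] a(1) b(1) x0 y0 by (simp add: X.act_act)
  have "\<omega> = snd T (b \<otimes>\<^bsub>A\<^esub> a, \<one>\<^bsub>G\<^esub>, \<one>\<^bsub>I\<^esub>) (pt x0 y0)"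
    using 1 2 a(1) b(1) x0 y0 by (simp add: snd_tensor)
  then show "\<exists>z\<in>(\<lambda>(x, y). pt x y) ` (X.A_rep ` fst X \<times> Y.A_rep ` fst Y) \<inter> fst T.
      \<exists>a\<in>carrier A. \<omega> = snd T (a, \<one>\<^bsub>G\<^esub>, \<one>\<^bsub>I\<^esub>) z"
    using 2 a(1) b(1) xy(2,3) by (intro bexI[of _ "pt x0 y0"] bexI[of _ "b \<otimes>\<^bsub>A\<^esub> a"]) (auto simp: x0_def y0_def)
qed

sublocale tensor: fibered A G I T
  by unfold_locales (rule fibered_tensor)

end

text \<open>Equivariance makes \<open>f \<times> g\<close> send the orbit of \<open>(x, y)\<close> onto the orbit of \<open>(f x, g y)\<close>, and injectivity
  makes distinct orbits stay distinct. So \<open>A\<close> acts freely on \<open>x \<otimes> y\<close> if and only if it acts freely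
  on \<open>f x \<otimes> g y\<close>. Surjective \<open>f\<close> and \<open>g\<close> give the invariance of the tensor product under
  isomorphism, inclusions of parts of a disjoint union give distributivity.\<close>

lemma tensor_emb:
  assumes "fibered_pair A G H I X Y" "fibered_pair A G H I X' Y'"
    and f: "fbiset_emb A G H X X' f" and g: "fbiset_emb A H I Y Y' g"
  shows "fbiset_emb A G I (fbiset_tensor A G H I X Y) (fbiset_tensor A G H I X' Y') (image (map_prod f g))"
    and "image (map_prod f g) ` fst (fbiset_tensor A G H I X Y)
      = {\<omega> \<in> fst (fbiset_tensor A G H I X' Y'). \<omega> \<subseteq> f ` fst X \<times> g ` fst Y}"
proof -
  interpret P: fibered_pair A G H I X Y by fact
  interpret P': fibered_pair A G H I X' Y' by fact
  note f = fbiset_embD[OF f] and g = fbiset_embD[OF g]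
  let ?F = "image (map_prod f g)"
  have pt: "?F (P.pt x y) = P'.pt (f x) (g y)" if xy: "x \<in> fst X" "y \<in> fst Y" for x y
  proof -
    have *: "P.pt x y = (\<lambda>(a, h). (snd X (inv\<^bsub>A\<^esub> a, \<one>\<^bsub>G\<^esub>, h) x, snd Y (a, h, \<one>\<^bsub>I\<^esub>) y)) ` (carrier A \<times> carrier H)"
      "P'.pt (f x) (g y) = (\<lambda>(a, h). (snd X' (inv\<^bsub>A\<^esub> a, \<one>\<^bsub>G\<^esub>, h) (f x), snd Y' (a, h, \<one>\<^bsub>I\<^esub>) (g y)))
        ` (carrier A \<times> carrier H)"
      by (simp_all add: set_eq_iff P.mem_pt P'.mem_pt image_iff)
    show ?thesis unfolding * image_image
      by (rule image_cong) (use xy in \<open>auto simp: f g\<close>)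
  qed
  have inj: "inj_on (map_prod f g) (fst X \<times> fst Y)"
    using f(1) g(1) by (rule map_prod_inj_on)
  have pt_eq: "P'.pt (f x) (g y) = P'.pt (f x') (g y') \<longleftrightarrow> P.pt x y = P.pt x' y'"
    if "x \<in> fst X" "y \<in> fst Y" "x' \<in> fst X" "y' \<in> fst Y" for x y x' y'
    using inj_on_image_eq_iff[OF inj P.pt_subset[OF that(1,2)] P.pt_subset[OF that(3,4)]] that
    by (simp add: pt)
  have mem: "P'.pt (f x) (g y) \<in> fst P'.T \<longleftrightarrow> P.pt x y \<in> fst P.T" if "x \<in> fst X" "y \<in> fst Y" for x y
    using that by (simp add: P.pt_in_tensor P'.pt_in_tensor f g pt_eq)
  show "fbiset_emb A G I P.T P'.T ?F"
    unfolding fbiset_emb_def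
  proof (intro conjI ballI)
    show "inj_on ?F (fst P.T)"
    proof (rule inj_on_subset)
      show "inj_on ?F (Pow (fst X \<times> fst Y))" using inj by (rule inj_on_image_Pow)
      show "fst P.T \<subseteq> Pow (fst X \<times> fst Y)"
        using P.pt_subset by (auto elim!: P.tensor_cases)
    qed
    show "?F ` fst P.T \<subseteq> fst P'.T"
    proof
      fix \<omega>' assume "\<omega>' \<in> ?F ` fst P.T"
      then obtain \<omega> where \<omega>: "\<omega> \<in> fst P.T" "\<omega>' = ?F \<omega>" by blast
      from \<omega>(1) obtain x y where "\<omega> = P.pt x y" "x \<in> fst X" "y \<in> fst Y" by (rule P.tensor_cases)
      then show "\<omega>' \<in> fst P'.T" using mem[of x y] pt[of x y] \<omega> by simp
    qed
    fix a h i \<omega> assume w: "a \<in> carrier A" "h \<in> carrier G" "i \<in> carrier I" and \<omega>: "\<omega> \<in> fst P.T"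
    obtain x y where xy: "\<omega> = P.pt x y" "x \<in> fst X" "y \<in> fst Y" using \<omega> by (rule P.tensor_cases)
    then show "?F (snd P.T (a, h, i) \<omega>) = snd P'.T (a, h, i) (?F \<omega>)"
      using w \<omega> mem[of x y] by (simp add: P.snd_tensor P'.snd_tensor pt f g)
  qed
  show "?F ` fst P.T = {\<omega> \<in> fst P'.T. \<omega> \<subseteq> f ` fst X \<times> g ` fst Y}"
  proof (intro equalityI subsetI)
    fix \<omega> assume "\<omega> \<in> ?F ` fst P.T"
    then obtain \<omega>' where \<omega>': "\<omega>' \<in> fst P.T" "\<omega> = ?F \<omega>'" by blast
    from \<omega>'(1) obtain x y where "\<omega>' = P.pt x y" "x \<in> fst X" "y \<in> fst Y" by (rule P.tensor_cases)
    with \<omega>' have "\<omega> = ?F (P.pt x y)" "P.pt x y \<in> fst P.T" "x \<in> fst X" "y \<in> fst Y" by simp_all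
    then show "\<omega> \<in> {\<omega> \<in> fst P'.T. \<omega> \<subseteq> f ` fst X \<times> g ` fst Y}"
      using mem[of x y] pt[of x y] image_mono[OF P.pt_subset[of x y], of "map_prod f g"]
      by (simp add: map_prod_surj_on[OF refl refl])
  next
    fix \<omega> assume \<omega>: "\<omega> \<in> {\<omega> \<in> fst P'.T. \<omega> \<subseteq> f ` fst X \<times> g ` fst Y}"
    then have "\<omega> \<in> fst P'.T" by simp
    then obtain x' y' where xy': "\<omega> = P'.pt x' y'" "x' \<in> fst X'" "y' \<in> fst Y'"
      by (rule P'.tensor_cases)
    then have "(x', y') \<in> f ` fst X \<times> g ` fst Y" using P'.pt_self \<omega> by blast
    then obtain x y where "x' = f x" "y' = g y" "x \<in> fst X" "y \<in> fst Y" by blast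
    then show "\<omega> \<in> ?F ` fst P.T" using mem[of x y] pt[of x y] \<omega> xy' by auto
  qed
qed

section \<open>Composition in the Burnside groups\<close>

lemma (in fibered) fbiset_emb_id: "fbiset_emb A G H X X (\<lambda>x. x)"
  by (auto simp: fbiset_emb_def)

text \<open>The union that defines \<open>class_tensor\<close> runs over pairs of isomorphic copies, whose tensor products are
  isomorphic to the one of \<open>X\<close> and \<open>Y\<close>.\<close>

lemma (in fibered_pair) class_tensor_iso_class:
  "class_tensor A G H I (iso_class A G H X) (iso_class A H I Y) = iso_class A G I T"
proof -
  have eq: "iso_class A G I (fbiset_tensor A G H I X' Y') = iso_class A G I T"
    if X': "X' \<in> iso_class A G H X" and Y': "Y' \<in> iso_class A H I Y" for X' Y'
  proof -
    obtain f where f: "fbiset_emb A G H X X' f" "f ` fst X = fst X'"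
      using X' unfolding iso_class_def fbiset_iso_iff_emb by blast
    obtain g where g: "fbiset_emb A H I Y Y' g" "g ` fst Y = fst Y'"
      using Y' unfolding iso_class_def fbiset_iso_iff_emb by blast
    interpret P': fibered_pair A G H I X' Y'
      using X' Y' by unfold_locales (auto simp: iso_class_def)
    note emb = tensor_emb[OF fibered_pair_axioms P'.fibered_pair_axioms f(1) g(1)]
    have "\<omega> \<subseteq> f ` fst X \<times> g ` fst Y" if "\<omega> \<in> fst P'.T" for \<omega>
      using that P'.pt_subset unfolding f g by (elim P'.tensor_cases) simp
    then have "image (map_prod f g) ` fst T = fst P'.T" unfolding emb(2) by blast
    then have "fbiset_iso A G I T P'.T" unfolding fbiset_iso_iff_emb using emb(1) by blast
    then show ?thesis by (rule tensor.iso_class_eqI[symmetric])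
  qed
  obtain X' where "X' \<in> iso_class A G H X"
    using X.fibered_biset_copy unfolding iso_class_def by blast
  moreover obtain Y' where "Y' \<in> iso_class A H I Y"
    using Y.fibered_biset_copy unfolding iso_class_def by blast
  ultimately show ?thesis unfolding class_tensor_def using eq by blast
qed

text \<open>Distributivity: the embedded parts of \<open>Z\<close> are stable under \<open>H\<close> and \<open>A\<close>, so every point \<open>z \<otimes> y\<close>
  of the tensor product lies over exactly one of them.\<close>

lemma tensor_split_left:
  assumes X1: "fibered_pair A G H I X1 Y" and X2: "fibered_pair A G H I X2 Y" and Z: "fibered_pair A G H I Z Y"
    and i: "fbiset_emb A G H X1 Z i" and j: "fbiset_emb A G H X2 Z j"
    and cover: "i ` fst X1 \<union> j ` fst X2 = fst Z" and disjoint: "i ` fst X1 \<inter> j ` fst X2 = {}"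
  shows "frag_of (iso_class A G I (fbiset_tensor A G H I Z Y))
    - frag_of (iso_class A G I (fbiset_tensor A G H I X1 Y))
    - frag_of (iso_class A G I (fbiset_tensor A G H I X2 Y)) \<in> union_relations A G I"
proof -
  interpret X1: fibered_pair A G H I X1 Y by fact
  interpret X2: fibered_pair A G H I X2 Y by fact
  interpret Z: fibered_pair A G H I Z Y by fact
  note F = tensor_emb[OF X1 Z i X1.Y.fbiset_emb_id]
  note F' = tensor_emb[OF X2 Z j X1.Y.fbiset_emb_id]
  have sub: "Z.pt (k x) y \<subseteq> k ` fst X \<times> fst Y"
    if "fibered_biset A G H X" "fbiset_emb A G H X Z k" "x \<in> fst X" "y \<in> fst Y"
    for X :: "('a, 'c, 'e, 'z) fbiset" and k x y
  proof -
    interpret X: fibered A G H X by unfold_locales fact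
    show ?thesis using fbiset_embD[OF that(2)] that(3,4) by (auto simp: Z.mem_pt)
  qed
  show ?thesis
  proof (rule X1.T.split_relation)
    show "fibered_biset A G I X1.T" "fibered_biset A G I X2.T" "fibered_biset A G I Z.T"
      by (rule X1.fibered_tensor X2.fibered_tensor Z.fibered_tensor)+
    show "fbiset_emb A G I X1.T Z.T (image (map_prod i (\<lambda>y. y)))" by (rule F(1))
    show "fbiset_emb A G I X2.T Z.T (image (map_prod j (\<lambda>y. y)))" by (rule F'(1))
    have "\<omega> \<noteq> {}" if "\<omega> \<in> fst Z.T" for \<omega>
      using that Z.pt_self by (elim Z.tensor_cases) blast
    then show "image (map_prod i (\<lambda>y. y)) ` fst X1.T \<inter> image (map_prod j (\<lambda>y. y)) ` fst X2.T = {}"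
      unfolding F(2) F'(2) using disjoint by fast
    have "\<omega> \<subseteq> i ` fst X1 \<times> fst Y \<or> \<omega> \<subseteq> j ` fst X2 \<times> fst Y" if \<omega>: "\<omega> \<in> fst Z.T" for \<omega>
    proof -
      obtain z y where zy: "\<omega> = Z.pt z y" "z \<in> fst Z" "y \<in> fst Y" using \<omega> by (rule Z.tensor_cases)
      then consider x where "x \<in> fst X1" "z = i x" | x where "x \<in> fst X2" "z = j x"
        using cover by blast
      then show ?thesis
      proof cases
        case 1 then show ?thesis using sub[OF X1.X.fibered i] zy by simp
      next
        case 2 then show ?thesis using sub[OF X2.X.fibered j] zy by simp
      qed
    qed
    then show "image (map_prod i (\<lambda>y. y)) ` fst X1.T \<union> image (map_prod j (\<lambda>y. y)) ` fst X2.T = fst Z.T"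
      unfolding F(2) F'(2) by auto
  qed
qed

lemma tensor_split_right:
  assumes Y1: "fibered_pair A G H I X Y1" and Y2: "fibered_pair A G H I X Y2" and Z: "fibered_pair A G H I X Z"
    and i: "fbiset_emb A H I Y1 Z i" and j: "fbiset_emb A H I Y2 Z j"
    and cover: "i ` fst Y1 \<union> j ` fst Y2 = fst Z" and disjoint: "i ` fst Y1 \<inter> j ` fst Y2 = {}"
  shows "frag_of (iso_class A G I (fbiset_tensor A G H I X Z))
    - frag_of (iso_class A G I (fbiset_tensor A G H I X Y1))
    - frag_of (iso_class A G I (fbiset_tensor A G H I X Y2)) \<in> union_relations A G I"
proof -
  interpret Y1: fibered_pair A G H I X Y1 by fact
  interpret Y2: fibered_pair A G H I X Y2 by fact
  interpret Z: fibered_pair A G H I X Z by fact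
  note F = tensor_emb[OF Y1 Z Y1.X.fbiset_emb_id i]
  note F' = tensor_emb[OF Y2 Z Y1.X.fbiset_emb_id j]
  have sub: "Z.pt x (k y) \<subseteq> fst X \<times> k ` fst Y"
    if "fibered_biset A H I Y" "fbiset_emb A H I Y Z k" "x \<in> fst X" "y \<in> fst Y"
    for Y :: "('a, 'e, 'g, 'z) fbiset" and k x y
  proof -
    interpret Y: fibered A H I Y by unfold_locales fact
    show ?thesis using fbiset_embD[OF that(2)] that(3,4) by (auto simp: Z.mem_pt)
  qed
  show ?thesis
  proof (rule Y1.T.split_relation)
    show "fibered_biset A G I Y1.T" "fibered_biset A G I Y2.T" "fibered_biset A G I Z.T"
      by (rule Y1.fibered_tensor Y2.fibered_tensor Z.fibered_tensor)+
    show "fbiset_emb A G I Y1.T Z.T (image (map_prod (\<lambda>x. x) i))" by (rule F(1))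
    show "fbiset_emb A G I Y2.T Z.T (image (map_prod (\<lambda>x. x) j))" by (rule F'(1))
    have "\<omega> \<noteq> {}" if "\<omega> \<in> fst Z.T" for \<omega>
      using that Z.pt_self by (elim Z.tensor_cases) blast
    then show "image (map_prod (\<lambda>x. x) i) ` fst Y1.T \<inter> image (map_prod (\<lambda>x. x) j) ` fst Y2.T = {}"
      unfolding F(2) F'(2) using disjoint by fast
    have "\<omega> \<subseteq> fst X \<times> i ` fst Y1 \<or> \<omega> \<subseteq> fst X \<times> j ` fst Y2" if \<omega>: "\<omega> \<in> fst Z.T" for \<omega>
    proof -
      obtain x z where zy: "\<omega> = Z.pt x z" "x \<in> fst X" "z \<in> fst Z" using \<omega> by (rule Z.tensor_cases)
      then consider y where "y \<in> fst Y1" "z = i y" | y where "y \<in> fst Y2" "z = j y"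
        using cover by blast
      then show ?thesis
      proof cases
        case 1 then show ?thesis using sub[OF Y1.Y.fibered i] zy by simp
      next
        case 2 then show ?thesis using sub[OF Y2.Y.fibered j] zy by simp
      qed
    qed
    then show "image (map_prod (\<lambda>x. x) i) ` fst Y1.T \<union> image (map_prod (\<lambda>x. x) j) ` fst Y2.T = fst Z.T"
      unfolding F(2) F'(2) by auto
  qed
qed

context three_groups
begin

lemma iso_classes_cases:
  assumes "c \<in> iso_classes A G H"
  obtains X :: "('a, 'g, 'h, 'a \<times> nat) fbiset" where "fibered A G H X" "c = iso_class A G H X"
  using assms unfolding iso_classes_def fibered_def fibered_axioms_def
  using three_groups_axioms by blast

lemma union_relations_cases:
  assumes "r \<in> union_relations A G H"
  obtains X Y :: "('a, 'g, 'h, 'a \<times> nat) fbiset" where "fibered A G H X" "fibered A G H Y"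
    "fibered A G H (fbiset_union X Y)"
    "r = frag_of (iso_class A G H (fbiset_union X Y)) - frag_of (iso_class A G H X) - frag_of (iso_class A G H Y)"
  using assms fibered_biset_union three_groups_axioms
  unfolding union_relations_def fibered_def fibered_axioms_def by blast

lemma union_relations_subset: "union_relations A G H \<subseteq> carrier (free_Abelian_group (iso_classes A G H))"
proof
  fix r assume "r \<in> union_relations A G H"
  then obtain X Y :: "('a, 'g, 'h, 'a \<times> nat) fbiset" where XY: "fibered A G H X" "fibered A G H Y"
    "fibered A G H (fbiset_union X Y)"
    and r: "r = frag_of (iso_class A G H (fbiset_union X Y)) - frag_of (iso_class A G H X) - frag_of (iso_class A G H Y)"
    by (rule union_relations_cases)
  have "Poly_Mapping.keys r \<subseteq> iso_classes A G H"
    unfolding r using XY[THEN fibered.iso_class_in_iso_classes]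
    by (intro order.trans[OF keys_diff] Un_least) auto
  then show "r \<in> carrier (free_Abelian_group (iso_classes A G H))" by simp
qed

lemma comm_group_burnside: "comm_group (burnside_group A G H)"
  unfolding burnside_group_def using union_relations_subset by (rule comm_group_presented_group)

lemma tensor_relations_subset:
  assumes "cring k"
  shows "tensor_relations k (burnside_group A G H)
    \<subseteq> carrier (free_Abelian_group (tensor_generators k (burnside_group A G H)))"
proof
  interpret k: cring k by fact
  interpret B: comm_group "burnside_group A G H" by (rule comm_group_burnside)
  fix r assume "r \<in> tensor_relations k (burnside_group A G H)"
  then have "Poly_Mapping.keys r \<subseteq> tensor_generators k (burnside_group A G H)"
    unfolding tensor_relations_def tensor_generators_def
    by (elim UnE CollectE exE conjE) (auto dest!: subsetD[OF keys_diff])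
  then show "r \<in> carrier (free_Abelian_group (tensor_generators k (burnside_group A G H)))" by simp
qed

end

lemma (in fibered) burnside_class_closed:
  "burnside_class A G H X \<in> carrier (burnside_group A G H)"
  unfolding burnside_class_def burnside_group_def carrier_presented_group
  using iso_class_in_iso_classes by (intro imageI) simp

lemma (in fibered) kburnside_class_closed:
  assumes "cring k"
  shows "kburnside_class k A G H X \<in> carrier (kburnside_group k A G H)"
proof -
  interpret cring k by fact
  show ?thesis
  unfolding kburnside_class_def kburnside_group_def carrier_presented_group
  using burnside_class_closed by (intro imageI) (simp add: tensor_generators_def)
qed

locale four_groups = GH: three_groups A G H + HI: three_groups A H I
  for A :: "('a, 'm) monoid_scheme" and G :: "('g, 'p) monoid_scheme"
    and H :: "('h, 'q) monoid_scheme" and I :: "('i, 'r) monoid_scheme"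
begin

sublocale GI: three_groups A G I ..

lemma fibered_pairI: "fibered A G H X \<Longrightarrow> fibered A H I Y \<Longrightarrow> fibered_pair A G H I X Y"
  by (simp add: fibered_pair_def)

sublocale comp: presented_bilinear "iso_classes A G H" "union_relations A G H"
  "iso_classes A H I" "union_relations A H I" "iso_classes A G I" "union_relations A G I"
  "class_tensor A G H I"
proof
  show "union_relations A G H \<subseteq> carrier (free_Abelian_group (iso_classes A G H))"
    "union_relations A H I \<subseteq> carrier (free_Abelian_group (iso_classes A H I))"
    "union_relations A G I \<subseteq> carrier (free_Abelian_group (iso_classes A G I))"
    by (rule GH.union_relations_subset HI.union_relations_subset GI.union_relations_subset)+
  show "class_tensor A G H I c d \<in> iso_classes A G I"
    if c: "c \<in> iso_classes A G H" and d: "d \<in> iso_classes A H I" for c d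
  proof -
    obtain X :: "('a, 'g, 'h, 'a \<times> nat) fbiset" where X: "fibered A G H X" "c = iso_class A G H X"
      using c by (rule GH.iso_classes_cases)
    obtain Y :: "('a, 'h, 'i, 'a \<times> nat) fbiset" where Y: "fibered A H I Y" "d = iso_class A H I Y"
      using d by (rule HI.iso_classes_cases)
    interpret P: fibered_pair A G H I X Y using X Y by (intro fibered_pairI)
    show ?thesis unfolding X Y P.class_tensor_iso_class by (rule P.tensor.iso_class_in_iso_classes)
  qed
  show "frag_bilinear (class_tensor A G H I) r (frag_of d) \<in> relators (iso_classes A G I) (union_relations A G I)"
    if r: "r \<in> union_relations A G H" and d: "d \<in> iso_classes A H I" for r d
  proof -
    obtain X1 X2 :: "('a, 'g, 'h, 'a \<times> nat) fbiset" where X: "fibered A G H X1" "fibered A G H X2"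
      "fibered A G H (fbiset_union X1 X2)"
      and r: "r = frag_of (iso_class A G H (fbiset_union X1 X2)) - frag_of (iso_class A G H X1) - frag_of (iso_class A G H X2)"
      using r by (rule GH.union_relations_cases)
    obtain Y :: "('a, 'h, 'i, 'a \<times> nat) fbiset" where Y: "fibered A H I Y" and d: "d = iso_class A H I Y"
      using d by (rule HI.iso_classes_cases)
    note P = X[THEN fibered_pairI, OF Y]
    have "frag_bilinear (class_tensor A G H I) r (frag_of d) \<in> union_relations A G I"
      unfolding r d frag_bilinear_diff_left frag_bilinear_of P[THEN fibered_pair.class_tensor_iso_class]
    proof (rule tensor_split_left[OF P])
      show "fbiset_emb A G H X1 (fbiset_union X1 X2) Inl" "fbiset_emb A G H X2 (fbiset_union X1 X2) Inr"
        by (rule fbiset_union_emb)+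
    qed (auto simp: fbiset_union_def)
    then show ?thesis by (rule generate.incl)
  qed
  show "frag_bilinear (class_tensor A G H I) (frag_of c) r \<in> relators (iso_classes A G I) (union_relations A G I)"
    if r: "r \<in> union_relations A H I" and c: "c \<in> iso_classes A G H" for r c
  proof -
    obtain Y1 Y2 :: "('a, 'h, 'i, 'a \<times> nat) fbiset" where Y: "fibered A H I Y1" "fibered A H I Y2"
      "fibered A H I (fbiset_union Y1 Y2)"
      and r: "r = frag_of (iso_class A H I (fbiset_union Y1 Y2)) - frag_of (iso_class A H I Y1) - frag_of (iso_class A H I Y2)"
      using r by (rule HI.union_relations_cases)
    obtain X :: "('a, 'g, 'h, 'a \<times> nat) fbiset" where X: "fibered A G H X" and c: "c = iso_class A G H X"
      using c by (rule GH.iso_classes_cases)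
    note P = Y[THEN fibered_pairI[OF X]]
    have "frag_bilinear (class_tensor A G H I) (frag_of c) r \<in> union_relations A G I"
      unfolding r c frag_bilinear_diff_right frag_bilinear_of P[THEN fibered_pair.class_tensor_iso_class]
    proof (rule tensor_split_right[OF P])
      show "fbiset_emb A H I Y1 (fbiset_union Y1 Y2) Inl" "fbiset_emb A H I Y2 (fbiset_union Y1 Y2) Inr"
        by (rule fbiset_union_emb)+
    qed (auto simp: fbiset_union_def)
    then show ?thesis by (rule generate.incl)
  qed
qed

lemma burnside_comp_class:
  assumes "fibered A G H X" "fibered A H I Y"
  shows "burnside_comp A G H I (burnside_class A G H X) (burnside_class A H I Y)
    = burnside_class A G I (fbiset_tensor A G H I X Y)"
proof -
  interpret P: fibered_pair A G H I X Y using assms by (intro fibered_pairI)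
  show ?thesis
    unfolding burnside_comp_def burnside_class_def
    using P.X.iso_class_in_iso_classes P.Y.iso_class_in_iso_classes
    by (simp add: comp.induced_bilinear_class P.class_tensor_iso_class)
qed

lemma burnside_comp_closed:
  "\<lbrakk>b \<in> carrier (burnside_group A G H); c \<in> carrier (burnside_group A H I)\<rbrakk>
    \<Longrightarrow> burnside_comp A G H I b c \<in> carrier (burnside_group A G I)"
  unfolding burnside_comp_def burnside_group_def by (rule comp.induced_bilinear_closed)

lemma burnside_comp_mult_left:
  "\<lbrakk>b \<in> carrier (burnside_group A G H); b' \<in> carrier (burnside_group A G H); c \<in> carrier (burnside_group A H I)\<rbrakk>
    \<Longrightarrow> burnside_comp A G H I (b \<otimes>\<^bsub>burnside_group A G H\<^esub> b') c
      = burnside_comp A G H I b c \<otimes>\<^bsub>burnside_group A G I\<^esub> burnside_comp A G H I b' c"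
  unfolding burnside_comp_def burnside_group_def by (rule comp.induced_bilinear_mult_left)

lemma burnside_comp_mult_right:
  "\<lbrakk>b \<in> carrier (burnside_group A G H); c \<in> carrier (burnside_group A H I); c' \<in> carrier (burnside_group A H I)\<rbrakk>
    \<Longrightarrow> burnside_comp A G H I b (c \<otimes>\<^bsub>burnside_group A H I\<^esub> c')
      = burnside_comp A G H I b c \<otimes>\<^bsub>burnside_group A G I\<^esub> burnside_comp A G H I b c'"
  unfolding burnside_comp_def burnside_group_def by (rule comp.induced_bilinear_mult_right)

text \<open>The relations of \<open>k \<otimes> B\<close> are additivity in the scalar and additivity in the class. The first is
  preserved by distributivity in \<open>k\<close>, the second by biadditivity of the composition over the
  integers.\<close>

lemma kcomp_presented_bilinear:
  assumes "cring k"
  shows "presented_bilinear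
    (tensor_generators k (burnside_group A G H)) (tensor_relations k (burnside_group A G H))
    (tensor_generators k (burnside_group A H I)) (tensor_relations k (burnside_group A H I))
    (tensor_generators k (burnside_group A G I)) (tensor_relations k (burnside_group A G I))
    (\<lambda>(r, b) (s, c). (r \<otimes>\<^bsub>k\<^esub> s, burnside_comp A G H I b c))"
    (is "presented_bilinear _ _ _ _ ?S ?R ?f")
proof
  interpret k: cring k by fact
  interpret BGH: comm_group "burnside_group A G H" by (rule GH.comm_group_burnside)
  interpret BHI: comm_group "burnside_group A H I" by (rule HI.comm_group_burnside)
  show "tensor_relations k (burnside_group A G H) \<subseteq> carrier (free_Abelian_group (tensor_generators k (burnside_group A G H)))"
    "tensor_relations k (burnside_group A H I) \<subseteq> carrier (free_Abelian_group (tensor_generators k (burnside_group A H I)))"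
    "?R \<subseteq> carrier (free_Abelian_group ?S)"
    by (rule GH.tensor_relations_subset[OF assms] HI.tensor_relations_subset[OF assms] GI.tensor_relations_subset[OF assms])+
  show "?f x y \<in> ?S" if "x \<in> tensor_generators k (burnside_group A G H)"
    "y \<in> tensor_generators k (burnside_group A H I)" for x y
    using that burnside_comp_closed by (auto simp: tensor_generators_def)
  show "frag_bilinear ?f \<rho> (frag_of y) \<in> relators ?S ?R"
    if \<rho>: "\<rho> \<in> tensor_relations k (burnside_group A G H)"
      and y: "y \<in> tensor_generators k (burnside_group A H I)" for \<rho> y
  proof (rule generate.incl)
    obtain s c where y: "y = (s, c)" "s \<in> carrier k" "c \<in> carrier (burnside_group A H I)"
      using y by (auto simp: tensor_generators_def)
    from \<rho> show "frag_bilinear ?f \<rho> (frag_of y) \<in> ?R"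
      unfolding tensor_relations_def[of k "burnside_group A G H"]
    proof (elim UnE CollectE exE conjE)
      fix r r' b
      assume "\<rho> = frag_of (r \<oplus>\<^bsub>k\<^esub> r', b) - frag_of (r, b) - frag_of (r', b)"
        "r \<in> carrier k" "r' \<in> carrier k" "b \<in> carrier (burnside_group A G H)"
      then show ?thesis
        using burnside_comp_closed[of b c] y
        unfolding tensor_relations_def
        by (intro UnI1 CollectI exI[of _ "r \<otimes>\<^bsub>k\<^esub> s"] exI[of _ "r' \<otimes>\<^bsub>k\<^esub> s"] exI[of _ "burnside_comp A G H I b c"])
          (simp add: frag_bilinear_diff_left k.l_distr)
    next
      fix r b b'
      assume "\<rho> = frag_of (r, b \<otimes>\<^bsub>burnside_group A G H\<^esub> b') - frag_of (r, b) - frag_of (r, b')"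
        "r \<in> carrier k" "b \<in> carrier (burnside_group A G H)" "b' \<in> carrier (burnside_group A G H)"
      then show ?thesis
        using burnside_comp_closed[of b c] burnside_comp_closed[of b' c] burnside_comp_mult_left[of b b' c] y
        unfolding tensor_relations_def
        by (intro UnI2 CollectI exI[of _ "r \<otimes>\<^bsub>k\<^esub> s"] exI[of _ "burnside_comp A G H I b c"] exI[of _ "burnside_comp A G H I b' c"])
          (simp add: frag_bilinear_diff_left)
    qed
  qed
  show "frag_bilinear ?f (frag_of x) \<rho> \<in> relators ?S ?R"
    if \<rho>: "\<rho> \<in> tensor_relations k (burnside_group A H I)"
      and x: "x \<in> tensor_generators k (burnside_group A G H)" for \<rho> x
  proof (rule generate.incl)
    obtain r b where x: "x = (r, b)" "r \<in> carrier k" "b \<in> carrier (burnside_group A G H)"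
      using x by (auto simp: tensor_generators_def)
    from \<rho> show "frag_bilinear ?f (frag_of x) \<rho> \<in> ?R"
      unfolding tensor_relations_def[of k "burnside_group A H I"]
    proof (elim UnE CollectE exE conjE)
      fix s s' c
      assume "\<rho> = frag_of (s \<oplus>\<^bsub>k\<^esub> s', c) - frag_of (s, c) - frag_of (s', c)"
        "s \<in> carrier k" "s' \<in> carrier k" "c \<in> carrier (burnside_group A H I)"
      then show ?thesis
        using burnside_comp_closed[of b c] x
        unfolding tensor_relations_def
        by (intro UnI1 CollectI exI[of _ "r \<otimes>\<^bsub>k\<^esub> s"] exI[of _ "r \<otimes>\<^bsub>k\<^esub> s'"] exI[of _ "burnside_comp A G H I b c"])
          (simp add: frag_bilinear_diff_right k.r_distr)
    next
      fix s c c'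
      assume "\<rho> = frag_of (s, c \<otimes>\<^bsub>burnside_group A H I\<^esub> c') - frag_of (s, c) - frag_of (s, c')"
        "s \<in> carrier k" "c \<in> carrier (burnside_group A H I)" "c' \<in> carrier (burnside_group A H I)"
      then show ?thesis
        using burnside_comp_closed[of b c] burnside_comp_closed[of b c'] burnside_comp_mult_right[of b c c'] x
        unfolding tensor_relations_def
        by (intro UnI2 CollectI exI[of _ "r \<otimes>\<^bsub>k\<^esub> s"] exI[of _ "burnside_comp A G H I b c"] exI[of _ "burnside_comp A G H I b c'"])
          (simp add: frag_bilinear_diff_right)
    qed
  qed
qed

lemma kburnside_comp_class:
  assumes k: "cring k" and X: "fibered A G H X" and Y: "fibered A H I Y"
  shows "kburnside_comp k A G H I (kburnside_class k A G H X) (kburnside_class k A H I Y)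
    = kburnside_class k A G I (fbiset_tensor A G H I X Y)"
proof -
  interpret k: cring k by fact
  interpret kcomp: presented_bilinear
    "tensor_generators k (burnside_group A G H)" "tensor_relations k (burnside_group A G H)"
    "tensor_generators k (burnside_group A H I)" "tensor_relations k (burnside_group A H I)"
    "tensor_generators k (burnside_group A G I)" "tensor_relations k (burnside_group A G I)"
    "\<lambda>(r, b) (s, c). (r \<otimes>\<^bsub>k\<^esub> s, burnside_comp A G H I b c)"
    by (rule kcomp_presented_bilinear[OF k])
  show ?thesis
    unfolding kburnside_comp_def kburnside_class_def
    by (subst kcomp.induced_bilinear_class)
      (use fibered.burnside_class_closed[OF X] fibered.burnside_class_closed[OF Y]
        in \<open>simp_all add: tensor_generators_def burnside_comp_class[OF X Y]\<close>)
qed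

end

section \<open>Cosets as fibered bisets\<close>

lemma (in group) l_coset_eq_iff:
  assumes D: "subgroup D G" and x: "x \<in> carrier G" and y: "y \<in> carrier G"
  shows "x <# D = y <# D \<longleftrightarrow> inv y \<otimes> x \<in> D"
proof
  assume "x <# D = y <# D"
  then have "x \<in> y <# D" using lcos_self[OF x D] by simp
  then show "inv y \<otimes> x \<in> D" using subgroup.lcos_module_imp[OF D is_group y] by simp
next
  assume "inv y \<otimes> x \<in> D"
  then have "x \<in> y <# D" by (rule subgroup.lcos_module_rev[OF D is_group y x])
  then show "x <# D = y <# D" using l_repr_independence[OF _ y D] by simp
qed

text \<open>For a twisted subgroup \<open>D\<close> of \<open>W = A \<times> G \<times> H\<close> this is the transitive fibered biset. Working with
  \<open>D\<close>, the stabilizer of the base point, replaces computations with \<open>U\<close> and \<open>\<phi>\<close> by general facts on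
  cosets.\<close>

definition coset_fbiset :: "('a \<times> 'g \<times> 'h) monoid \<Rightarrow> ('a \<times> 'g \<times> 'h) set
    \<Rightarrow> ('a, 'g, 'h, ('a \<times> 'g \<times> 'h) set) fbiset" where
  "coset_fbiset W D = (lcosets\<^bsub>W\<^esub> D, \<lambda>w. restrict (\<lambda>c. w <#\<^bsub>W\<^esub> c) (lcosets\<^bsub>W\<^esub> D))"

lemma transitive_fbiset_eq_coset_fbiset:
  "transitive_fbiset A G H U \<phi> = coset_fbiset (A \<times>\<times> G \<times>\<times> H) (twisted_subgroup A U \<phi>)"
  by (simp add: transitive_fbiset_def coset_fbiset_def Let_def)

context three_groups
begin

abbreviation W :: "('a \<times> 'g \<times> 'h) monoid" where "W \<equiv> A \<times>\<times> G \<times>\<times> H"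

sublocale W: group W by (rule group_W)

lemma W_simps [simp]:
  "(a, g, h) \<in> carrier W \<longleftrightarrow> a \<in> carrier A \<and> g \<in> carrier G \<and> h \<in> carrier H"
  "(a, g, h) \<otimes>\<^bsub>W\<^esub> (a', g', h') = (a \<otimes>\<^bsub>A\<^esub> a', g \<otimes>\<^bsub>G\<^esub> g', h \<otimes>\<^bsub>H\<^esub> h')"
  "\<one>\<^bsub>W\<^esub> = (\<one>\<^bsub>A\<^esub>, \<one>\<^bsub>G\<^esub>, \<one>\<^bsub>H\<^esub>)"
  by (auto simp: DirProd_def)

lemma inv_W [simp]:
  assumes "a \<in> carrier A" "g \<in> carrier G" "h \<in> carrier H"
  shows "inv\<^bsub>W\<^esub> (a, g, h) = (inv\<^bsub>A\<^esub> a, inv\<^bsub>G\<^esub> g, inv\<^bsub>H\<^esub> h)"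
  using assms by (intro W.inv_equality) auto

lemma coset_fbiset_act:
  assumes "subgroup D W" "v \<in> carrier W" "w \<in> carrier W"
  shows "snd (coset_fbiset W D) v (w <#\<^bsub>W\<^esub> D) = (v \<otimes>\<^bsub>W\<^esub> w) <#\<^bsub>W\<^esub> D"
proof -
  have "w <#\<^bsub>W\<^esub> D \<in> lcosets\<^bsub>W\<^esub> D" using assms(3) by (auto simp: LCOSETS_def)
  then show ?thesis using W.lcos_m_assoc[OF subgroup.subset[OF assms(1)] assms(2,3)]
    by (simp add: coset_fbiset_def)
qed

lemma coset_fbiset_cases:
  assumes "c \<in> fst (coset_fbiset W D)"
  obtains w where "w \<in> carrier W" "c = w <#\<^bsub>W\<^esub> D"
  using assms by (auto simp: coset_fbiset_def LCOSETS_def)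

lemma coset_in_coset_fbiset: "w \<in> carrier W \<Longrightarrow> w <#\<^bsub>W\<^esub> D \<in> fst (coset_fbiset W D)"
  by (auto simp: coset_fbiset_def LCOSETS_def)

text \<open>The image of \<open>A\<close> is central in \<open>W\<close>, so all points have the same stabilizer in \<open>A\<close> as the base point.
  Every coset is an \<open>A\<close>-translate of one of the finitely many cosets of elements \<open>(1, g, h)\<close>.\<close>

lemma fibered_coset_fbiset:
  assumes D: "subgroup D W" and fin: "finite (carrier G)" "finite (carrier H)"
    and free: "\<And>a. (a, \<one>\<^bsub>G\<^esub>, \<one>\<^bsub>H\<^esub>) \<in> D \<Longrightarrow> a = \<one>\<^bsub>A\<^esub>"
  shows "fibered_biset A G H (coset_fbiset W D)"
proof (rule fibered_bisetI)
  show "snd (coset_fbiset W D) (a, g, h) \<in> extensional (fst (coset_fbiset W D))" for a g h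
    by (simp add: coset_fbiset_def)
next
  fix a g h c assume "a \<in> carrier A" "g \<in> carrier G" "h \<in> carrier H" "c \<in> fst (coset_fbiset W D)"
  then show "snd (coset_fbiset W D) (a, g, h) c \<in> fst (coset_fbiset W D)"
    using coset_fbiset_act[OF D, of "(a, g, h)"] by (elim coset_fbiset_cases) (auto intro!: coset_in_coset_fbiset)
next
  fix c assume "c \<in> fst (coset_fbiset W D)"
  then show "snd (coset_fbiset W D) (\<one>\<^bsub>A\<^esub>, \<one>\<^bsub>G\<^esub>, \<one>\<^bsub>H\<^esub>) c = c"
    using coset_fbiset_act[OF D, of "\<one>\<^bsub>W\<^esub>"] by (elim coset_fbiset_cases) auto
next
  fix a g h a' g' h' c
  assume v: "a \<in> carrier A" "g \<in> carrier G" "h \<in> carrier H" "a' \<in> carrier A" "g' \<in> carrier G" "h' \<in> carrier H"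
    and c: "c \<in> fst (coset_fbiset W D)"
  obtain w where w: "w \<in> carrier W" "c = w <#\<^bsub>W\<^esub> D" using c by (rule coset_fbiset_cases)
  have "(a, g, h) \<in> carrier W" "(a', g', h') \<in> carrier W" using v by simp_all
  then have "snd (coset_fbiset W D) ((a, g, h) \<otimes>\<^bsub>W\<^esub> (a', g', h')) c =
      snd (coset_fbiset W D) (a, g, h) (snd (coset_fbiset W D) (a', g', h') c)"
    using w(1) unfolding w(2) by (simp only: coset_fbiset_act[OF D] W.m_closed W.m_assoc)
  then show "snd (coset_fbiset W D) (a \<otimes>\<^bsub>A\<^esub> a', g \<otimes>\<^bsub>G\<^esub> g', h \<otimes>\<^bsub>H\<^esub> h') c =
      snd (coset_fbiset W D) (a, g, h) (snd (coset_fbiset W D) (a', g', h') c)"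
    by simp
next
  fix a c assume a: "a \<in> carrier A" and c: "c \<in> fst (coset_fbiset W D)"
    and fixed: "snd (coset_fbiset W D) (a, \<one>\<^bsub>G\<^esub>, \<one>\<^bsub>H\<^esub>) c = c"
  obtain b g h where w: "(b, g, h) \<in> carrier W" "c = (b, g, h) <#\<^bsub>W\<^esub> D"
    using c by (auto elim!: coset_fbiset_cases)
  have "inv\<^bsub>W\<^esub> (b, g, h) \<otimes>\<^bsub>W\<^esub> ((a, \<one>\<^bsub>G\<^esub>, \<one>\<^bsub>H\<^esub>) \<otimes>\<^bsub>W\<^esub> (b, g, h)) \<in> D"
    using fixed coset_fbiset_act[OF D, of "(a, \<one>\<^bsub>G\<^esub>, \<one>\<^bsub>H\<^esub>)" "(b, g, h)"] w a
      W.l_coset_eq_iff[OF D, of "(a, \<one>\<^bsub>G\<^esub>, \<one>\<^bsub>H\<^esub>) \<otimes>\<^bsub>W\<^esub> (b, g, h)" "(b, g, h)"] by simp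
  then show "a = \<one>\<^bsub>A\<^esub>"
    using free w(1) a A.m_comm[of a b] by (simp flip: A.m_assoc)
next
  show "finite ((\<lambda>(g, h). (\<one>\<^bsub>A\<^esub>, g, h) <#\<^bsub>W\<^esub> D) ` (carrier G \<times> carrier H))"
    using fin by simp
  fix c assume "c \<in> fst (coset_fbiset W D)"
  then obtain b g h where w: "(b, g, h) \<in> carrier W" "c = (b, g, h) <#\<^bsub>W\<^esub> D"
    by (auto elim!: coset_fbiset_cases)
  then have "c = snd (coset_fbiset W D) (b, \<one>\<^bsub>G\<^esub>, \<one>\<^bsub>H\<^esub>) ((\<one>\<^bsub>A\<^esub>, g, h) <#\<^bsub>W\<^esub> D)"
    using coset_fbiset_act[OF D, of "(b, \<one>\<^bsub>G\<^esub>, \<one>\<^bsub>H\<^esub>)" "(\<one>\<^bsub>A\<^esub>, g, h)"] by simp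
  then show "\<exists>y\<in>(\<lambda>(g, h). (\<one>\<^bsub>A\<^esub>, g, h) <#\<^bsub>W\<^esub> D) ` (carrier G \<times> carrier H) \<inter> fst (coset_fbiset W D).
      \<exists>a\<in>carrier A. c = snd (coset_fbiset W D) (a, \<one>\<^bsub>G\<^esub>, \<one>\<^bsub>H\<^esub>) y"
    using w coset_in_coset_fbiset[of "(\<one>\<^bsub>A\<^esub>, g, h)" D]
    by (intro bexI[of _ "(\<one>\<^bsub>A\<^esub>, g, h) <#\<^bsub>W\<^esub> D"] bexI[of _ b]) auto
qed

end

lemma kburnside_class_cong:
  assumes "fibered A G H X" "fbiset_iso A G H X Y"
  shows "kburnside_class k A G H X = kburnside_class k A G H Y"
  unfolding kburnside_class_def burnside_class_def fibered.iso_class_eqI[OF assms] ..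

section \<open>Factoring through a quotient\<close>

text \<open>Since \<open>L\<close> acts trivially from the right, \<open>E\<close> is a \<open>(G, G/L)\<close>-biset \<open>X\<close>. Its tensor product with
  the \<open>(G/L, G)\<close>-biset \<open>Y = A \<times> G/L\<close> gives back \<open>E\<close>: in \<open>x \<otimes> (b, y)\<close> both \<open>b\<close> and \<open>y\<close> can be moved to
  the left, so each point is \<open>x \<otimes> (1, 1)\<close> for exactly one \<open>x\<close>.\<close>

lemma inflation_in_I_ideal:
  fixes A :: "('a, 'm) monoid_scheme" and G :: "('g, 'p) monoid_scheme"
  assumes k: "cring k" and fin: "finite (carrier G)" and E: "fibered A G G E"
    and L: "L \<lhd> G" and L1: "L \<noteq> {\<one>\<^bsub>G\<^esub>}"
    and triv: "\<And>l x. \<lbrakk>l \<in> L; x \<in> fst E\<rbrakk> \<Longrightarrow> snd E (\<one>\<^bsub>A\<^esub>, \<one>\<^bsub>G\<^esub>, l) x = x"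
  shows "kburnside_class k A G G E \<in> I_ideal k A G"
proof -
  interpret E: fibered A G G E by fact
  interpret L: normal L G by fact
  obtain num :: "'g set \<Rightarrow> nat" where num: "inj_on num (carrier (G Mod L))"
    using finite_imp_inj_to_nat_seg[of "carrier (G Mod L)"] fin
    by (auto simp: FactGroup_def RCOSETS_def)
  \<comment> \<open>the quotient map onto \<open>G/L\<close>, whose elements are replaced by natural numbers\<close>
  define \<pi> where "\<pi> g = num (L #>\<^bsub>G\<^esub> g)" for g
  have \<pi>_eq: "\<pi> g = \<pi> g' \<longleftrightarrow> g \<otimes>\<^bsub>G\<^esub> inv\<^bsub>G\<^esub> g' \<in> L" if "g \<in> carrier G" "g' \<in> carrier G" for g g'
  proof -
    have "\<pi> g = \<pi> g' \<longleftrightarrow> L #>\<^bsub>G\<^esub> g = L #>\<^bsub>G\<^esub> g'"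
      unfolding \<pi>_def using that by (intro inj_on_eq_iff[OF num]) (auto simp: FactGroup_def RCOSETS_def)
    also have "\<dots> \<longleftrightarrow> g \<otimes>\<^bsub>G\<^esub> inv\<^bsub>G\<^esub> g' \<in> L"
      using that L.rcos_module E.G.repr_independence E.G.rcos_self L.subgroup_axioms
      by (metis E.G.is_group)
    finally show ?thesis .
  qed
  have wm: "weak_group_morphism \<pi> L G"
    using L \<pi>_eq by (rule weak_group_morphismsI)
  define H where "H = image_group \<pi> G"
  interpret H: group H unfolding H_def by (rule E.G.image_group_is_group[OF wm])
  have carrier_H: "carrier H = \<pi> ` carrier G" by (simp add: H_def image_group_carrier)
  have \<pi>: "\<pi> \<in> hom G H" unfolding H_def by (rule E.G.weak_group_morphism_is_hom[OF wm])
  interpret \<pi>: group_hom G H \<pi>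
    using \<pi> by (simp add: group_hom_def group_hom_axioms_def E.G.is_group H.is_group)
  \<comment> \<open>a section of \<open>\<pi>\<close>; by \<open>E_cong\<close> below, the action of \<open>\<sigma> h\<close> from the right depends on \<open>h\<close> alone\<close>
  define \<sigma> where "\<sigma> = inv_into (carrier G) \<pi>"
  have \<sigma> [simp]: "\<sigma> h \<in> carrier G" "\<pi> (\<sigma> h) = h" if "h \<in> carrier H" for h
    using that unfolding carrier_H \<sigma>_def by (auto intro: inv_into_into f_inv_into_f)
  have E_cong: "snd E (a, g, u) x = snd E (a, g, v) x"
    if w: "a \<in> carrier A" "g \<in> carrier G" "u \<in> carrier G" "v \<in> carrier G" "x \<in> fst E" "\<pi> u = \<pi> v" for a g u v x
  proof -
    have "inv\<^bsub>G\<^esub> v \<otimes>\<^bsub>G\<^esub> u \<in> L"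
      using L.inv_op_closed1[of v "u \<otimes>\<^bsub>G\<^esub> inv\<^bsub>G\<^esub> v"] \<pi>_eq[of u v] w by (simp add: E.G.m_assoc)
    from triv[OF this w(5)] have "snd E (a, g, v) x = snd E (a, g, v) (snd E (\<one>\<^bsub>A\<^esub>, \<one>\<^bsub>G\<^esub>, inv\<^bsub>G\<^esub> v \<otimes>\<^bsub>G\<^esub> u) x)"
      by simp
    also have "\<dots> = snd E (a, g, u) x" using w by (simp add: E.act_act flip: E.G.m_assoc)
    finally show ?thesis by simp
  qed
  define X where "X = (fst E, \<lambda>(a, g, h). snd E (a, g, \<sigma> h))"
  define Y where "Y = (carrier A \<times> carrier H,
    \<lambda>(a, h, g). restrict (\<lambda>(b, y). (a \<otimes>\<^bsub>A\<^esub> b, h \<otimes>\<^bsub>H\<^esub> y \<otimes>\<^bsub>H\<^esub> inv\<^bsub>H\<^esub> \<pi> g)) (carrier A \<times> carrier H))"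
  interpret GH: three_groups A G H ..
  interpret HG: three_groups A H G ..
  have X: "fibered_biset A G H X"
  proof (rule GH.fibered_bisetI)
    show "finite (E.A_rep ` fst E)" by (rule E.finite_A_reps)
    fix x assume x: "x \<in> fst X"
    have "\<sigma> \<one>\<^bsub>H\<^esub> \<in> carrier G" "\<pi> (\<sigma> \<one>\<^bsub>H\<^esub>) = \<pi> \<one>\<^bsub>G\<^esub>" by simp_all
    note one = E_cong[OF _ _ this(1) E.G.one_closed _ this(2)]
    show "snd X (\<one>\<^bsub>A\<^esub>, \<one>\<^bsub>G\<^esub>, \<one>\<^bsub>H\<^esub>) x = x" using x one by (simp add: X_def)
    show "a = \<one>\<^bsub>A\<^esub>" if "a \<in> carrier A" "snd X (a, \<one>\<^bsub>G\<^esub>, \<one>\<^bsub>H\<^esub>) x = x" for a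
      using that x one E.free by (simp add: X_def)
    obtain a where "a \<in> carrier A" "x = snd E (a, \<one>\<^bsub>G\<^esub>, \<one>\<^bsub>G\<^esub>) (E.A_rep x)"
      using E.A_rep(2)[of x] x by (auto simp: X_def)
    then show "\<exists>y\<in>E.A_rep ` fst E \<inter> fst X. \<exists>a\<in>carrier A. x = snd X (a, \<one>\<^bsub>G\<^esub>, \<one>\<^bsub>H\<^esub>) y"
      using x one E.A_rep(1)[of x]
      by (intro bexI[of _ "E.A_rep x"] bexI[of _ a]) (simp_all add: X_def)
    fix a g h a' g' h'
    assume w: "a \<in> carrier A" "g \<in> carrier G" "h \<in> carrier H" "a' \<in> carrier A" "g' \<in> carrier G" "h' \<in> carrier H"
    show "snd X (a \<otimes>\<^bsub>A\<^esub> a', g \<otimes>\<^bsub>G\<^esub> g', h \<otimes>\<^bsub>H\<^esub> h') x = snd X (a, g, h) (snd X (a', g', h') x)"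
      using w x E_cong[of "a \<otimes>\<^bsub>A\<^esub> a'" "g \<otimes>\<^bsub>G\<^esub> g'" "\<sigma> (h \<otimes>\<^bsub>H\<^esub> h')" "\<sigma> h \<otimes>\<^bsub>G\<^esub> \<sigma> h'" x]
      by (simp add: X_def E.act_act)
  qed (simp_all add: X_def E.act_extensional)
  have Y: "fibered_biset A H G Y"
  proof (rule HG.fibered_bisetI)
    show "finite ((\<lambda>h. (\<one>\<^bsub>A\<^esub>, h)) ` carrier H)" using fin by (simp add: carrier_H)
    fix y assume "y \<in> fst Y"
    then obtain b h where y: "y = (b, h)" "b \<in> carrier A" "h \<in> carrier H" by (auto simp: Y_def)
    show "\<exists>z\<in>(\<lambda>h. (\<one>\<^bsub>A\<^esub>, h)) ` carrier H \<inter> fst Y. \<exists>a\<in>carrier A. y = snd Y (a, \<one>\<^bsub>H\<^esub>, \<one>\<^bsub>G\<^esub>) z"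
      using y by (intro bexI[of _ "(\<one>\<^bsub>A\<^esub>, h)"] bexI[of _ b]) (auto simp: Y_def)
    show "snd Y (\<one>\<^bsub>A\<^esub>, \<one>\<^bsub>H\<^esub>, \<one>\<^bsub>G\<^esub>) y = y" using y by (simp add: Y_def)
    show "a = \<one>\<^bsub>A\<^esub>" if "a \<in> carrier A" "snd Y (a, \<one>\<^bsub>H\<^esub>, \<one>\<^bsub>G\<^esub>) y = y" for a
      using that y by (simp add: Y_def)
    fix a h' g a' h'' g'
    assume w: "a \<in> carrier A" "h' \<in> carrier H" "g \<in> carrier G" "a' \<in> carrier A" "h'' \<in> carrier H" "g' \<in> carrier G"
    show "snd Y (a \<otimes>\<^bsub>A\<^esub> a', h' \<otimes>\<^bsub>H\<^esub> h'', g \<otimes>\<^bsub>G\<^esub> g') y = snd Y (a, h', g) (snd Y (a', h'', g') y)"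
      using w y by (simp add: Y_def E.A.m_assoc H.m_assoc H.inv_mult_group)
  qed (auto simp: Y_def)
  interpret P: fibered_pair A G H G X Y
    using X Y by unfold_locales
  interpret four_groups A G H G ..
  have Y1: "(\<one>\<^bsub>A\<^esub>, \<one>\<^bsub>H\<^esub>) \<in> fst Y" by (simp add: Y_def)
  have pt_eq: "x' = x"
    if xx': "x \<in> fst X" "x' \<in> fst X" "P.pt x' (\<one>\<^bsub>A\<^esub>, \<one>\<^bsub>H\<^esub>) = P.pt x (\<one>\<^bsub>A\<^esub>, \<one>\<^bsub>H\<^esub>)" for x x'
  proof -
    obtain a h where a: "a \<in> carrier A" "h \<in> carrier H"
      and x': "x' = snd X (inv\<^bsub>A\<^esub> a, \<one>\<^bsub>G\<^esub>, h) x"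
      and 1: "(\<one>\<^bsub>A\<^esub>, \<one>\<^bsub>H\<^esub>) = snd Y (a, h, \<one>\<^bsub>G\<^esub>) (\<one>\<^bsub>A\<^esub>, \<one>\<^bsub>H\<^esub>)"
      using P.pt_eq_iff[OF xx'(1) Y1 xx'(2) Y1] xx'(3) by blast
    have "a = \<one>\<^bsub>A\<^esub>" "h = \<one>\<^bsub>H\<^esub>" using 1 a by (simp_all add: Y_def)
    then show ?thesis using x' xx'(1) by simp
  qed
  have in_T: "P.pt x (\<one>\<^bsub>A\<^esub>, \<one>\<^bsub>H\<^esub>) \<in> fst P.T" if x: "x \<in> fst X" for x
    unfolding P.pt_in_tensor[OF x Y1]
  proof (intro ballI impI)
    fix a assume a: "a \<in> carrier A" and eq: "P.pt (snd X (a, \<one>\<^bsub>G\<^esub>, \<one>\<^bsub>H\<^esub>) x) (\<one>\<^bsub>A\<^esub>, \<one>\<^bsub>H\<^esub>) = P.pt x (\<one>\<^bsub>A\<^esub>, \<one>\<^bsub>H\<^esub>)"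
    have "snd X (a, \<one>\<^bsub>G\<^esub>, \<one>\<^bsub>H\<^esub>) x = x" by (rule pt_eq) (use a x eq in simp_all)
    then show "a = \<one>\<^bsub>A\<^esub>" by (rule P.X.free[OF a x])
  qed
  have "fbiset_emb A G G E P.T (\<lambda>x. P.pt x (\<one>\<^bsub>A\<^esub>, \<one>\<^bsub>H\<^esub>))"
    unfolding fbiset_emb_def
  proof (intro conjI ballI)
    show "inj_on (\<lambda>x. P.pt x (\<one>\<^bsub>A\<^esub>, \<one>\<^bsub>H\<^esub>)) (fst E)"
      by (intro inj_onI pt_eq) (simp_all add: X_def)
    show "(\<lambda>x. P.pt x (\<one>\<^bsub>A\<^esub>, \<one>\<^bsub>H\<^esub>)) ` fst E \<subseteq> fst P.T"
      using in_T by (auto simp: X_def)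
    fix a g g' x assume w: "a \<in> carrier A" "g \<in> carrier G" "g' \<in> carrier G" and "x \<in> fst E"
    then have x: "x \<in> fst X" by (simp add: X_def)
    have "snd P.T (a, g, g') (P.pt x (\<one>\<^bsub>A\<^esub>, \<one>\<^bsub>H\<^esub>))
        = P.pt (snd X (a, g, \<one>\<^bsub>H\<^esub>) x) (\<one>\<^bsub>A\<^esub>, inv\<^bsub>H\<^esub> \<pi> g')"
      using w P.snd_tensor[OF w x Y1 in_T[OF x]] by (simp add: Y_def)
    also have "\<dots> = P.pt (snd X (\<one>\<^bsub>A\<^esub>, \<one>\<^bsub>G\<^esub>, \<pi> g') (snd X (a, g, \<one>\<^bsub>H\<^esub>) x)) (\<one>\<^bsub>A\<^esub>, \<one>\<^bsub>H\<^esub>)"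
      using P.pt_move[of "\<one>\<^bsub>A\<^esub>" "\<pi> g'" "snd X (a, g, \<one>\<^bsub>H\<^esub>) x" "(\<one>\<^bsub>A\<^esub>, inv\<^bsub>H\<^esub> \<pi> g')"] w x
      by (simp add: Y_def)
    also have "snd X (\<one>\<^bsub>A\<^esub>, \<one>\<^bsub>G\<^esub>, \<pi> g') (snd X (a, g, \<one>\<^bsub>H\<^esub>) x) = snd E (a, g, g') x"
      using P.X.act_act[of "\<one>\<^bsub>A\<^esub>" "\<one>\<^bsub>G\<^esub>" "\<pi> g'" a g "\<one>\<^bsub>H\<^esub>" x] w x E_cong[of a g "\<sigma> (\<pi> g')" g' x]
      by (simp add: X_def)
    finally show "P.pt (snd E (a, g, g') x) (\<one>\<^bsub>A\<^esub>, \<one>\<^bsub>H\<^esub>) = snd P.T (a, g, g') (P.pt x (\<one>\<^bsub>A\<^esub>, \<one>\<^bsub>H\<^esub>))"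
      by simp
  qed
  moreover have "(\<lambda>x. P.pt x (\<one>\<^bsub>A\<^esub>, \<one>\<^bsub>H\<^esub>)) ` fst E = fst P.T"
  proof (intro equalityI subsetI)
    fix \<omega> assume "\<omega> \<in> fst P.T"
    then obtain x y where xy: "\<omega> = P.pt x y" "x \<in> fst X" "y \<in> fst Y" by (rule P.tensor_cases)
    then obtain b h where y: "y = (b, h)" "b \<in> carrier A" "h \<in> carrier H" by (auto simp: Y_def)
    have "\<omega> = P.pt (snd X (inv\<^bsub>A\<^esub> (inv\<^bsub>A\<^esub> b), \<one>\<^bsub>G\<^esub>, inv\<^bsub>H\<^esub> h) x) (\<one>\<^bsub>A\<^esub>, \<one>\<^bsub>H\<^esub>)"
      using P.pt_move[of "inv\<^bsub>A\<^esub> b" "inv\<^bsub>H\<^esub> h" x y] xy y by (simp add: Y_def)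
    moreover have "snd X (inv\<^bsub>A\<^esub> (inv\<^bsub>A\<^esub> b), \<one>\<^bsub>G\<^esub>, inv\<^bsub>H\<^esub> h) x \<in> fst E"
      using P.X.act_closed[of "inv\<^bsub>A\<^esub> (inv\<^bsub>A\<^esub> b)" "\<one>\<^bsub>G\<^esub>" "inv\<^bsub>H\<^esub> h" x] xy y by (simp add: X_def)
    ultimately show "\<omega> \<in> (\<lambda>x. P.pt x (\<one>\<^bsub>A\<^esub>, \<one>\<^bsub>H\<^esub>)) ` fst E" by blast
  qed (use in_T in \<open>auto simp: X_def\<close>)
  ultimately have "fbiset_iso A G G E P.T" unfolding fbiset_iso_iff_emb by blast
  then have "kburnside_class k A G G E = kburnside_comp k A G H G (kburnside_class k A G H X) (kburnside_class k A H G Y)"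
    using kburnside_class_cong[OF E] kburnside_comp_class[OF k P.X.fibered_axioms P.Y.fibered_axioms] by simp
  moreover have "order H < order G"
  proof -
    obtain l where l: "l \<in> L" "l \<noteq> \<one>\<^bsub>G\<^esub>" using L1 L.one_closed by blast
    then have lG: "l \<in> carrier G" using L.subset by blast
    then have "\<pi> l = \<pi> \<one>\<^bsub>G\<^esub>" using \<pi>_eq[OF lG E.G.one_closed] l(1) by simp
    then have "\<not> inj_on \<pi> (carrier G)" using l(2) lG inj_onD[of \<pi> "carrier G" l "\<one>\<^bsub>G\<^esub>"] by auto
    then show ?thesis unfolding order_def carrier_H
      using card_image_le[OF fin, of \<pi>] eq_card_imp_inj_on[OF fin, of \<pi>] by fastforce
  qed
  moreover have "finite (carrier H)" using fin by (simp add: carrier_H)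
  ultimately show ?thesis
    unfolding I_ideal_def
    using P.X.kburnside_class_closed[OF k] P.Y.kburnside_class_closed[OF k] H.is_group
    by (intro generate.incl) blast
qed

section \<open>Counting orbits of a given type\<close>

context three_groups
begin

text \<open>These are the orbits isomorphic to the transitive biset \<open>W / S\<close>. Their number is the coefficient of
  its class when \<open>[X]\<close> is written in the basis of transitive classes.\<close>

definition typed_orbits :: "('a \<times> 'g \<times> 'h) set \<Rightarrow> ('a, 'g, 'h, 'x) fbiset \<Rightarrow> 'x set set" where
  "typed_orbits S X = {orbit W (snd X) x | x. x \<in> fst X \<and> stabilizer W (snd X) x = S}"

lemma fbiset_emb_orbit:
  assumes f: "fbiset_emb A G H X Z f" and X: "fibered_biset A G H X" and x: "x \<in> fst X"
  shows "orbit W (snd Z) (f x) = f ` orbit W (snd X) x"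
    and "stabilizer W (snd Z) (f x) = stabilizer W (snd X) x"
proof -
  interpret X: fibered A G H X by unfold_locales fact
  have closed: "snd X w x \<in> fst X" and eq: "snd Z w (f x) = f (snd X w x)" if "w \<in> carrier W" for w
    using fbiset_embD(3)[OF f _ _ _ x] x that by (cases w; simp)+
  show "orbit W (snd Z) (f x) = f ` orbit W (snd X) x"
    unfolding orbit_def setcompr_eq_image image_image
    by (rule image_cong[OF refl]) (rule eq, simp only: mem_Collect_eq)
  show "stabilizer W (snd Z) (f x) = stabilizer W (snd X) x"
    unfolding stabilizer_def using eq closed inj_on_eq_iff[OF fbiset_embD(1)[OF f] _ x] by auto
qed

lemma typed_orbits_emb:
  assumes f: "fbiset_emb A G H X Z f" and X: "fibered_biset A G H X"
  shows "image f ` typed_orbits S X = {orbit W (snd Z) z | z. z \<in> f ` fst X \<and> stabilizer W (snd Z) z = S}"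
    (is "?l = ?r")
proof
  show "?l \<subseteq> ?r" unfolding typed_orbits_def
    using fbiset_emb_orbit[OF f X] by blast
  show "?r \<subseteq> ?l"
  proof
    fix Q assume "Q \<in> ?r"
    then obtain x where x: "x \<in> fst X" "Q = orbit W (snd Z) (f x)" "stabilizer W (snd Z) (f x) = S" by blast
    then have "Q = f ` orbit W (snd X) x" "stabilizer W (snd X) x = S"
      using fbiset_emb_orbit[OF f X x(1)] by simp_all
    then show "Q \<in> ?l" unfolding typed_orbits_def using x(1) by blast
  qed
qed

lemma typed_orbits_subset:
  assumes "fibered_biset A G H X" "Q \<in> typed_orbits S X"
  shows "Q \<subseteq> fst X" "Q \<noteq> {}"
proof -
  interpret X: fibered A G H X by unfold_locales fact
  obtain x where x: "x \<in> fst X" "Q = orbit W (snd X) x" using assms(2) unfolding typed_orbits_def by blast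
  show "Q \<subseteq> fst X" unfolding x(2) orbit_def using x(1) by auto
  show "Q \<noteq> {}" unfolding x(2) orbit_def using W.one_closed by blast
qed

lemma card_typed_orbits_emb:
  assumes f: "fbiset_emb A G H X Z f" and X: "fibered_biset A G H X"
  shows "card (image f ` typed_orbits S X) = card (typed_orbits S X)"
proof (rule card_image, rule inj_on_subset)
  show "inj_on (image f) (Pow (fst X))" using fbiset_embD(1)[OF f] by (rule inj_on_image_Pow)
  show "typed_orbits S X \<subseteq> Pow (fst X)" using typed_orbits_subset[OF X] by blast
qed

lemma card_typed_orbits_iso:
  assumes X: "fibered_biset A G H X" and "fbiset_iso A G H X Y"
  shows "card (typed_orbits S Y) = card (typed_orbits S X)"
proof -
  obtain f where f: "fbiset_emb A G H X Y f" "f ` fst X = fst Y"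
    using assms(2) unfolding fbiset_iso_iff_emb by blast
  have "typed_orbits S Y = image f ` typed_orbits S X"
    using typed_orbits_emb[OF f(1) X] unfolding f(2) by (simp add: typed_orbits_def)
  then show ?thesis using card_typed_orbits_emb[OF f(1) X] by simp
qed

text \<open>Each \<open>W\<close>-orbit is a union of \<open>A\<close>-orbits, of which there are finitely many. Without finiteness,
  counting would not be additive.\<close>

lemma finite_typed_orbits:
  assumes X: "fibered_biset A G H X"
  shows "finite (typed_orbits S X)"
proof -
  interpret X: fibered A G H X by unfold_locales fact
  interpret act: group_action W "fst X" "snd X" by (rule X.group_action)
  have orb: "orbit W (snd X) (snd X w x) = orbit W (snd X) x" if w: "w \<in> carrier W" and x: "x \<in> fst X" for w x
  proof (intro equalityI subsetI)
    fix y assume "y \<in> orbit W (snd X) (snd X w x)"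
    then obtain v where v: "v \<in> carrier W" "y = snd X v (snd X w x)" unfolding orbit_def by blast
    then have "y = snd X (v \<otimes>\<^bsub>W\<^esub> w) x" using act.composition_rule[OF x v(1) w] by simp
    then show "y \<in> orbit W (snd X) x" unfolding orbit_def using W.m_closed[OF v(1) w] by blast
  next
    fix y assume "y \<in> orbit W (snd X) x"
    then obtain v where v: "v \<in> carrier W" "y = snd X v x" unfolding orbit_def by blast
    have c: "v \<otimes>\<^bsub>W\<^esub> inv\<^bsub>W\<^esub> w \<in> carrier W" using v(1) w by (intro W.m_closed W.inv_closed)
    have "(v \<otimes>\<^bsub>W\<^esub> inv\<^bsub>W\<^esub> w) \<otimes>\<^bsub>W\<^esub> w = v" using v(1) w by (simp only: W.m_assoc W.inv_closed W.l_inv W.r_one)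
    then have "y = snd X (v \<otimes>\<^bsub>W\<^esub> inv\<^bsub>W\<^esub> w) (snd X w x)"
      using act.composition_rule[OF x c w] v(2) by simp
    then show "y \<in> orbit W (snd X) (snd X w x)" unfolding orbit_def using c by blast
  qed
  have "typed_orbits S X \<subseteq> orbit W (snd X) ` (X.A_rep ` fst X)"
  proof
    fix Q assume "Q \<in> typed_orbits S X"
    then obtain x where x: "x \<in> fst X" "Q = orbit W (snd X) x" unfolding typed_orbits_def by blast
    obtain a where a: "a \<in> carrier A" "x = snd X (a, \<one>\<^bsub>G\<^esub>, \<one>\<^bsub>H\<^esub>) (X.A_rep x)"
      using X.A_rep(2)[OF x(1)] by blast
    have "orbit W (snd X) (snd X (a, \<one>\<^bsub>G\<^esub>, \<one>\<^bsub>H\<^esub>) (X.A_rep x)) = orbit W (snd X) (X.A_rep x)"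
      using X.A_rep(1)[OF x(1)] a(1) by (intro orb) simp_all
    then have "Q = orbit W (snd X) (X.A_rep x)" using x(2) a(2) by simp
    then show "Q \<in> orbit W (snd X) ` (X.A_rep ` fst X)" using x(1) by blast
  qed
  then show ?thesis using X.finite_A_reps finite_surj by blast
qed

lemma card_typed_orbits_union:
  assumes X: "fibered_biset A G H X" and Y: "fibered_biset A G H Y"
  shows "card (typed_orbits S (fbiset_union X Y)) = card (typed_orbits S X) + card (typed_orbits S Y)"
proof -
  let ?U = "fbiset_union X Y"
  note i = fbiset_union_emb(1)[of A G H X Y] and j = fbiset_union_emb(2)[of A G H Y X]
  have "typed_orbits S ?U = image Inl ` typed_orbits S X \<union> image Inr ` typed_orbits S Y"
    unfolding typed_orbits_emb[OF i X] typed_orbits_emb[OF j Y]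
    unfolding typed_orbits_def fbiset_union_def by (auto simp: Plus_def)
  moreover have "image Inl ` typed_orbits S X \<inter> image Inr ` typed_orbits S Y = {}"
  proof -
    have "Q = {}" if "Q = Inl ` R" "Q = Inr ` R'" for Q :: "('b + 'c) set" and R R' using that by blast
    then show ?thesis using typed_orbits_subset(2)[OF X] by fastforce
  qed
  ultimately show ?thesis
    using finite_typed_orbits[OF X] finite_typed_orbits[OF Y]
    by (simp add: card_Un_disjoint card_typed_orbits_emb[OF i X] card_typed_orbits_emb[OF j Y])
qed

text \<open>An isomorphism class is a set of copies with points in \<open>'a \<times> nat\<close>, all of which have the same number
  of orbits of type \<open>S\<close>.\<close>

definition class_count :: "('a \<times> 'g \<times> 'h) set \<Rightarrow> ('a, 'g, 'h) fbiset_class \<Rightarrow> int" where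
  "class_count S c = int (card (typed_orbits S (SOME X. X \<in> c)))"

lemma class_count_iso_class:
  assumes "fibered A G H X"
  shows "class_count S (iso_class A G H X) = int (card (typed_orbits S X))"
proof -
  interpret X: fibered A G H X by fact
  define Y where "Y = (SOME Y. Y \<in> iso_class A G H X)"
  obtain Y' where "Y' \<in> iso_class A G H X" using X.fibered_biset_copy unfolding iso_class_def by blast
  then have "Y \<in> iso_class A G H X" unfolding Y_def by (rule someI)
  then have "fbiset_iso A G H X Y" unfolding iso_class_def by blast
  then show ?thesis
    unfolding class_count_def Y_def[symmetric] using card_typed_orbits_iso[OF X.fibered] by simp
qed

end

lemma hom_free_Abelian_group_diff:
  assumes h: "h \<in> hom (free_Abelian_group S) M" and M: "group M"
    and "x \<in> S" "y \<in> S" "z \<in> S"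
  shows "h (frag_of x - frag_of y - frag_of z)
    = h (frag_of x) \<otimes>\<^bsub>M\<^esub> inv\<^bsub>M\<^esub> h (frag_of y) \<otimes>\<^bsub>M\<^esub> inv\<^bsub>M\<^esub> h (frag_of z)"
proof -
  interpret h: group_hom "free_Abelian_group S" M h
    using h M by (simp add: group_hom_def group_hom_axioms_def)
  have "h (u - frag_of v) = h u \<otimes>\<^bsub>M\<^esub> inv\<^bsub>M\<^esub> h (frag_of v)" if "Poly_Mapping.keys u \<subseteq> S" "v \<in> S" for u v
    using h.hom_mult[of u "- frag_of v"] h.hom_inv[of "frag_of v"] that by simp
  moreover have "Poly_Mapping.keys (frag_of x - frag_of y) \<subseteq> S"
    using assms by (intro order.trans[OF keys_diff]) auto
  ultimately show ?thesis using assms by simp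
qed

text \<open>Counting orbits of type \<open>S\<close> is additive on disjoint unions.\<close>

lemma (in three_groups) burnside_count:
  obtains N where "N \<in> hom (burnside_group A G H) integer_group"
    "\<And>c. c \<in> iso_classes A G H \<Longrightarrow>
      N (presented_class (iso_classes A G H) (union_relations A G H) (frag_of c)) = class_count S c"
proof -
  have rel: "h r = \<one>\<^bsub>integer_group\<^esub>"
    if h: "h \<in> hom (free_Abelian_group (iso_classes A G H)) integer_group"
      "\<forall>c\<in>iso_classes A G H. h (frag_of c) = class_count S c"
      and r: "r \<in> union_relations A G H" for h r
  proof -
    obtain X Y :: "('a, 'g, 'h, 'a \<times> nat) fbiset" where XY: "fibered A G H X" "fibered A G H Y"
      "fibered A G H (fbiset_union X Y)"
      and r: "r = frag_of (iso_class A G H (fbiset_union X Y)) - frag_of (iso_class A G H X) - frag_of (iso_class A G H Y)"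
      using r by (rule union_relations_cases)
    note cl = XY[THEN fibered.iso_class_in_iso_classes]
    show ?thesis
      unfolding r hom_free_Abelian_group_diff[OF h(1) group_integer_group cl(3,1,2)]
      using XY[THEN class_count_iso_class] card_typed_orbits_union[OF XY(1,2)[THEN fibered.fibered]]
      by (simp add: h(2) cl)
  qed
  have closed: "class_count S ` iso_classes A G H \<subseteq> carrier integer_group" by simp
  obtain N where "N \<in> hom (presented_group (iso_classes A G H) (union_relations A G H)) integer_group"
    "\<And>c. c \<in> iso_classes A G H \<Longrightarrow>
      N (presented_class (iso_classes A G H) (union_relations A G H) (frag_of c)) = class_count S c"
    by (rule presented_group_universal[OF union_relations_subset abelian_integer_group closed],
      rule rel, assumption+) blast
  then show thesis using that unfolding burnside_group_def by blast
qed

text \<open>The linear extension of \<open>N\<close> is \<open>r \<otimes> b \<mapsto> N(b) r\<close>. The multiple \<open>N(b) r\<close> appears as an integer power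
  in the additive group of \<open>k\<close>, where the laws of powers are its additivity in \<open>r\<close> and in \<open>b\<close>.\<close>

lemma (in three_groups) kburnside_functional:
  assumes k: "cring k" and N: "N \<in> hom (burnside_group A G H) integer_group"
  obtains F where "F \<in> hom (kburnside_group k A G H) (add_monoid k)"
    "\<And>r b. \<lbrakk>r \<in> carrier k; b \<in> carrier (burnside_group A G H)\<rbrakk> \<Longrightarrow>
      F (presented_class (tensor_generators k (burnside_group A G H)) (tensor_relations k (burnside_group A G H))
        (frag_of (r, b))) = r [^]\<^bsub>add_monoid k\<^esub> N b"
proof -
  \<comment> \<open>before the ring, whose interpretation would restate the laws of powers in terms of multiples\<close>
  interpret M: comm_group "add_monoid k"
    using abelian_group.a_comm_group[OF ring.is_abelian_group[OF cring.axioms(1)[OF k]]] .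
  interpret k: cring k by fact
  interpret B: comm_group "burnside_group A G H" by (rule comm_group_burnside)
  interpret N: group_hom "burnside_group A G H" integer_group N
    using N by (simp add: group_hom_def group_hom_axioms_def B.is_group)
  define f where "f = (\<lambda>(r, b). r [^]\<^bsub>add_monoid k\<^esub> N b)"
  let ?S = "tensor_generators k (burnside_group A G H)" and ?R = "tensor_relations k (burnside_group A G H)"
  have closed: "f ` ?S \<subseteq> carrier (add_monoid k)"
    using M.int_pow_closed by (auto simp: f_def tensor_generators_def)
  have inv2: "(x \<otimes>\<^bsub>add_monoid k\<^esub> y) \<otimes>\<^bsub>add_monoid k\<^esub> inv\<^bsub>add_monoid k\<^esub> x \<otimes>\<^bsub>add_monoid k\<^esub> inv\<^bsub>add_monoid k\<^esub> y = \<one>\<^bsub>add_monoid k\<^esub>"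
    if "x \<in> carrier (add_monoid k)" "y \<in> carrier (add_monoid k)" for x y
    using that M.m_comm[of x y] M.m_closed M.inv_closed M.r_inv by (metis M.inv_solve_right M.l_one)
  have rel: "h \<rho> = \<one>\<^bsub>add_monoid k\<^esub>"
    if h: "h \<in> hom (free_Abelian_group ?S) (add_monoid k)" "\<forall>x\<in>?S. h (frag_of x) = f x"
      and \<rho>: "\<rho> \<in> ?R" for h \<rho>
    using \<rho> unfolding tensor_relations_def
  proof (elim UnE CollectE exE conjE)
    fix r s b assume \<rho>: "\<rho> = frag_of (r \<oplus>\<^bsub>k\<^esub> s, b) - frag_of (r, b) - frag_of (s, b)"
      and rs: "r \<in> carrier k" "s \<in> carrier k" "b \<in> carrier (burnside_group A G H)"
    then have S: "(r \<oplus>\<^bsub>k\<^esub> s, b) \<in> ?S" "(r, b) \<in> ?S" "(s, b) \<in> ?S"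
      using M.m_closed[of r s] by (auto simp: tensor_generators_def)
    have "f (r \<oplus>\<^bsub>k\<^esub> s, b) = f (r, b) \<otimes>\<^bsub>add_monoid k\<^esub> f (s, b)"
      using M.int_pow_distrib[of r s "N b"] rs by (simp add: f_def)
    then show ?thesis
      unfolding \<rho> hom_free_Abelian_group_diff[OF h(1) M.is_group S] S[THEN h(2)[THEN bspec]]
      using inv2[of "f (r, b)" "f (s, b)"] closed S by auto
  next
    fix r b c assume \<rho>: "\<rho> = frag_of (r, b \<otimes>\<^bsub>burnside_group A G H\<^esub> c) - frag_of (r, b) - frag_of (r, c)"
      and rs: "r \<in> carrier k" "b \<in> carrier (burnside_group A G H)" "c \<in> carrier (burnside_group A G H)"
    then have S: "(r, b \<otimes>\<^bsub>burnside_group A G H\<^esub> c) \<in> ?S" "(r, b) \<in> ?S" "(r, c) \<in> ?S"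
      by (auto simp: tensor_generators_def)
    have "f (r, b \<otimes>\<^bsub>burnside_group A G H\<^esub> c) = f (r, b) \<otimes>\<^bsub>add_monoid k\<^esub> f (r, c)"
      using M.int_pow_mult[of r "N b" "N c"] rs by (simp add: f_def N.hom_mult)
    then show ?thesis
      unfolding \<rho> hom_free_Abelian_group_diff[OF h(1) M.is_group S] S[THEN h(2)[THEN bspec]]
      using inv2[of "f (r, b)" "f (r, c)"] closed S by auto
  qed
  obtain F where F: "F \<in> hom (presented_group ?S ?R) (add_monoid k)"
    "\<And>x. x \<in> ?S \<Longrightarrow> F (presented_class ?S ?R (frag_of x)) = f x"
    by (rule presented_group_universal[OF tensor_relations_subset[OF k] M.comm_group_axioms closed],
      rule rel, assumption+) blast
  show thesis
  proof (rule that)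
    show "F \<in> hom (kburnside_group k A G H) (add_monoid k)"
      using F(1) by (simp add: kburnside_group_def)
  qed (use F(2) in \<open>simp add: f_def tensor_generators_def\<close>)
qed

section \<open>The biset of an invariant pair\<close>

locale invariant_pair = A: comm_group A + G: group G
  for A :: "('a, 'm) monoid_scheme" and G :: "('g, 'p) monoid_scheme" +
  fixes K :: "'g set" and \<kappa> :: "'g \<Rightarrow> 'a"
  assumes finite_G: "finite (carrier G)" and pair: "(K, \<kappa>) \<in> M_pairs_fixed A G"
begin

sublocale K: normal K G using pair by (simp add: M_pairs_fixed_def)

sublocale three_groups A G G ..

lemma hom_\<kappa>: "group_hom (G\<lparr>carrier := K\<rparr>) A \<kappa>"
  using pair G.subgroup_imp_group[OF K.subgroup_axioms]
  by (simp add: M_pairs_fixed_def M_pairs_def group_hom_def group_hom_axioms_def A.is_group)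

lemma \<kappa>_simps [simp]:
  "x \<in> K \<Longrightarrow> \<kappa> x \<in> carrier A"
  "\<lbrakk>x \<in> K; y \<in> K\<rbrakk> \<Longrightarrow> \<kappa> (x \<otimes>\<^bsub>G\<^esub> y) = \<kappa> x \<otimes>\<^bsub>A\<^esub> \<kappa> y"
  "\<kappa> \<one>\<^bsub>G\<^esub> = \<one>\<^bsub>A\<^esub>"
  "x \<in> K \<Longrightarrow> \<kappa> (inv\<^bsub>G\<^esub> x) = inv\<^bsub>A\<^esub> \<kappa> x"
  using group_hom.hom_closed[OF hom_\<kappa>, of x] group_hom.hom_mult[OF hom_\<kappa>, of x y]
    group_hom.hom_one[OF hom_\<kappa>] group_hom.hom_inv[OF hom_\<kappa>, of x]
    G.m_inv_consistent[OF K.subgroup_axioms, of x]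
  by simp_all

lemma \<kappa>_conj: "\<lbrakk>g \<in> carrier G; x \<in> K\<rbrakk> \<Longrightarrow> \<kappa> (g \<otimes>\<^bsub>G\<^esub> x \<otimes>\<^bsub>G\<^esub> inv\<^bsub>G\<^esub> g) = \<kappa> x"
  using pair by (simp add: M_pairs_fixed_def)

lemma K_carrier [simp]: "x \<in> K \<Longrightarrow> x \<in> carrier G" using K.subset by blast

text \<open>The stabilizer of the base point in the biset of \<open>e\<close>.\<close>

definition S :: "('a \<times> 'g \<times> 'g) set" where
  "S = twisted_subgroup A (Delta G K) (\<lambda>(g1, g2). \<kappa> (g1 \<otimes>\<^bsub>G\<^esub> inv\<^bsub>G\<^esub> g2))"

lemma mem_S:
  "(a, g, h) \<in> S \<longleftrightarrow> g \<in> carrier G \<and> h \<in> carrier G \<and> g \<otimes>\<^bsub>G\<^esub> inv\<^bsub>G\<^esub> h \<in> K \<and> a = inv\<^bsub>A\<^esub> \<kappa> (g \<otimes>\<^bsub>G\<^esub> inv\<^bsub>G\<^esub> h)"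
proof -
  have "g <#\<^bsub>G\<^esub> K = h <#\<^bsub>G\<^esub> K \<longleftrightarrow> g \<otimes>\<^bsub>G\<^esub> inv\<^bsub>G\<^esub> h \<in> K" if "g \<in> carrier G" "h \<in> carrier G"
  proof -
    have "inv\<^bsub>G\<^esub> h \<otimes>\<^bsub>G\<^esub> g \<in> K" if "g \<otimes>\<^bsub>G\<^esub> inv\<^bsub>G\<^esub> h \<in> K"
      using K.inv_op_closed1[OF \<open>h \<in> carrier G\<close> that] \<open>g \<in> carrier G\<close> \<open>h \<in> carrier G\<close> by (simp add: G.m_assoc)
    moreover have "g \<otimes>\<^bsub>G\<^esub> inv\<^bsub>G\<^esub> h \<in> K" if "inv\<^bsub>G\<^esub> h \<otimes>\<^bsub>G\<^esub> g \<in> K"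
      using K.inv_op_closed2[OF \<open>h \<in> carrier G\<close> that] \<open>g \<in> carrier G\<close> \<open>h \<in> carrier G\<close> by (simp flip: G.m_assoc)
    ultimately show ?thesis using G.l_coset_eq_iff[OF K.subgroup_axioms] that by blast
  qed
  then show ?thesis by (auto simp: S_def twisted_subgroup_def Delta_def)
qed

lemma subgroup_S: "subgroup S W"
proof (rule W.subgroupI)
  show "S \<subseteq> carrier W" by (auto simp: mem_S)
  have "(\<one>\<^bsub>A\<^esub>, \<one>\<^bsub>G\<^esub>, \<one>\<^bsub>G\<^esub>) \<in> S" using K.one_closed by (simp add: mem_S)
  then show "S \<noteq> {}" by blast
next
  fix w assume "w \<in> S"
  then obtain g h where w: "w = (inv\<^bsub>A\<^esub> \<kappa> (g \<otimes>\<^bsub>G\<^esub> inv\<^bsub>G\<^esub> h), g, h)" "g \<in> carrier G" "h \<in> carrier G"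
    and x: "g \<otimes>\<^bsub>G\<^esub> inv\<^bsub>G\<^esub> h \<in> K" by (cases w) (auto simp: mem_S)
  have x': "inv\<^bsub>G\<^esub> (g \<otimes>\<^bsub>G\<^esub> inv\<^bsub>G\<^esub> h) \<in> K" using x by simp
  have eq: "inv\<^bsub>G\<^esub> g \<otimes>\<^bsub>G\<^esub> inv\<^bsub>G\<^esub> (g \<otimes>\<^bsub>G\<^esub> inv\<^bsub>G\<^esub> h) \<otimes>\<^bsub>G\<^esub> inv\<^bsub>G\<^esub> (inv\<^bsub>G\<^esub> g) = inv\<^bsub>G\<^esub> g \<otimes>\<^bsub>G\<^esub> h"
    using w by (simp add: G.inv_mult_group G.m_assoc)
  have "inv\<^bsub>G\<^esub> g \<otimes>\<^bsub>G\<^esub> h \<in> K" using K.inv_op_closed2[OF G.inv_closed[OF w(2)] x'] unfolding eq .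
  moreover have "\<kappa> (inv\<^bsub>G\<^esub> g \<otimes>\<^bsub>G\<^esub> h) = inv\<^bsub>A\<^esub> \<kappa> (g \<otimes>\<^bsub>G\<^esub> inv\<^bsub>G\<^esub> h)"
    using \<kappa>_conj[OF G.inv_closed[OF w(2)] x'] x unfolding eq by simp
  ultimately show "inv\<^bsub>W\<^esub> w \<in> S" using w x by (simp add: mem_S)
next
  fix v w assume "v \<in> S" "w \<in> S"
  then obtain g h g' h' where v: "v = (inv\<^bsub>A\<^esub> \<kappa> (g \<otimes>\<^bsub>G\<^esub> inv\<^bsub>G\<^esub> h), g, h)" "g \<in> carrier G" "h \<in> carrier G"
    and x: "g \<otimes>\<^bsub>G\<^esub> inv\<^bsub>G\<^esub> h \<in> K"
    and w: "w = (inv\<^bsub>A\<^esub> \<kappa> (g' \<otimes>\<^bsub>G\<^esub> inv\<^bsub>G\<^esub> h'), g', h')" "g' \<in> carrier G" "h' \<in> carrier G"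
    and y: "g' \<otimes>\<^bsub>G\<^esub> inv\<^bsub>G\<^esub> h' \<in> K" by (cases v, cases w) (auto simp: mem_S)
  have y': "g \<otimes>\<^bsub>G\<^esub> (g' \<otimes>\<^bsub>G\<^esub> inv\<^bsub>G\<^esub> h') \<otimes>\<^bsub>G\<^esub> inv\<^bsub>G\<^esub> g \<in> K" by (rule K.inv_op_closed2[OF v(2) y])
  have eq: "g \<otimes>\<^bsub>G\<^esub> g' \<otimes>\<^bsub>G\<^esub> inv\<^bsub>G\<^esub> (h \<otimes>\<^bsub>G\<^esub> h')
      = (g \<otimes>\<^bsub>G\<^esub> (g' \<otimes>\<^bsub>G\<^esub> inv\<^bsub>G\<^esub> h') \<otimes>\<^bsub>G\<^esub> inv\<^bsub>G\<^esub> g) \<otimes>\<^bsub>G\<^esub> (g \<otimes>\<^bsub>G\<^esub> inv\<^bsub>G\<^esub> h)"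
  proof -
    have "inv\<^bsub>G\<^esub> g \<otimes>\<^bsub>G\<^esub> (g \<otimes>\<^bsub>G\<^esub> inv\<^bsub>G\<^esub> h) = inv\<^bsub>G\<^esub> h" using v(2,3) by (simp flip: G.m_assoc)
    then show ?thesis using v(2,3) w(2,3) by (simp add: G.inv_mult_group G.m_assoc)
  qed
  have "\<kappa> (g \<otimes>\<^bsub>G\<^esub> g' \<otimes>\<^bsub>G\<^esub> inv\<^bsub>G\<^esub> (h \<otimes>\<^bsub>G\<^esub> h')) = \<kappa> (g' \<otimes>\<^bsub>G\<^esub> inv\<^bsub>G\<^esub> h') \<otimes>\<^bsub>A\<^esub> \<kappa> (g \<otimes>\<^bsub>G\<^esub> inv\<^bsub>G\<^esub> h)"
    unfolding eq using x y' \<kappa>_conj[OF v(2) y] by simp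
  moreover have "g \<otimes>\<^bsub>G\<^esub> g' \<otimes>\<^bsub>G\<^esub> inv\<^bsub>G\<^esub> (h \<otimes>\<^bsub>G\<^esub> h') \<in> K" unfolding eq using x y' by simp
  ultimately show "v \<otimes>\<^bsub>W\<^esub> w \<in> S"
    using v w x y by (simp add: mem_S A.inv_mult A.m_comm)
qed

abbreviation E :: "('a, 'g, 'g, ('a \<times> 'g \<times> 'g) set) fbiset" where "E \<equiv> coset_fbiset W S"

lemma e_element_eq: "e_element k A G K \<kappa> = kburnside_class k A G G E"
  by (simp add: e_element_def transitive_fbiset_eq_coset_fbiset S_def)

lemma fibered_E: "fibered A G G E"
  by unfold_locales (rule fibered_coset_fbiset[OF subgroup_S finite_G finite_G], simp add: mem_S)

text \<open>Moving \<open>(1, 1, l)\<close> past \<open>(a, g, h)\<close> replaces \<open>l\<close> by a conjugate, which is again in the kernel of \<open>\<kappa>\<close>, and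
  \<open>S\<close> contains \<open>(1, 1, l')\<close> for all \<open>l'\<close> in this kernel.\<close>

lemma kernel_acts_trivially:
  assumes l: "l \<in> K" "\<kappa> l = \<one>\<^bsub>A\<^esub>" and c: "c \<in> fst E"
  shows "snd E (\<one>\<^bsub>A\<^esub>, \<one>\<^bsub>G\<^esub>, l) c = c"
proof -
  obtain a g h where w: "(a, g, h) \<in> carrier W" "c = (a, g, h) <#\<^bsub>W\<^esub> S"
    using c by (auto elim!: coset_fbiset_cases)
  have x: "inv\<^bsub>G\<^esub> h \<otimes>\<^bsub>G\<^esub> l \<otimes>\<^bsub>G\<^esub> h \<in> K" using K.inv_op_closed1[of h l] w l by simp
  have "\<kappa> (inv\<^bsub>G\<^esub> h \<otimes>\<^bsub>G\<^esub> l \<otimes>\<^bsub>G\<^esub> h) = \<one>\<^bsub>A\<^esub>" using \<kappa>_conj[of "inv\<^bsub>G\<^esub> h" l] w l by simp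
  then have "inv\<^bsub>W\<^esub> (a, g, h) \<otimes>\<^bsub>W\<^esub> (a, g, l \<otimes>\<^bsub>G\<^esub> h) \<in> S"
    using w(1) x l K.m_inv_closed[OF x] by (simp add: mem_S G.m_assoc)
  then have "(a, g, l \<otimes>\<^bsub>G\<^esub> h) <#\<^bsub>W\<^esub> S = (a, g, h) <#\<^bsub>W\<^esub> S"
    using W.l_coset_eq_iff[OF subgroup_S, of "(a, g, l \<otimes>\<^bsub>G\<^esub> h)" "(a, g, h)"] w(1) l(1) by simp
  then show ?thesis
    using coset_fbiset_act[OF subgroup_S, of "(\<one>\<^bsub>A\<^esub>, \<one>\<^bsub>G\<^esub>, l)" "(a, g, h)"] w l(1) by simp
qed

lemma e_element_in_I_ideal:
  assumes k: "cring k" and "\<not> inj_on \<kappa> K"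
  shows "e_element k A G K \<kappa> \<in> I_ideal k A G"
  unfolding e_element_eq
proof (rule inflation_in_I_ideal[OF k finite_G fibered_E])
  let ?L = "{x \<in> K. \<kappa> x = \<one>\<^bsub>A\<^esub>}"
  have "subgroup ?L G"
    by (rule G.subgroupI) (use K.one_closed in \<open>auto intro!: exI[of _ "\<one>\<^bsub>G\<^esub>"]\<close>)
  moreover have "g \<otimes>\<^bsub>G\<^esub> x \<otimes>\<^bsub>G\<^esub> inv\<^bsub>G\<^esub> g \<in> ?L" if "g \<in> carrier G" "x \<in> ?L" for g x
    using that K.inv_op_closed2 \<kappa>_conj by auto
  ultimately show "?L \<lhd> G" by (simp add: G.normal_inv_iff)
  obtain x y where xy: "x \<in> K" "y \<in> K" "\<kappa> x = \<kappa> y" "x \<noteq> y" using assms(2) by (auto simp: inj_on_def)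
  have "x \<otimes>\<^bsub>G\<^esub> inv\<^bsub>G\<^esub> y \<noteq> \<one>\<^bsub>G\<^esub>"
    using xy G.inv_equality[of x "inv\<^bsub>G\<^esub> y"] by auto
  moreover have "x \<otimes>\<^bsub>G\<^esub> inv\<^bsub>G\<^esub> y \<in> ?L" using xy by simp
  ultimately show "?L \<noteq> {\<one>\<^bsub>G\<^esub>}" by blast
qed (use kernel_acts_trivially in auto)

text \<open>The biset of \<open>e\<close> is transitive and its base point has stabilizer \<open>S\<close>, so the count is 1.\<close>

lemma typed_orbits_E: "typed_orbits S E = {fst E}"
proof -
  interpret E: fibered A G G E by (rule fibered_E)
  have base: "S \<in> fst E" "\<And>w. w \<in> carrier W \<Longrightarrow> snd E w S = w <#\<^bsub>W\<^esub> S"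
  proof -
    have one: "\<one>\<^bsub>W\<^esub> <#\<^bsub>W\<^esub> S = S" using W.lcos_mult_one[OF subgroup.subset[OF subgroup_S]] .
    show "S \<in> fst E" using coset_in_coset_fbiset[OF W.one_closed, of S] unfolding one .
    show "snd E w S = w <#\<^bsub>W\<^esub> S" if "w \<in> carrier W" for w
      using coset_fbiset_act[OF subgroup_S that W.one_closed] that unfolding one by (simp only: W.r_one)
  qed
  have orbit: "orbit W (snd E) c = fst E" if c: "c \<in> fst E" for c
  proof -
    obtain v where v: "v \<in> carrier W" "c = v <#\<^bsub>W\<^esub> S" using c by (rule coset_fbiset_cases)
    show ?thesis
    proof (intro equalityI subsetI)
      fix d assume "d \<in> fst E"
      then obtain w where w: "w \<in> carrier W" "d = w <#\<^bsub>W\<^esub> S" by (rule coset_fbiset_cases)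
      have "snd E (w \<otimes>\<^bsub>W\<^esub> inv\<^bsub>W\<^esub> v) c = d"
        unfolding v(2) w(2) using v(1) w(1)
        by (simp only: coset_fbiset_act[OF subgroup_S] W.m_closed W.inv_closed W.m_assoc W.l_inv W.r_one)
      moreover have "w \<otimes>\<^bsub>W\<^esub> inv\<^bsub>W\<^esub> v \<in> carrier W" using v(1) w(1) by (intro W.m_closed W.inv_closed)
      ultimately show "d \<in> orbit W (snd E) c" unfolding orbit_def by blast
    qed (use c in \<open>auto simp: orbit_def\<close>)
  qed
  have "stabilizer W (snd E) S = S"
  proof -
    have "snd E w S = S \<longleftrightarrow> w \<in> S" if "w \<in> carrier W" for w
      using W.l_coset_eq_iff[OF subgroup_S that W.one_closed]
      by (simp only: base(2)[OF that] W.lcos_mult_one[OF subgroup.subset[OF subgroup_S]] W.inv_one W.l_one[OF that])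
    then show ?thesis using subgroup.subset[OF subgroup_S] by (auto simp: stabilizer_def)
  qed
  then show ?thesis unfolding typed_orbits_def using orbit base(1) by blast
qed

end

section \<open>Faithful characters on commutators\<close>

context invariant_pair
begin

text \<open>The stabilizer \<open>D\<close> of \<open>x\<close> alone forces the order of \<open>H\<close> up: it must project onto \<open>G\<close>, and each
  \<open>l\<close> with \<open>(a, l, 1) \<in> D\<close> is, being a product of commutators, matched by some \<open>(\<kappa> l, 1, h) \<in> D\<close>. Counting
  \<open>D\<close> over \<open>G\<close> and over \<open>H\<close> then gives \<open>|G| \<le> |H|\<close>.\<close>

lemma stabilizer_tensor_point_neq:
  assumes P: "fibered_pair A G H G X Y" and fin_H: "finite (carrier H)" and small: "order H < order G"
    and inj: "inj_on \<kappa> K" and comm: "K \<subseteq> derived G (carrier G)"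
    and \<omega>: "\<omega> \<in> fst (fbiset_tensor A G H G X Y)"
  shows "stabilizer W (snd (fbiset_tensor A G H G X Y)) \<omega> \<noteq> S"
proof
  interpret P: fibered_pair A G H G X Y by fact
  assume S: "stabilizer W (snd P.T) \<omega> = S"
  obtain x y where xy: "\<omega> = P.pt x y" and x: "x \<in> fst X" and y: "y \<in> fst Y"
    using \<omega> by (rule P.tensor_cases)
  define D where "D = stabilizer P.X.W (snd X) x"
  have mem_D: "(a, g, h) \<in> D \<longleftrightarrow> a \<in> carrier A \<and> g \<in> carrier G \<and> h \<in> carrier H \<and> snd X (a, g, h) x = x" for a g h
    by (auto simp: D_def stabilizer_def)
  have mult_D: "(a \<otimes>\<^bsub>A\<^esub> a', g \<otimes>\<^bsub>G\<^esub> g', h \<otimes>\<^bsub>H\<^esub> h') \<in> D" if "(a, g, h) \<in> D" "(a', g', h') \<in> D" for a g h a' g' h'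
    using that x by (auto simp: mem_D simp flip: P.X.act_act)
  have inv_D: "(inv\<^bsub>A\<^esub> a, inv\<^bsub>G\<^esub> g, inv\<^bsub>H\<^esub> h) \<in> D" if "(a, g, h) \<in> D" for a g h
    using that x P.X.act_act[of "inv\<^bsub>A\<^esub> a" "inv\<^bsub>G\<^esub> g" "inv\<^bsub>H\<^esub> h" a g h x] by (auto simp: mem_D)
  \<comment> \<open>the diagonal element \<open>(1, g, g)\<close> of \<open>S\<close> changes \<open>(x, y)\<close> only within its orbit\<close>
  have surj: "\<exists>a h. (a, g, h) \<in> D" if g: "g \<in> carrier G" for g
  proof -
    have "(\<one>\<^bsub>A\<^esub>, g, g) \<in> S" using g K.one_closed by (simp add: mem_S)
    then have "snd P.T (\<one>\<^bsub>A\<^esub>, g, g) \<omega> = \<omega>" unfolding S[symmetric] by (simp add: stabilizer_def)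
    then have "P.pt (snd X (\<one>\<^bsub>A\<^esub>, g, \<one>\<^bsub>H\<^esub>) x) (snd Y (\<one>\<^bsub>A\<^esub>, \<one>\<^bsub>H\<^esub>, g) y) = P.pt x y"
      using P.snd_tensor[of "\<one>\<^bsub>A\<^esub>" g g x y] g x y \<omega> xy by simp
    then obtain a h where a: "a \<in> carrier A" "h \<in> carrier H"
      and eq: "snd X (\<one>\<^bsub>A\<^esub>, g, \<one>\<^bsub>H\<^esub>) x = snd X (inv\<^bsub>A\<^esub> a, \<one>\<^bsub>G\<^esub>, h) x"
      using P.pt_eq_iff[OF x y] g x y by auto
    have "snd X (a, g, inv\<^bsub>H\<^esub> h) x = snd X (a, \<one>\<^bsub>G\<^esub>, inv\<^bsub>H\<^esub> h) (snd X (\<one>\<^bsub>A\<^esub>, g, \<one>\<^bsub>H\<^esub>) x)"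
      using a g x by (simp add: P.X.act_act)
    also have "\<dots> = x" unfolding eq using a x by (simp add: P.X.act_act)
    finally have "(a, g, inv\<^bsub>H\<^esub> h) \<in> D" using a g by (simp add: mem_D)
    then show ?thesis by blast
  qed
  \<comment> \<open>an element that fixes \<open>x\<close> and does not involve \<open>H\<close> fixes \<open>x \<otimes> y\<close>\<close>
  have left: "l \<in> K \<and> a = inv\<^bsub>A\<^esub> \<kappa> l" if "(a, l, \<one>\<^bsub>H\<^esub>) \<in> D" for a l
  proof -
    have "snd P.T (a, l, \<one>\<^bsub>G\<^esub>) \<omega> = \<omega>"
      using P.snd_tensor[of a l "\<one>\<^bsub>G\<^esub>" x y] that x y \<omega> xy by (simp add: mem_D)
    then have "(a, l, \<one>\<^bsub>G\<^esub>) \<in> S" unfolding S[symmetric] using that by (simp add: stabilizer_def mem_D)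
    then show ?thesis by (auto simp: mem_S)
  qed
  \<comment> \<open>commutators of elements of \<open>D\<close> have trivial component in \<open>A\<close>\<close>
  have derived: "\<exists>h. (\<one>\<^bsub>A\<^esub>, l, h) \<in> D" if l: "l \<in> derived G (carrier G)" for l
  proof -
    let ?C = "{l. \<exists>h. (\<one>\<^bsub>A\<^esub>, l, h) \<in> D}"
    have "subgroup ?C G"
    proof (rule G.subgroupI)
      show "?C \<subseteq> carrier G" by (auto simp: mem_D)
      have "(\<one>\<^bsub>A\<^esub>, \<one>\<^bsub>G\<^esub>, \<one>\<^bsub>H\<^esub>) \<in> D" using x by (simp add: mem_D)
      then show "?C \<noteq> {}" by blast
      show "inv\<^bsub>G\<^esub> g \<in> ?C" if "g \<in> ?C" for g using that inv_D[of "\<one>\<^bsub>A\<^esub>" g] by auto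
      show "g \<otimes>\<^bsub>G\<^esub> g' \<in> ?C" if "g \<in> ?C" "g' \<in> ?C" for g g'
        using that mult_D[of "\<one>\<^bsub>A\<^esub>" g _ "\<one>\<^bsub>A\<^esub>" g'] by auto
    qed
    moreover have "derived_set G (carrier G) \<subseteq> ?C"
    proof
      fix c assume "c \<in> derived_set G (carrier G)"
      then obtain g g' where g: "g \<in> carrier G" "g' \<in> carrier G"
        and c: "c = g \<otimes>\<^bsub>G\<^esub> g' \<otimes>\<^bsub>G\<^esub> inv\<^bsub>G\<^esub> g \<otimes>\<^bsub>G\<^esub> inv\<^bsub>G\<^esub> g'" by auto
      obtain a h where d: "(a, g, h) \<in> D" using surj[OF g(1)] by blast
      obtain a' h' where d': "(a', g', h') \<in> D" using surj[OF g(2)] by blast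
      have "a \<otimes>\<^bsub>A\<^esub> a' \<otimes>\<^bsub>A\<^esub> inv\<^bsub>A\<^esub> a \<otimes>\<^bsub>A\<^esub> inv\<^bsub>A\<^esub> a' = \<one>\<^bsub>A\<^esub>"
        using d d' A.m_comm[of a a'] by (simp add: mem_D A.m_assoc)
      then show "c \<in> ?C" using mult_D[OF mult_D[OF mult_D[OF d d'] inv_D[OF d]] inv_D[OF d']] c by auto
    qed
    ultimately show ?thesis using G.generate_subgroup_incl l unfolding derived_def by blast
  qed
  define L where "L = {l. \<exists>a. (a, l, \<one>\<^bsub>H\<^esub>) \<in> D}"
  have L_K: "L \<subseteq> K" using left by (auto simp: L_def)
  \<comment> \<open>the quotient of \<open>(1, l, h)\<close> by \<open>(\<kappa>(l)\<^sup>-\<^sup>1, l, 1)\<close>\<close>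
  have right: "\<exists>h. (\<kappa> l, \<one>\<^bsub>G\<^esub>, h) \<in> D" if "l \<in> L" for l
  proof -
    have l: "l \<in> K" and d: "(inv\<^bsub>A\<^esub> \<kappa> l, l, \<one>\<^bsub>H\<^esub>) \<in> D" using that left by (auto simp: L_def)
    obtain h where h: "(\<one>\<^bsub>A\<^esub>, l, h) \<in> D" using derived comm l by blast
    have "h \<in> carrier H" using h by (simp add: mem_D)
    then show ?thesis using mult_D[OF h inv_D[OF d]] l by auto
  qed
  obtain \<alpha> \<beta> where \<alpha>: "\<And>g. g \<in> carrier G \<Longrightarrow> (\<alpha> g, g, \<beta> g) \<in> D" using surj by metis
  obtain \<eta> where \<eta>: "\<And>l. l \<in> L \<Longrightarrow> (\<kappa> l, \<one>\<^bsub>G\<^esub>, \<eta> l) \<in> D" using right by metis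
  \<comment> \<open>over \<open>g\<close>, the translates of \<open>(\<alpha> g, g, \<beta> g)\<close> differ in \<open>A\<close> because \<open>\<kappa>\<close> is injective\<close>
  define p where "p = (\<lambda>(g, l). (\<alpha> g \<otimes>\<^bsub>A\<^esub> \<kappa> l, g, \<beta> g \<otimes>\<^bsub>H\<^esub> \<eta> l))"
  have p_D: "p ` (carrier G \<times> L) \<subseteq> D"
    using mult_D[OF \<alpha> \<eta>] by (auto simp: p_def)
  have p_inj: "inj_on p (carrier G \<times> L)"
  proof (rule inj_onI, clarsimp simp: p_def)
    fix g l l' assume g: "g \<in> carrier G" and l: "l \<in> L" "l' \<in> L"
      and eq: "\<alpha> g \<otimes>\<^bsub>A\<^esub> \<kappa> l = \<alpha> g \<otimes>\<^bsub>A\<^esub> \<kappa> l'"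
    moreover have "\<alpha> g \<in> carrier A" "l \<in> K" "l' \<in> K" using \<alpha>[OF g] l L_K by (auto simp: mem_D)
    ultimately have "\<kappa> l = \<kappa> l'" by simp
    then show "l = l'" using inj l L_K by (auto dest: inj_onD)
  qed
  define \<gamma> where "\<gamma> h = (SOME g. \<exists>a. (a, g, h) \<in> D)" for h
  have \<gamma>: "\<exists>a. (a, \<gamma> h, h) \<in> D" if "(a, g, h) \<in> D" for a g h
    unfolding \<gamma>_def by (rule someI_ex) (use that in blast)
  \<comment> \<open>over \<open>h\<close>, two elements of \<open>D\<close> differ by some \<open>(a, l, 1) \<in> D\<close>, where \<open>l\<close> determines \<open>a\<close>\<close>
  define q where "q = (\<lambda>(a :: 'a, g, h). (h, g \<otimes>\<^bsub>G\<^esub> inv\<^bsub>G\<^esub> \<gamma> h))"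
  have q_HL: "q ` D \<subseteq> carrier H \<times> L"
  proof
    fix z assume "z \<in> q ` D"
    then obtain a g h where d: "(a, g, h) \<in> D" and z: "z = (h, g \<otimes>\<^bsub>G\<^esub> inv\<^bsub>G\<^esub> \<gamma> h)" by (auto simp: q_def)
    obtain b where "(b, \<gamma> h, h) \<in> D" using \<gamma>[OF d] by blast
    from mult_D[OF d inv_D[OF this]] show "z \<in> carrier H \<times> L" using d by (auto simp: z L_def mem_D)
  qed
  have q_inj: "inj_on q D"
  proof (rule inj_onI, clarsimp simp: q_def)
    fix a g h a' g' assume d: "(a, g, h) \<in> D" "(a', g', h) \<in> D"
      and eq: "g \<otimes>\<^bsub>G\<^esub> inv\<^bsub>G\<^esub> \<gamma> h = g' \<otimes>\<^bsub>G\<^esub> inv\<^bsub>G\<^esub> \<gamma> h"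
    have "\<gamma> h \<in> carrier G" using \<gamma>[OF d(1)] by (auto simp: mem_D)
    then have g: "g = g'" using eq d by (simp add: mem_D)
    have "a \<otimes>\<^bsub>A\<^esub> inv\<^bsub>A\<^esub> a' = \<one>\<^bsub>A\<^esub>"
      using mult_D[OF d(1) inv_D[OF d(2)]] g d P.X.free[of "a \<otimes>\<^bsub>A\<^esub> inv\<^bsub>A\<^esub> a'" x] x by (simp add: mem_D)
    then have "a = a'" using d A.inv_equality[of a "inv\<^bsub>A\<^esub> a'"] by (simp add: mem_D)
    then show "a = a' \<and> g = g'" using g by simp
  qed
  have fin_L: "finite L" using L_K K.subset finite_G by (meson finite_subset)
  have "card (carrier G \<times> L) \<le> card D"
    using card_inj_on_le[OF p_inj p_D] inj_on_finite[OF q_inj q_HL] fin_H fin_L by simp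
  also have "\<dots> \<le> card (carrier H \<times> L)"
    using card_inj_on_le[OF q_inj q_HL] fin_H fin_L by simp
  finally have "card (carrier G) * card L \<le> card (carrier H) * card L" by (simp add: card_cartesian_product)
  moreover have "\<one>\<^bsub>G\<^esub> \<in> L" unfolding L_def using x by (auto simp: mem_D intro!: exI[of _ "\<one>\<^bsub>A\<^esub>"])
  then have "card L > 0" using fin_L card_gt_0_iff by blast
  ultimately show False using small by (simp add: order_def)
qed

text \<open>The linear form \<open>F\<close> that counts orbits of type \<open>S\<close> has the value 1 at \<open>e\<close> and vanishes on \<open>I\<^sub>G\<close>.\<close>

lemma e_element_not_in_I_ideal:
  assumes k: "cring k" and one: "\<one>\<^bsub>k\<^esub> \<noteq> \<zero>\<^bsub>k\<^esub>" and inj: "inj_on \<kappa> K" and comm: "K \<subseteq> derived G (carrier G)"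
  shows "e_element k A G K \<kappa> \<notin> I_ideal k A G"
proof
  interpret M: comm_group "add_monoid k"
    using abelian_group.a_comm_group[OF ring.is_abelian_group[OF cring.axioms(1)[OF k]]] .
  interpret k: cring k by fact
  interpret B: comm_group "burnside_group A G G" by (rule comm_group_burnside)
  interpret E: fibered A G G E by (rule fibered_E)
  obtain N where N: "N \<in> hom (burnside_group A G G) integer_group"
    and Nc: "\<And>c. c \<in> iso_classes A G G \<Longrightarrow>
      N (presented_class (iso_classes A G G) (union_relations A G G) (frag_of c)) = class_count S c"
    using burnside_count by blast
  obtain F where F: "F \<in> hom (kburnside_group k A G G) (add_monoid k)"
    and Fr: "\<And>r b. \<lbrakk>r \<in> carrier k; b \<in> carrier (burnside_group A G G)\<rbrakk> \<Longrightarrow>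
      F (presented_class (tensor_generators k (burnside_group A G G)) (tensor_relations k (burnside_group A G G))
        (frag_of (r, b))) = r [^]\<^bsub>add_monoid k\<^esub> N b"
    using kburnside_functional[OF k N] by blast
  have kB: "comm_group (kburnside_group k A G G)"
    unfolding kburnside_group_def by (rule comm_group_presented_group[OF tensor_relations_subset[OF k]])
  interpret F: group_hom "kburnside_group k A G G" "add_monoid k" F
    using F kB M.is_group by (simp add: group_hom_def group_hom_axioms_def comm_group_def)
  have N0: "N (burnside_comp A G H G b c) = 0"
    if H: "group H" "finite (carrier H)" "order H < order G"
      and b: "b \<in> carrier (burnside_group A G H)" and c: "c \<in> carrier (burnside_group A H G)"
    for H :: "nat monoid" and b c
  proof -
    interpret H: group H by fact
    interpret four_groups A G H G ..
    have "N (presented_class (iso_classes A G G) (union_relations A G G) (frag_of (class_tensor A G H G c d))) = 0"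
      if c: "c \<in> iso_classes A G H" and d: "d \<in> iso_classes A H G" for c d
    proof -
      obtain X :: "('a, 'g, nat, 'a \<times> nat) fbiset" where X: "fibered A G H X" "c = iso_class A G H X"
        using c by (rule GH.iso_classes_cases)
      obtain Y :: "('a, nat, 'g, 'a \<times> nat) fbiset" where Y: "fibered A H G Y" "d = iso_class A H G Y"
        using d by (rule HI.iso_classes_cases)
      interpret P: fibered_pair A G H G X Y using X Y by (intro fibered_pairI)
      have "typed_orbits S P.T = {}"
        using stabilizer_tensor_point_neq[OF P.fibered_pair_axioms H(2,3) inj comm]
        unfolding typed_orbits_def by blast
      then show ?thesis
        unfolding X Y P.class_tensor_iso_class Nc[OF P.tensor.iso_class_in_iso_classes]
          class_count_iso_class[OF P.tensor.fibered_axioms] by simp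
    qed
    then show ?thesis
      using comp.induced_bilinear_vanishes[of N integer_group b c] N b c
      by (simp add: burnside_comp_def burnside_group_def)
  qed
  have F0: "kburnside_comp k A G H G P Q \<in> carrier (kburnside_group k A G G) \<and> F (kburnside_comp k A G H G P Q) = \<zero>\<^bsub>k\<^esub>"
    if H: "group H" "finite (carrier H)" "order H < order G"
      and P: "P \<in> carrier (kburnside_group k A G H)" and Q: "Q \<in> carrier (kburnside_group k A H G)"
    for H :: "nat monoid" and P Q
  proof -
    interpret H: group H by fact
    interpret four_groups A G H G ..
    interpret kcomp: presented_bilinear
      "tensor_generators k (burnside_group A G H)" "tensor_relations k (burnside_group A G H)"
      "tensor_generators k (burnside_group A H G)" "tensor_relations k (burnside_group A H G)"
      "tensor_generators k (burnside_group A G G)" "tensor_relations k (burnside_group A G G)"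
      "\<lambda>(r, b) (s, c). (r \<otimes>\<^bsub>k\<^esub> s, burnside_comp A G H G b c)"
      by (rule kcomp_presented_bilinear[OF k])
    have "F (kburnside_comp k A G H G P Q) = \<one>\<^bsub>add_monoid k\<^esub>"
      unfolding kburnside_comp_def
    proof (rule kcomp.induced_bilinear_vanishes)
      show "F \<in> hom (presented_group (tensor_generators k (burnside_group A G G)) (tensor_relations k (burnside_group A G G))) (add_monoid k)"
        using F by (simp add: kburnside_group_def)
      show "group (add_monoid k)" by (rule M.is_group)
      show "P \<in> carrier (presented_group (tensor_generators k (burnside_group A G H)) (tensor_relations k (burnside_group A G H)))"
        "Q \<in> carrier (presented_group (tensor_generators k (burnside_group A H G)) (tensor_relations k (burnside_group A H G)))"
        using P Q by (simp_all add: kburnside_group_def)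
      fix x y assume "x \<in> tensor_generators k (burnside_group A G H)" "y \<in> tensor_generators k (burnside_group A H G)"
      then obtain r b s c where xy: "x = (r, b)" "y = (s, c)" "r \<in> carrier k" "s \<in> carrier k"
        "b \<in> carrier (burnside_group A G H)" "c \<in> carrier (burnside_group A H G)"
        by (auto simp: tensor_generators_def)
      then have "F (presented_class (tensor_generators k (burnside_group A G G)) (tensor_relations k (burnside_group A G G))
          (frag_of (r \<otimes>\<^bsub>k\<^esub> s, burnside_comp A G H G b c))) = (r \<otimes>\<^bsub>k\<^esub> s) [^]\<^bsub>add_monoid k\<^esub> (0 :: int)"
        using Fr[of "r \<otimes>\<^bsub>k\<^esub> s" "burnside_comp A G H G b c"] burnside_comp_closed N0[OF H] by simp
      then show "F (presented_class (tensor_generators k (burnside_group A G G)) (tensor_relations k (burnside_group A G G))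
          (frag_of ((case x of (r, b) \<Rightarrow> \<lambda>(s, c). (r \<otimes>\<^bsub>k\<^esub> s, burnside_comp A G H G b c)) y))) = \<one>\<^bsub>add_monoid k\<^esub>"
        using xy by simp
    qed
    moreover have "kburnside_comp k A G H G P Q \<in> carrier (kburnside_group k A G G)"
      using kcomp.induced_bilinear_closed[of P Q] P Q by (simp add: kburnside_comp_def kburnside_group_def)
    ultimately show ?thesis by simp
  qed
  have "I_ideal k A G \<subseteq> kernel (kburnside_group k A G G) (add_monoid k) F"
    unfolding I_ideal_def
    by (rule group.generate_subgroup_incl[OF F.G.is_group _ F.subgroup_kernel])
      (use F0 in \<open>auto simp: kernel_def\<close>)
  moreover assume "e_element k A G K \<kappa> \<in> I_ideal k A G"
  ultimately have "F (e_element k A G K \<kappa>) = \<zero>\<^bsub>k\<^esub>" by (auto simp: kernel_def)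
  moreover have "N (burnside_class A G G E) = 1"
    unfolding burnside_class_def Nc[OF E.iso_class_in_iso_classes] class_count_iso_class[OF fibered_E] typed_orbits_E
    by simp
  then have "F (e_element k A G K \<kappa>) = \<one>\<^bsub>k\<^esub>"
    unfolding e_element_eq kburnside_class_def
    using Fr[OF k.one_closed E.burnside_class_closed] M.int_pow_1[of "\<one>\<^bsub>k\<^esub>"] by simp
  ultimately show False using one by simp
qed

text \<open>An element of \<open>K\<close> and its conjugates have the same value under \<open>\<kappa>\<close>, hence are equal.\<close>

lemma inj_imp_central:
  assumes "inj_on \<kappa> K"
  shows "K \<subseteq> center G"
proof
  fix x assume x: "x \<in> K"
  have "x \<otimes>\<^bsub>G\<^esub> g = g \<otimes>\<^bsub>G\<^esub> x" if g: "g \<in> carrier G" for g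
  proof -
    have "g \<otimes>\<^bsub>G\<^esub> x \<otimes>\<^bsub>G\<^esub> inv\<^bsub>G\<^esub> g = x"
      using inj_onD[OF assms \<kappa>_conj[OF g x]] K.inv_op_closed2[OF g x] x by simp
    then show ?thesis using G.inv_solve_right'[of x "g \<otimes>\<^bsub>G\<^esub> x" g] g x by simp
  qed
  then show "x \<in> center G" using x by (simp add: center_def)
qed

end

theorem proposition8p6:
  fixes A :: "('a, 'm) monoid_scheme"
    and k :: "('k, 'n) ring_scheme"
    and G :: "('g, 'p) monoid_scheme"
    and K :: "'g set"
    and \<kappa> :: "'g \<Rightarrow> 'a"
  assumes "comm_group A"
    and "cring k"
    and "group G" "finite (carrier G)"
    and "(K, \<kappa>) \<in> M_pairs_fixed A G"
  shows "((K, \<kappa>) \<in> reduced_pairs k A G \<longrightarrow> inj_on \<kappa> K \<and> K \<subseteq> center G) \<and>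
         (\<one>\<^bsub>k\<^esub> \<noteq> \<zero>\<^bsub>k\<^esub> \<longrightarrow> inj_on \<kappa> K \<longrightarrow> K \<subseteq> derived G (carrier G)
            \<longrightarrow> (K, \<kappa>) \<in> reduced_pairs k A G)"
proof -
  interpret invariant_pair A G K \<kappa>
    using assms by (simp add: invariant_pair_def invariant_pair_axioms_def)
  show ?thesis
    using e_element_in_I_ideal[OF assms(2)] e_element_not_in_I_ideal[OF assms(2)] inj_imp_central assms(5)
    by (auto simp: reduced_pairs_def)
qed

end
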